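(* Let $$\mathcal Q_{41}=(\{123,145,167,246,258,357,368,478\},\emptyset),\qquad \mathcal Q_{63}=(\{123,145,246,356\},\{125678,134678,234578\}).$$ Every candidate quatroid is representable over $\mathbb Q$, except for those in the $\mathfrak S_8$-orbits of $\mathcal Q_{41}$ and $\mathcal Q_{63}$. Those in the orbit of $\mathcal Q_{41}$ are representable over $\mathbb C$ but not over $\mathbb R$. Those in the orbit of $\mathcal Q_{63}$ are not representable over $\mathbb C$.
   Context: For a field $\mathbb K$, let $\mathcal P_{\mathbb K}\subset(\mathbb P^2_{\mathbb K})^8$ be the set of ordered $8$-tuples of pairwise distinct points. A conic is an irreducible plane quadric. A pair $\mathcal Q=(\mathcal I,\mathcal J)$ consists of a set $\mathcal I$ of $3$-subsets and a set $\mathcal J$ of $6$-subsets of $\{1,\dots,8\}$ ($123$ abbreviates $\{1,2,3\}$, etc.). $\mathcal Q$ is representable over $\mathbb K$ if there is $\mathbf p\in\mathcal P_{\mathbb K}$ such that the triples of points of $\mathbf p$ lying on a line are exactly those indexed by $\mathcal I$ and the sextuples of points of $\mathbf p$ lying on a conic are exactly those indexed by $\mathcal J$. The group $\mathfrak S_8$ acts on pairs by permuting $\{1,\dots,8\}$. A pair satisfies Bézout's weak criteria if (1) $|I\cap J|\le2$ for all $I\in\mathcal I$, $J\in\mathcal J$; (2) whenever distinct $I_1,I_2\in\mathcal I$ have $|I_1\cap I_2|>1$, every $3$-subset of $I_1\cup I_2$ is in $\mathcal I$; (3) whenever distinct $J_1,J_2\in\mathcal J$ have $|J_1\cap J_2|>4$,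 every $6$-subset of $J_1\cup J_2$ is in $\mathcal J$. A pair is matroidal if there is $\mathbf p\in\mathcal P_{\mathbb C}$ whose collinear triples are exactly those indexed by $\mathcal I$. A candidate quatroid is a matroidal pair satisfying Bézout's weak criteria. *)

theory Defs
  imports
    "HOL-Analysis.Finite_Cartesian_Product"
    "HOL-Library.Poly_Mapping"
    "HOL-Computational_Algebra.Factorial_Ring"
    "HOL-Combinatorics.Permutations"
    Complex_Main
begin

definition proj_rel :: "'a::field ^ 3 \<Rightarrow> 'a ^ 3 \<Rightarrow> bool" where
  "proj_rel v w \<longleftrightarrow> v \<noteq> 0 \<and> w \<noteq> 0 \<and> (\<exists>c. c \<noteq> 0 \<and> w = c *s v)"

lemma part_equivp_proj_rel: "part_equivp (proj_rel :: 'a::field ^ 3 \<Rightarrow> _)"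
proof (rule part_equivpI)
  have "proj_rel (axis 1 1 :: 'a ^ 3) (axis 1 1)"
    unfolding proj_rel_def by (auto simp: axis_eq_0_iff intro!: exI[of _ 1])
  then show "\<exists>v :: 'a ^ 3. proj_rel v v" ..
  show "symp (proj_rel :: 'a ^ 3 \<Rightarrow> _)"
  proof (rule sympI)
    fix v w :: "'a ^ 3"
    assume "proj_rel v w"
    then obtain c where "v \<noteq> 0" "w \<noteq> 0" "c \<noteq> 0" "w = c *s v"
      unfolding proj_rel_def by blast
    then show "proj_rel w v"
      unfolding proj_rel_def by (auto simp: vector_smult_assoc intro!: exI[of _ "inverse c"])
  qed
  show "transp (proj_rel :: 'a ^ 3 \<Rightarrow> _)"
  proof (rule transpI)
    fix u v w :: "'a ^ 3"
    assume "proj_rel u v" "proj_rel v w"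
    then obtain c d where "u \<noteq> 0" "w \<noteq> 0" "c \<noteq> 0" "d \<noteq> 0" "v = c *s u" "w = d *s v"
      unfolding proj_rel_def by blast
    then show "proj_rel u w"
      unfolding proj_rel_def by (auto simp: vector_smult_assoc intro!: exI[of _ "d * c"])
  qed
qed

quotient_type (overloaded) 'a proj_plane = "('a::field) ^ 3" / partial: proj_rel
  by (rule part_equivp_proj_rel)

definition lines :: "'a::field proj_plane set set" where
  "lines = {abs_proj_plane ` {v. v \<noteq> 0 \<and> (\<Sum>i\<in>UNIV. a $ i * v $ i) = 0} | a. a \<noteq> 0}"

text \<open>
  The polynomial ring in three variables over \<open>'a\<close>: a monomial is an exponent vector of type
  \<open>3 \<Rightarrow>\<^sub>0 nat\<close>, and multiplication is the convolution product on finitely supported functions.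
\<close>

type_synonym 'a mpoly3 = "(3 \<Rightarrow>\<^sub>0 nat) \<Rightarrow>\<^sub>0 'a"

definition eval_mpoly3 :: "'a::field mpoly3 \<Rightarrow> 'a ^ 3 \<Rightarrow> 'a" where
  "eval_mpoly3 f v =
     (\<Sum>m\<in>Poly_Mapping.keys f.
        Poly_Mapping.lookup f m * (\<Prod>i\<in>UNIV. v $ i ^ Poly_Mapping.lookup m i))"

definition homogeneous :: "nat \<Rightarrow> 'a::field mpoly3 \<Rightarrow> bool" where
  "homogeneous d f \<longleftrightarrow>
     (\<forall>m\<in>Poly_Mapping.keys f. (\<Sum>i\<in>UNIV. Poly_Mapping.lookup m i) = d)"

text \<open>
  A conic is given by an irreducible quadratic form; irreducibility is over the ground field
  \<open>'a\<close> itself. In characteristic different from 2 this does not affect which sextuples of points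
  lie on a conic: a quadratic form that is irreducible over the ground field but splits over its
  algebraic closure has at most one zero in the plane over the ground field.
\<close>

definition conics :: "'a::field proj_plane set set" where
  "conics = {abs_proj_plane ` {v. v \<noteq> 0 \<and> eval_mpoly3 f v = 0} | f. homogeneous 2 f \<and> irreducible f}"

text \<open>
  An 8-tuple of points is a function on \<open>nat\<close> of which only the values on \<open>{1..8}\<close> matter.
\<close>

definition collinear_triples :: "(nat \<Rightarrow> 'a::field proj_plane) \<Rightarrow> nat set set" where
  "collinear_triples p = {I. I \<subseteq> {1..8} \<and> card I = 3 \<and> (\<exists>L\<in>lines. p ` I \<subseteq> L)}"

definition coconic_sextuples :: "(nat \<Rightarrow> 'a::field proj_plane) \<Rightarrow> nat set set" where
  "coconic_sextuples p = {J. J \<subseteq> {1..8} \<and> card J = 6 \<and> (\<exists>C\<in>conics. p ` J \<subseteq> C)}"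

type_synonym index_pair = "nat set set \<times> nat set set"

definition is_index_pair :: "index_pair \<Rightarrow> bool" where
  "is_index_pair Q \<longleftrightarrow>
     (\<forall>I\<in>fst Q. I \<subseteq> {1..8} \<and> card I = 3) \<and> (\<forall>J\<in>snd Q. J \<subseteq> {1..8} \<and> card J = 6)"

definition representable :: "'a::field itself \<Rightarrow> index_pair \<Rightarrow> bool" where
  "representable K Q \<longleftrightarrow>
     (\<exists>p :: nat \<Rightarrow> 'a proj_plane.
        inj_on p {1..8} \<and> collinear_triples p = fst Q \<and> coconic_sextuples p = snd Q)"

definition matroidal :: "index_pair \<Rightarrow> bool" where
  "matroidal Q \<longleftrightarrow>
     (\<exists>p :: nat \<Rightarrow> complex proj_plane. inj_on p {1..8} \<and> collinear_triples p = fst Q)"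

definition bezout_weak :: "index_pair \<Rightarrow> bool" where
  "bezout_weak Q \<longleftrightarrow>
     (\<forall>I\<in>fst Q. \<forall>J\<in>snd Q. card (I \<inter> J) \<le> 2) \<and>
     (\<forall>I1\<in>fst Q. \<forall>I2\<in>fst Q. I1 \<noteq> I2 \<and> card (I1 \<inter> I2) > 1 \<longrightarrow>
        (\<forall>I. I \<subseteq> I1 \<union> I2 \<and> card I = 3 \<longrightarrow> I \<in> fst Q)) \<and>
     (\<forall>J1\<in>snd Q. \<forall>J2\<in>snd Q. J1 \<noteq> J2 \<and> card (J1 \<inter> J2) > 4 \<longrightarrow>
        (\<forall>J. J \<subseteq> J1 \<union> J2 \<and> card J = 6 \<longrightarrow> J \<in> snd Q))"

definition candidate_quatroid :: "index_pair \<Rightarrow> bool" where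
  "candidate_quatroid Q \<longleftrightarrow> is_index_pair Q \<and> matroidal Q \<and> bezout_weak Q"

definition permute_pair :: "(nat \<Rightarrow> nat) \<Rightarrow> index_pair \<Rightarrow> index_pair" where
  "permute_pair \<sigma> Q = ((\<lambda>I. \<sigma> ` I) ` fst Q, (\<lambda>J. \<sigma> ` J) ` snd Q)"

definition S8_orbit :: "index_pair \<Rightarrow> index_pair set" where
  "S8_orbit Q = {permute_pair \<sigma> Q | \<sigma>. \<sigma> permutes {1..8}}"

definition Q41 :: index_pair where
  "Q41 = ({{1,2,3}, {1,4,5}, {1,6,7}, {2,4,6}, {2,5,8}, {3,5,7}, {3,6,8}, {4,7,8}}, {})"

definition Q63 :: index_pair where
  "Q63 = ({{1,2,3}, {1,4,5}, {2,4,6}, {3,5,6}},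
          {{1,2,5,6,7,8}, {1,3,4,6,7,8}, {2,3,4,5,7,8}})"

end

(*
  By Bezout's weak criteria a pair is determined by its maximal collinear and coconic sets ("lines" and
  "conics"): two lines share at most 1 index, a line and a conic at most 2, two conics at most 4. Up to
  relabelling there are 128 such configurations. The catalogue contains one of each; it is complete by
  induction on the number of lines and conics, because every extension of a listed configuration by one
  line or conic is a relabelling of a listed configuration.

  Three points are collinear iff a 3x3 determinant vanishes, and six points lie on a conic iff no three of
  them are collinear and another 3x3 determinant, expressing the quadratic forms in a basis formed by three
  of the points, vanishes. With these criteria 124 configurations are realized by explicit integer points.
  Two of the others contain the Fano plane, so they are not matroidal. Realizing Q41 amounts to solving
  s^2 + s t + t^2 = 0 with s nonzero, which needs a primitive third root of unity. For Q63, the lines form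
  a complete quadrilateral with vertices 1, ..., 6, and the conics force the point 7 onto a diagonal of it
  or to coincide with 8.
*)
theory Submission
  imports Defs
    "HOL-Computational_Algebra.Polynomial"
    "HOL-Analysis.Cartesian_Space"
begin

subsection \<open>Ternary forms as polynomials\<close>

text \<open>The finite part is to be checked by rewriting with code equations, and this shapes the
  rest. Representability quantifies over irreducible forms, so it is first replaced by brackets,
  polynomial expressions without division. Their identities then hold for numbers, for test points
  over a computable ring, and for polynomials with the variables as arguments.

  Passing from brackets back to a conic requires an irreducible form. Factors of a form are again
  forms, so a quadratic form that is not irreducible would be a product of two linear forms and put
  three of six zeros on a line.

  A configuration can be dismantled by removing a block of least rank each time. Hence only blocks
  whose rank does not exceed the ranks already present have to be added, which keeps the enumeration
  small. No canonical forms are computed: each extension comes with an explicit permutation onto a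
  catalogue entry.

  The catalogue is combinatorial and therefore contains entries without any realization. They are
  treated in coordinates in which three noncollinear points of the configuration form the coordinate
  triangle.\<close>

definition poly_hom :: "('c::comm_ring_1 \<Rightarrow> 'b::comm_ring_1) \<Rightarrow> ('m::comm_monoid_add \<Rightarrow> 'b) \<Rightarrow> ('m \<Rightarrow>\<^sub>0 'c) \<Rightarrow> 'b" where
  "poly_hom h \<psi> f = (\<Sum>m\<in>Poly_Mapping.keys f. h (Poly_Mapping.lookup f m) * \<psi> m)"

lemma poly_mapping_sum_single:
  "(\<Sum>m\<in>Poly_Mapping.keys f. Poly_Mapping.single m (Poly_Mapping.lookup f m)) = f"
  by (rule poly_mapping_eqI)
     (auto simp: lookup_sum lookup_single when_def sum.delta in_keys_iff)

text \<open>The universal property of a monoid algebra: a ring homomorphism on the coefficients and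
  a monoid homomorphism from the exponents into the multiplicative monoid together extend to a ring
  homomorphism. There are two instances, evaluation at a vector and the grading by degree.\<close>

locale poly_hom_data =
  fixes h :: "'c::comm_ring_1 \<Rightarrow> 'b::comm_ring_1" and \<psi> :: "'m::comm_monoid_add \<Rightarrow> 'b"
  assumes h_0: "h 0 = 0" and h_1: "h 1 = 1"
    and h_add: "\<And>a b. h (a + b) = h a + h b" and h_mult: "\<And>a b. h (a * b) = h a * h b"
    and \<psi>_0: "\<psi> 0 = 1" and \<psi>_add: "\<And>m n. \<psi> (m + n) = \<psi> m * \<psi> n"
begin

lemma poly_hom_superset:
  assumes "finite A" "Poly_Mapping.keys f \<subseteq> A"
  shows "poly_hom h \<psi> f = (\<Sum>m\<in>A. h (Poly_Mapping.lookup f m) * \<psi> m)"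
  unfolding poly_hom_def using assms
  by (intro sum.mono_neutral_left) (auto simp: in_keys_iff h_0)

lemma poly_hom_single: "poly_hom h \<psi> (Poly_Mapping.single m c) = h c * \<psi> m"
  by (subst poly_hom_superset[of "{m}"]) auto

lemma poly_hom_0 [simp]: "poly_hom h \<psi> 0 = 0"
  by (simp add: poly_hom_def)

lemma poly_hom_1: "poly_hom h \<psi> 1 = 1"
  using poly_hom_single[of 0 1] by (simp add: h_1 \<psi>_0)

lemma poly_hom_add: "poly_hom h \<psi> (f + g) = poly_hom h \<psi> f + poly_hom h \<psi> g"
proof -
  let ?A = "Poly_Mapping.keys f \<union> Poly_Mapping.keys g"
  have "Poly_Mapping.keys (f + g) \<subseteq> ?A"
    by (rule Poly_Mapping.keys_add)
  then show ?thesis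
    by (subst (1 2 3) poly_hom_superset[of ?A])
       (auto simp: lookup_add h_add sum.distrib algebra_simps)
qed

lemma poly_hom_sum: "poly_hom h \<psi> (sum f A) = (\<Sum>x\<in>A. poly_hom h \<psi> (f x))"
  by (induction A rule: infinite_finite_induct) (auto simp: poly_hom_add)

lemma poly_hom_mult: "poly_hom h \<psi> (f * g) = poly_hom h \<psi> f * poly_hom h \<psi> g"
proof -
  let ?s = "\<lambda>f m. Poly_Mapping.single m (Poly_Mapping.lookup f m)"
  have "f * g = (\<Sum>m\<in>Poly_Mapping.keys f. ?s f m) * (\<Sum>n\<in>Poly_Mapping.keys g. ?s g n)"
    by (simp only: poly_mapping_sum_single)
  also have "\<dots> = (\<Sum>m\<in>Poly_Mapping.keys f. \<Sum>n\<in>Poly_Mapping.keys g. ?s f m * ?s g n)"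
    by (simp add: sum_product)
  finally show ?thesis
    by (simp add: poly_hom_sum mult_single poly_hom_single h_mult \<psi>_add sum_product)
       (simp add: poly_hom_def sum_product ac_simps)
qed

end

section \<open>Evaluation of ternary polynomials\<close>

lemma poly_hom_data_eval: "poly_hom_data (\<lambda>c::'a::field. c) (\<lambda>m. \<Prod>i\<in>UNIV. v $ i ^ Poly_Mapping.lookup m (i::3))"
  by standard (auto simp: lookup_add power_add prod.distrib)

lemma eval_mpoly3_poly_hom:
  "eval_mpoly3 f v = poly_hom (\<lambda>c. c) (\<lambda>m. \<Prod>i\<in>UNIV. v $ i ^ Poly_Mapping.lookup m i) f"
  by (simp add: eval_mpoly3_def poly_hom_def)

lemma eval_mpoly3_add: "eval_mpoly3 (f + g) v = eval_mpoly3 f v + eval_mpoly3 g v"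
  unfolding eval_mpoly3_poly_hom by (rule poly_hom_data.poly_hom_add[OF poly_hom_data_eval])

lemma eval_mpoly3_mult: "eval_mpoly3 (f * g) v = eval_mpoly3 f v * eval_mpoly3 g v"
  unfolding eval_mpoly3_poly_hom by (rule poly_hom_data.poly_hom_mult[OF poly_hom_data_eval])

lemma eval_mpoly3_1: "eval_mpoly3 1 v = 1"
  unfolding eval_mpoly3_poly_hom by (rule poly_hom_data.poly_hom_1[OF poly_hom_data_eval])

lemma eval_mpoly3_0: "eval_mpoly3 0 v = 0"
  by (simp add: eval_mpoly3_def)

lemma eval_mpoly3_single:
  "eval_mpoly3 (Poly_Mapping.single m c) v = c * (\<Prod>i\<in>UNIV. v $ i ^ Poly_Mapping.lookup m i)"
  unfolding eval_mpoly3_poly_hom by (rule poly_hom_data.poly_hom_single[OF poly_hom_data_eval])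

section \<open>Homogeneity through the grading by degree\<close>

abbreviation mon_degree :: "(3 \<Rightarrow>\<^sub>0 nat) \<Rightarrow> nat" where
  "mon_degree m \<equiv> (\<Sum>i\<in>UNIV. Poly_Mapping.lookup m i)"

text \<open>The substitution of t x_i for x_i, read as a polynomial in t over the polynomial ring.
  Its coefficient at t^d is the homogeneous part of degree d, so homogeneity becomes the property of
  being a monomial in t.\<close>

definition grading :: "'a::field mpoly3 \<Rightarrow> 'a mpoly3 poly" where
  "grading = poly_hom (\<lambda>c. [:Poly_Mapping.single 0 c:])
     (\<lambda>m. monom (Poly_Mapping.single m 1) (mon_degree m))"

lemma grading_data:
  "poly_hom_data (\<lambda>c::'a::field. [:Poly_Mapping.single (0 :: 3 \<Rightarrow>\<^sub>0 nat) c:])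
     (\<lambda>m. monom (Poly_Mapping.single m 1) (mon_degree m))"
proof
  show "monom (Poly_Mapping.single 0 1) (mon_degree 0) = (1 :: 'a mpoly3 poly)"
    by simp
  show "monom (Poly_Mapping.single (m + n) 1) (mon_degree (m + n)) =
      monom (Poly_Mapping.single m 1) (mon_degree m) *
      (monom (Poly_Mapping.single n 1) (mon_degree n) :: 'a mpoly3 poly)" for m n
    by (simp add: mult_monom mult_single lookup_add sum.distrib)
qed (simp_all add: single_add mult_single one_pCons mult.commute)

lemma grading_eq:
  "grading f = (\<Sum>m\<in>Poly_Mapping.keys f. monom (Poly_Mapping.single m (Poly_Mapping.lookup f m)) (mon_degree m))"
  by (simp add: grading_def poly_hom_def smult_monom mult_single)

lemma coeff_grading:
  "Poly_Mapping.lookup (coeff (grading f) d) m = (if mon_degree m = d then Poly_Mapping.lookup f m else 0)"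
proof -
  have "Poly_Mapping.lookup (coeff (grading f) d) m =
      (\<Sum>k\<in>Poly_Mapping.keys f. if k = m then (if mon_degree m = d then Poly_Mapping.lookup f m else 0) else 0)"
    unfolding grading_eq coeff_sum lookup_sum
    by (rule sum.cong) (auto simp: lookup_single when_def)
  also have "\<dots> = (if mon_degree m = d then Poly_Mapping.lookup f m else 0)"
    by (auto simp: in_keys_iff)
  finally show ?thesis .
qed

lemma homogeneous_if_grading:
  assumes "grading f = monom a d"
  shows "homogeneous d f"
  unfolding homogeneous_def
proof
  fix m assume "m \<in> Poly_Mapping.keys f"
  then have "coeff (grading f) (mon_degree m) \<noteq> 0"
    using coeff_grading[of f "mon_degree m" m] by (auto simp: in_keys_iff)
  with assms show "mon_degree m = d"
    by (simp split: if_splits)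
qed

lemma grading_if_homogeneous:
  assumes "homogeneous d f"
  shows "grading f = monom f d"
proof (intro poly_eqI poly_mapping_eqI)
  fix e m
  have "Poly_Mapping.lookup f m \<noteq> 0 \<Longrightarrow> mon_degree m = d"
    using assms by (auto simp: homogeneous_def in_keys_iff)
  then show "Poly_Mapping.lookup (coeff (grading f) e) m = Poly_Mapping.lookup (coeff (monom f d) e) m"
    by (cases "Poly_Mapping.lookup f m = 0") (simp_all add: coeff_grading)
qed

text \<open>Order at 0 and degree are both additive over a domain, and the order never exceeds the
  degree. Both sums equal \<open>n\<close>, so order and degree agree for each factor and
  \<open>p\<close> has a single term.\<close>

lemma dvd_monom_imp_monom:
  fixes p q :: "'b::idom poly"
  assumes "p * q = monom c n" "c \<noteq> 0"
  shows "\<exists>a i. p = monom a i"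
proof -
  have nz: "p \<noteq> 0" "q \<noteq> 0"
    using assms by (auto simp: monom_eq_0_iff)
  define i where "i = order 0 p"
  have ord: "order 0 p + order 0 q = n"
    using order_mult[of p q 0] assms nz order_0_monom[of c n] by simp
  have deg: "degree p + degree q = n"
    using degree_mult_eq[OF nz] assms by (simp add: degree_monom_eq)
  have "order 0 p \<le> degree p" "order 0 q \<le> degree q"
    using nz by (auto intro: order_degree)
  with ord deg have "degree p = i" by (simp add: i_def)
  moreover have "\<forall>k<i. coeff p k = 0"
    using nz monom_1_dvd_iff[of p i] monom_1_dvd_iff'[of i p] by (simp add: i_def)
  ultimately have "p = monom (coeff p i) i"
    by (intro poly_eqI) (metis coeff_eq_0 coeff_monom linorder_neqE_nat)
  then show ?thesis by blast
qed

text \<open>The gradings of the two factors multiply to a monomial in t. Ternary polynomials form a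
  domain, so each grading is itself a monomial in t.\<close>

lemma homogeneous_factors:
  fixes f g h :: "'a::field mpoly3"
  assumes "homogeneous d f" "f \<noteq> 0" "f = g * h"
  obtains i j where "homogeneous i g" "homogeneous j h" "i + j = d"
proof -
  have *: "grading g * grading h = monom f d"
    using poly_hom_data.poly_hom_mult[OF grading_data, of g h] grading_if_homogeneous[OF assms(1)]
    unfolding assms(3) by (simp add: grading_def)
  obtain a i where g: "grading g = monom a i"
    using dvd_monom_imp_monom[OF *] assms by blast
  obtain b j where h: "grading h = monom b j"
    using dvd_monom_imp_monom[of "grading h" "grading g" f d] * assms(2) by (metis mult.commute)
  have "monom (a * b) (i + j) = monom f d"
    using * by (simp add: g h mult_monom)
  then have "i + j = d"
    using assms by (metis coeff_monom)
  then show ?thesis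
    using that g h homogeneous_if_grading by blast
qed

section \<open>Forms of degree at most two\<close>

definition mono3 :: "nat \<Rightarrow> nat \<Rightarrow> nat \<Rightarrow> 3 \<Rightarrow>\<^sub>0 nat" where
  "mono3 a b c = Poly_Mapping.single 1 a + Poly_Mapping.single 2 b + Poly_Mapping.single 3 c"

definition const3 :: "'a::field \<Rightarrow> 'a mpoly3" where
  "const3 = Poly_Mapping.single 0"

definition var3 :: "3 \<Rightarrow> 'a::field mpoly3" where
  "var3 i = Poly_Mapping.single (Poly_Mapping.single i 1) 1"

lemma lookup_mono3 [simp]:
  "Poly_Mapping.lookup (mono3 a b c) 1 = a"
  "Poly_Mapping.lookup (mono3 a b c) 2 = b"
  "Poly_Mapping.lookup (mono3 a b c) 3 = c"
  by (simp_all add: mono3_def lookup_add lookup_single)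

lemma mono3_inject [simp]: "mono3 a b c = mono3 a' b' c' \<longleftrightarrow> a = a' \<and> b = b' \<and> c = c'"
  by (metis lookup_mono3)

lemma mono3_lookup: "m = mono3 (Poly_Mapping.lookup m 1) (Poly_Mapping.lookup m 2) (Poly_Mapping.lookup m 3)"
  by (rule poly_mapping_eqI) (metis exhaust_3 lookup_mono3)

lemma single_mono3:
  "Poly_Mapping.single (mono3 a b c) k = const3 k * var3 1 ^ a * var3 2 ^ b * var3 3 ^ c"
proof -
  have "var3 i ^ n = (Poly_Mapping.single (Poly_Mapping.single i n) 1 :: 'a mpoly3)" for i n
    by (induction n) (simp_all add: var3_def mult_single flip: single_add)
  then show ?thesis
    by (simp add: const3_def mono3_def mult_single ac_simps)
qed

lemma const3_simps [simp]:
  "const3 0 = 0" "const3 1 = 1" "const3 (a + b) = const3 a + const3 b"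
  "const3 (a - b) = const3 a - const3 b" "const3 (- a) = - const3 a"
  "const3 (a * b) = const3 a * const3 b"
  by (simp_all add: const3_def single_add single_diff single_uminus mult_single)

lemma eval_const3 [simp]: "eval_mpoly3 (const3 c) v = c"
  by (simp add: const3_def eval_mpoly3_single)

lemma prod_UNIV_3: "prod f (UNIV :: 3 set) = f 1 * f 2 * f 3"
  unfolding UNIV_3 by (simp add: ac_simps)

lemma eval_var3 [simp]: "eval_mpoly3 (var3 i) v = v $ i"
  using exhaust_3[of i] by (auto simp: var3_def eval_mpoly3_single prod_UNIV_3 lookup_single)

lemma eval_uminus: "eval_mpoly3 (- f) v = - eval_mpoly3 f v"
  using eval_mpoly3_add[of "- f" f v] by (simp add: eval_mpoly3_0 eq_neg_iff_add_eq_0)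

lemma eval_diff: "eval_mpoly3 (f - g) v = eval_mpoly3 f v - eval_mpoly3 g v"
  using eval_mpoly3_add[of f "- g" v] by (simp add: eval_uminus)

lemmas eval_simps = eval_mpoly3_add eval_mpoly3_mult eval_mpoly3_1 eval_mpoly3_0 eval_uminus eval_diff

lemma homogeneous_keys:
  assumes "homogeneous d f" "m \<in> Poly_Mapping.keys f"
  obtains a b c where "a + b + c = d" "m = mono3 a b c"
  using assms mono3_lookup[of m] that by (metis homogeneous_def sum_3)

lemma homogeneous_0_cases:
  assumes "homogeneous 0 f"
  obtains c where "f = const3 c"
proof -
  have "Poly_Mapping.keys f \<subseteq> {mono3 0 0 0}"
    by (auto elim!: homogeneous_keys[OF assms])
  then have "f = Poly_Mapping.single (mono3 0 0 0) (Poly_Mapping.lookup f (mono3 0 0 0))"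
    by (intro poly_mapping_eqI) (auto simp: lookup_single when_def in_keys_iff)
  then show ?thesis
    using that by (simp add: single_mono3)
qed

lemma mpoly3_expand:
  assumes "finite A" "Poly_Mapping.keys f \<subseteq> A"
  shows "f = (\<Sum>m\<in>A. Poly_Mapping.single m (Poly_Mapping.lookup f m))"
  by (subst poly_mapping_sum_single[symmetric], rule sum.mono_neutral_left)
     (use assms in \<open>auto simp: in_keys_iff\<close>)

text \<open>These forms, like the brackets below, make sense over any commutative ring. With
  constant triples and \<open>vars3\<close> as arguments they are polynomials, so one identity
  serves numbers and polynomials alike. In \<open>quadratic_form\<close> the second coefficient
  triple belongs to yz, xz, xy, the order used by \<open>cremona\<close>.\<close>

definition linear_form :: "'b::comm_ring_1 \<times> 'b \<times> 'b \<Rightarrow> 'b \<times> 'b \<times> 'b \<Rightarrow> 'b" where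
  "linear_form = (\<lambda>(a, b, c) (x, y, z). a * x + b * y + c * z)"

definition quadratic_form :: "'b::comm_ring_1 \<times> 'b \<times> 'b \<Rightarrow> 'b \<times> 'b \<times> 'b \<Rightarrow> 'b \<times> 'b \<times> 'b \<Rightarrow> 'b" where
  "quadratic_form = (\<lambda>(a, b, c) (d, e, f) (x, y, z). a * x * x + b * y * y + c * z * z + d * y * z + e * x * z + f * x * y)"

abbreviation vars3 :: "'a::field mpoly3 \<times> 'a mpoly3 \<times> 'a mpoly3" where
  "vars3 \<equiv> (var3 1, var3 2, var3 3)"

fun const_triple :: "'a::field \<times> 'a \<times> 'a \<Rightarrow> 'a mpoly3 \<times> 'a mpoly3 \<times> 'a mpoly3" where
  "const_triple (a, b, c) = (const3 a, const3 b, const3 c)"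

definition coords :: "'a ^ 3 \<Rightarrow> 'a \<times> 'a \<times> 'a" where
  "coords v = (v $ 1, v $ 2, v $ 3)"

lemma homogeneous_1_cases:
  assumes "homogeneous 1 f"
  obtains a where "f = linear_form (const_triple a) vars3"
proof -
  have "m \<in> {mono3 1 0 0, mono3 0 1 0, mono3 0 0 1}" if "m \<in> Poly_Mapping.keys f" for m
    using assms that
  proof (rule homogeneous_keys)
    fix a b c :: nat assume "a + b + c = 1" "m = mono3 a b c"
    then show ?thesis
      by (cases a; cases b; cases c) auto
  qed
  then have "f = (\<Sum>m\<in>{mono3 1 0 0, mono3 0 1 0, mono3 0 0 1}. Poly_Mapping.single m (Poly_Mapping.lookup f m))"
    by (intro mpoly3_expand) auto
  also have "\<dots> = linear_form (const_triple (Poly_Mapping.lookup f (mono3 1 0 0),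
      Poly_Mapping.lookup f (mono3 0 1 0), Poly_Mapping.lookup f (mono3 0 0 1))) vars3"
    by (simp add: single_mono3 linear_form_def algebra_simps)
  finally show ?thesis by (rule that)
qed

lemma homogeneous_2_cases:
  assumes "homogeneous 2 f"
  obtains a b where "f = quadratic_form (const_triple a) (const_triple b) vars3"
proof -
  let ?M = "{mono3 2 0 0, mono3 0 2 0, mono3 0 0 2, mono3 0 1 1, mono3 1 0 1, mono3 1 1 0}"
  have "m \<in> ?M" if "m \<in> Poly_Mapping.keys f" for m
    using assms that
  proof (rule homogeneous_keys)
    fix a b c :: nat assume *: "a + b + c = 2" "m = mono3 a b c"
    from *(1) have "a = 2 \<and> b = 0 \<and> c = 0 \<or> a = 0 \<and> b = 2 \<and> c = 0 \<or> a = 0 \<and> b = 0 \<and> c = 2 \<or>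
        a = 0 \<and> b = 1 \<and> c = 1 \<or> a = 1 \<and> b = 0 \<and> c = 1 \<or> a = 1 \<and> b = 1 \<and> c = 0"
      by (cases a; cases "a - 1"; cases b; cases "b - 1") auto
    with *(2) show ?thesis
      by blast
  qed
  then have "Poly_Mapping.keys f \<subseteq> ?M"
    by blast
  then have "f = (\<Sum>m\<in>?M. Poly_Mapping.single m (Poly_Mapping.lookup f m))"
    by (intro mpoly3_expand) blast+
  also have "\<dots> = quadratic_form
      (const_triple (Poly_Mapping.lookup f (mono3 2 0 0), Poly_Mapping.lookup f (mono3 0 2 0), Poly_Mapping.lookup f (mono3 0 0 2)))
      (const_triple (Poly_Mapping.lookup f (mono3 0 1 1), Poly_Mapping.lookup f (mono3 1 0 1), Poly_Mapping.lookup f (mono3 1 1 0))) vars3"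
    by (simp add: single_mono3 quadratic_form_def power2_eq_square algebra_simps)
  finally show ?thesis by (rule that)
qed

lemma eval_linear_form: "eval_mpoly3 (linear_form (const_triple a) vars3) v = linear_form a (coords v)"
  by (cases a) (simp add: linear_form_def coords_def eval_simps)

lemma eval_quadratic_form:
  "eval_mpoly3 (quadratic_form (const_triple a) (const_triple b) vars3) v = quadratic_form a b (coords v)"
  by (cases a; cases b) (simp add: quadratic_form_def coords_def eval_simps)

lemma homogeneous_add: "homogeneous d f \<Longrightarrow> homogeneous d g \<Longrightarrow> homogeneous d (f + g)"
  using Poly_Mapping.keys_add[of f g] by (auto simp: homogeneous_def)

lemma homogeneous_mult:
  assumes "homogeneous i f" "homogeneous j g"
  shows "homogeneous (i + j) (f * g)"
  by (rule homogeneous_if_grading[of _ "f * g"])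
     (use assms poly_hom_data.poly_hom_mult[OF grading_data, of f g] in
       \<open>simp add: mult_monom grading_if_homogeneous flip: grading_def\<close>)

lemma homogeneous_const3: "homogeneous 0 (const3 c)"
  by (simp add: homogeneous_def const3_def)

lemma homogeneous_linear_form: "homogeneous 1 (linear_form (const_triple a) vars3)"
proof -
  have "homogeneous 1 (var3 i :: 'a mpoly3)" for i
    by (simp add: homogeneous_def var3_def lookup_single when_def)
  then have "homogeneous 1 (const3 c * var3 i :: 'a mpoly3)" for c i
    using homogeneous_mult[OF homogeneous_const3] by fastforce
  then show ?thesis
    by (cases a) (simp add: linear_form_def homogeneous_add)
qed

text \<open>Evaluation is a ring homomorphism into a field, so it maps units to nonzero
  elements.\<close>

lemma not_unit_if_eval_0:
  assumes "eval_mpoly3 f v = 0"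
  shows "\<not> f dvd 1"
proof
  assume "f dvd 1"
  then obtain g where "1 = f * g" ..
  then have "eval_mpoly3 1 v = eval_mpoly3 f v * eval_mpoly3 g v"
    by (metis eval_mpoly3_mult)
  with assms show False by (simp add: eval_mpoly3_1)
qed

lemma const3_unit: "c \<noteq> 0 \<Longrightarrow> const3 c dvd 1"
  by (rule dvdI[of _ _ "const3 (inverse c)"]) (simp flip: const3_simps)

subsection \<open>Brackets\<close>

type_synonym 'a triple = "'a \<times> 'a \<times> 'a"

fun det3 :: "'a::comm_ring_1 triple \<Rightarrow> 'a triple \<Rightarrow> 'a triple \<Rightarrow> 'a" where
  "det3 (a, b, c) (d, e, f) (g, h, i) = a * (e * i - f * h) - b * (d * i - f * g) + c * (d * h - e * g)"

fun cross :: "'a::comm_ring_1 triple \<Rightarrow> 'a triple \<Rightarrow> 'a triple" where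
  "cross (a, b, c) (d, e, f) = (b * f - c * e, c * d - a * f, a * e - b * d)"

fun combine :: "'a::comm_ring_1 triple \<Rightarrow> 'a triple \<Rightarrow> 'a triple \<Rightarrow> 'a triple \<Rightarrow> 'a triple" where
  "combine (x, y, z) (a, b, c) (d, e, f) (g, h, i) =
     (x * a + y * d + z * g, x * b + y * e + z * h, x * c + y * f + z * i)"

text \<open>The numerators in Cramer's rule: the coordinates of \<open>t\<close> with respect to
  \<open>u\<close>, \<open>v\<close>, \<open>w\<close>, multiplied by \<open>det3 u v w\<close>.
  Without the division they remain available over the integers and over polynomials.\<close>

fun coordinates :: "'a::comm_ring_1 triple \<Rightarrow> 'a triple \<Rightarrow> 'a triple \<Rightarrow> 'a triple \<Rightarrow> 'a triple" where
  "coordinates u v w t = (det3 t v w, det3 u t w, det3 u v t)"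

fun scale :: "'a::comm_ring_1 \<Rightarrow> 'a triple \<Rightarrow> 'a triple" where
  "scale k (a, b, c) = (k * a, k * b, k * c)"

text \<open>Pairwise products of coordinates, as they occur in a quadratic form that vanishes at the three base points.\<close>

fun cremona :: "'a::comm_ring_1 triple \<Rightarrow> 'a triple" where
  "cremona (x, y, z) = (y * z, x * z, x * y)"

text \<open>The standard quadratic transformation with base points \<open>u\<close>,
  \<open>v\<close>, \<open>w\<close> turns the quadrics through these points into lines, so the
  condition on the other three points is the collinearity of their images. This replaces the usual
  6x6 determinant of the monomials of degree two.\<close>

definition conic_det :: "'a::comm_ring_1 triple \<Rightarrow> 'a triple \<Rightarrow> 'a triple \<Rightarrow> 'a triple \<Rightarrow> 'a triple \<Rightarrow> 'a triple \<Rightarrow> 'a" where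
  "conic_det u v w p q r = det3 (cremona (coordinates u v w p)) (cremona (coordinates u v w q))
     (cremona (coordinates u v w r))"

lemma combine_coordinates: "combine (coordinates u v w t) u v w = scale (det3 u v w) t"
  by (cases u; cases v; cases w; cases t) (simp add: algebra_simps)

lemma linear_form_cross: "linear_form (cross u v) w = det3 u v w"
  by (cases u; cases v; cases w) (simp add: linear_form_def algebra_simps)

lemma det3_rotate: "det3 u v w = det3 v w u"
  by (cases u; cases v; cases w) (simp add: algebra_simps)

lemma det3_same [simp]: "det3 u u w = 0" "det3 u w u = 0" "det3 w u u = 0"
  by (cases u; cases w; simp add: algebra_simps)+

text \<open>The matrix with rows \<open>u\<close>, \<open>v\<close>, \<open>w\<close> kills
  \<open>a\<close>. Multiplying by the adjugate shows that the determinant times each entry of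
  \<open>a\<close> is zero.\<close>

lemma det3_eq_0_if_kernel:
  fixes a :: "'a::idom triple"
  assumes "a \<noteq> (0, 0, 0)" "linear_form a u = 0" "linear_form a v = 0" "linear_form a w = 0"
  shows "det3 u v w = 0"
proof -
  obtain a1 a2 a3 where a: "a = (a1, a2, a3)" by (cases a)
  obtain u1 u2 u3 where u: "u = (u1, u2, u3)" by (cases u)
  obtain v1 v2 v3 where v: "v = (v1, v2, v3)" by (cases v)
  obtain w1 w2 w3 where w: "w = (w1, w2, w3)" by (cases w)
  have eqs: "a1 * u1 + a2 * u2 + a3 * u3 = 0" "a1 * v1 + a2 * v2 + a3 * v3 = 0" "a1 * w1 + a2 * w2 + a3 * w3 = 0"
    using assms by (simp_all add: linear_form_def a u v w)
  have "a1 * det3 u v w = 0" "a2 * det3 u v w = 0" "a3 * det3 u v w = 0"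
    using eqs unfolding u v w det3.simps by algebra+
  with assms(1) show ?thesis by (auto simp: a)
qed

text \<open>\<open>cross u v\<close> annihilates \<open>u\<close> and \<open>v\<close> in any case,
  and \<open>w\<close> because the bracket vanishes. If it is zero, another cross product takes its
  place, or all three vectors are parallel to one of them and any form annihilating that one will
  do.\<close>

lemma det3_eq_0_imp_kernel:
  fixes u :: "'a::idom triple"
  assumes "det3 u v w = 0"
  shows "\<exists>a. a \<noteq> (0, 0, 0) \<and> linear_form a u = 0 \<and> linear_form a v = 0 \<and> linear_form a w = 0"
proof -
  have ex: "\<exists>a. a \<noteq> (0, 0, 0) \<and> linear_form a u = 0" for u :: "'a triple"
  proof (cases u)
    case (fields x y z)
    show ?thesis
    proof (cases "x = 0")
      case True
      then show ?thesis by (intro exI[of _ "(1, 0, 0)"]) (simp add: fields linear_form_def)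
    next
      case False
      then show ?thesis by (intro exI[of _ "(y, - x, 0)"]) (simp add: fields linear_form_def)
    qed
  qed
  \<comment> \<open>Over an integral domain parallel vectors need not be multiples of each other, so
    this case is phrased through the forms that annihilate them.\<close>
  have parallel: "linear_form a v = 0" if "cross u v = (0, 0, 0)" "linear_form a u = 0" "u \<noteq> (0, 0, 0)" for a u v :: "'a triple"
  proof -
    obtain a1 a2 a3 where a: "a = (a1, a2, a3)" by (cases a)
    obtain u1 u2 u3 where u: "u = (u1, u2, u3)" by (cases u)
    obtain v1 v2 v3 where v: "v = (v1, v2, v3)" by (cases v)
    have "u2 * v3 = u3 * v2" "u3 * v1 = u1 * v3" "u1 * v2 = u2 * v1" "a1 * u1 + a2 * u2 + a3 * u3 = 0"
      using that by (simp_all add: a u v linear_form_def)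
    then have "u1 * (a1 * v1 + a2 * v2 + a3 * v3) = 0" "u2 * (a1 * v1 + a2 * v2 + a3 * v3) = 0"
        "u3 * (a1 * v1 + a2 * v2 + a3 * v3) = 0"
      by algebra+
    then show ?thesis
      using that(3) by (auto simp: a u v linear_form_def)
  qed
  have zero: "linear_form a (0, 0, 0) = 0" for a :: "'a triple"
    by (simp add: linear_form_def split: prod.split)
  show ?thesis
  proof (cases "cross u v = (0, 0, 0)")
    case False
    then show ?thesis
      using assms by (intro exI[of _ "cross u v"]) (simp add: linear_form_cross det3_rotate[of u v u])
  next
    case uv: True
    show ?thesis
    proof (cases "u = (0, 0, 0)")
      case u: True
      show ?thesis
      proof (cases "cross v w = (0, 0, 0)")
        case False
        then show ?thesis
          using u by (intro exI[of _ "cross v w"]) (simp add: linear_form_cross zero)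
      next
        case True
        show ?thesis
        proof (cases "v = (0, 0, 0)")
          case v: True
          with ex[of w] u zero show ?thesis by metis
        next
          case False
          with ex[of v] parallel[OF True] u zero show ?thesis by metis
        qed
      qed
    next
      case u: False
      show ?thesis
      proof (cases "cross u w = (0, 0, 0)")
        case False
        then show ?thesis
          using parallel[OF uv _ u, of "cross u w"] by (intro exI[of _ "cross u w"]) (simp add: linear_form_cross)
      next
        case True
        with ex[of u] parallel[OF uv _ u] parallel[OF True _ u] show ?thesis by blast
      qed
    qed
  qed
qed

lemma det3_eq_0_iff:
  fixes u :: "'a::idom triple"
  shows "det3 u v w = 0 \<longleftrightarrow>
    (\<exists>a. a \<noteq> (0, 0, 0) \<and> linear_form a u = 0 \<and> linear_form a v = 0 \<and> linear_form a w = 0)"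
  using det3_eq_0_if_kernel det3_eq_0_imp_kernel by blast

subsection \<open>Conics\<close>

text \<open>The polarization Q(u + v) - Q(u) - Q(v) of the quadratic form Q.\<close>

definition polar_form :: "'a::comm_ring_1 triple \<Rightarrow> 'a triple \<Rightarrow> 'a triple \<Rightarrow> 'a triple \<Rightarrow> 'a" where
  "polar_form = (\<lambda>(a, b, c) (d, e, f) (x, y, z) (x', y', z').
     (a * x * x' + b * y * y' + c * z * z') + (a * x * x' + b * y * y' + c * z * z')
     + d * (y * z' + z * y') + e * (x * z' + z * x') + f * (x * y' + y * x'))"

lemma quadratic_form_combine:
  "quadratic_form a b (combine (x, y, z) u v w) =
     x * x * quadratic_form a b u + y * y * quadratic_form a b v + z * z * quadratic_form a b w
     + y * z * polar_form a b v w + x * z * polar_form a b u w + x * y * polar_form a b u v"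
  by (cases a; cases b; cases u; cases v; cases w)
     (simp add: quadratic_form_def polar_form_def algebra_simps)

lemma quadratic_form_scale: "quadratic_form a b (scale k t) = k * k * quadratic_form a b t"
  by (cases a; cases b; cases t) (simp add: quadratic_form_def algebra_simps)

lemma linear_form_scale: "linear_form a (scale k t) = k * linear_form a t"
  by (cases a; cases t) (simp add: linear_form_def algebra_simps)

text \<open>Q in the basis \<open>u\<close>, \<open>v\<close>, \<open>w\<close>, with Cramer's rule
  cleared of denominators. For a vector \<open>t\<close> this evaluates Q from its values and polar
  values on the basis; for \<open>t = vars3\<close> it is an identity of polynomials from which
  factors of Q can be read off.\<close>

lemma quadratic_form_in_coordinates:
  "det3 u v w * det3 u v w * quadratic_form a b t =
     det3 t v w * det3 t v w * quadratic_form a b u + det3 u t w * det3 u t w * quadratic_form a b v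
     + det3 u v t * det3 u v t * quadratic_form a b w
     + det3 u t w * det3 u v t * polar_form a b v w
     + det3 t v w * det3 u v t * polar_form a b u w
     + det3 t v w * det3 u t w * polar_form a b u v"
  using quadratic_form_combine[of a b "det3 t v w" "det3 u t w" "det3 u v t" u v w]
    combine_coordinates[of u v w t]
  by (simp add: quadratic_form_scale)

lemma det3_const_triple: "det3 (const_triple u) (const_triple v) (const_triple w) = const3 (det3 u v w)"
  by (cases u; cases v; cases w) simp

lemma quadratic_form_const_triple:
  "quadratic_form (const_triple a) (const_triple b) (const_triple u) = const3 (quadratic_form a b u)"
  by (cases u; cases a; cases b) (simp add: quadratic_form_def)

lemma polar_form_const_triple:
  "polar_form (const_triple a) (const_triple b) (const_triple u) (const_triple v) = const3 (polar_form a b u v)"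
proof -
  have "const3 2 = (2 :: 'a mpoly3)"
    using const3_simps(3)[of 1 1] by simp
  then show ?thesis
    by (cases u; cases v; cases a; cases b) (simp add: polar_form_def)
qed

lemmas const3_forms = det3_const_triple quadratic_form_const_triple polar_form_const_triple

lemma eval_det3_vars:
  "eval_mpoly3 (det3 vars3 (const_triple v) (const_triple w)) p = det3 (coords p) v w"
  "eval_mpoly3 (det3 (const_triple v) vars3 (const_triple w)) p = det3 v (coords p) w"
  "eval_mpoly3 (det3 (const_triple v) (const_triple w) vars3) p = det3 v w (coords p)"
  by (cases v; cases w; simp add: eval_simps coords_def)+

lemma det3_zero [simp]: "det3 (0, 0, 0) v w = 0" "det3 v (0, 0, 0) w = 0" "det3 v w (0, 0, 0) = 0"
  by (cases v; cases w; simp)+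

lemma coords_0: "coords 0 = (0, 0, 0)"
  by (simp add: coords_def)

section \<open>Zeros of irreducible quadratic forms\<close>

lemma eq_mult_if_scaled:
  fixes c :: "'b::comm_ring_1"
  shows "k * f = z * g \<Longrightarrow> c * k = 1 \<Longrightarrow> f = (c * z) * g"
  by (metis mult.assoc mult_1_left)

text \<open>Otherwise Q vanishes on the whole line through \<open>u\<close> and \<open>v\<close>: in
  the basis \<open>u\<close>, \<open>v\<close>, \<open>w\<close> every remaining term contains the
  third coordinate, so this linear form splits off. Neither factor is a unit, since both vanish at
  the zero vector.\<close>

lemma irreducible_not_totally_isotropic:
  fixes u v :: "'a::field triple"
  assumes irr: "irreducible (quadratic_form (const_triple a) (const_triple b) vars3)" (is "irreducible ?f")
    and D: "det3 u v w \<noteq> 0"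
    and "quadratic_form a b u = 0" "quadratic_form a b v = 0"
  shows "polar_form a b u v \<noteq> 0"
proof
  assume "polar_form a b u v = 0"
  let ?u = "const_triple u" and ?v = "const_triple v" and ?w = "const_triple w" and ?t = "vars3 :: 'a mpoly3 triple"
  let ?c = "const3 (inverse (det3 u v w * det3 u v w))"
  let ?g = "det3 ?u ?v ?t * const3 (quadratic_form a b w) + det3 ?u ?t ?w * const3 (polar_form a b v w)
     + det3 ?t ?v ?w * const3 (polar_form a b u w)"
  have "const3 (det3 u v w) * const3 (det3 u v w) * ?f = det3 ?u ?v ?t * ?g"
    using quadratic_form_in_coordinates[of ?u ?v ?w "const_triple a" "const_triple b" ?t]
    by (simp add: const3_forms assms \<open>polar_form a b u v = 0\<close> algebra_simps)
  moreover have "?c * (const3 (det3 u v w) * const3 (det3 u v w)) = 1"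
  proof -
    have "inverse (det3 u v w * det3 u v w) * (det3 u v w * det3 u v w) = 1"
      using D by (intro left_inverse) simp
    then show ?thesis
      by (simp only: const3_simps(2) flip: const3_simps(6))
  qed
  ultimately have "?f = (?c * det3 ?u ?v ?t) * ?g"
    by (intro eq_mult_if_scaled)
  moreover have "\<not> (?c * det3 ?u ?v ?t) dvd 1"
    by (rule not_unit_if_eval_0[of _ 0]) (simp add: eval_simps eval_det3_vars coords_0)
  moreover have "\<not> ?g dvd 1"
    by (rule not_unit_if_eval_0[of _ 0]) (simp add: eval_simps eval_det3_vars coords_0)
  ultimately show False
    using irreducibleD[OF irr] by blast
qed

lemma ex_det3_ne_0:
  fixes u v :: "'a::comm_ring_1 triple"
  assumes "cross u v \<noteq> (0, 0, 0)"
  shows "\<exists>w. det3 u v w \<noteq> 0"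
proof -
  obtain x y z where c: "cross u v = (x, y, z)" by (cases "cross u v")
  have "det3 u v (1, 0, 0) = x" "det3 u v (0, 1, 0) = y" "det3 u v (0, 0, 1) = z"
    by (simp_all add: c linear_form_def flip: linear_form_cross)
  then show ?thesis
    using assms c by metis
qed

lemma cross_combine:
  "cross u (combine (x, y, 0) u v w) = scale y (cross u v)"
  "cross v (combine (x, y, 0) u v w) = scale x (cross v u)"
  by (cases u; cases v; cases w; simp add: algebra_simps)+

lemma cross_scale: "cross u (scale k v) = scale k (cross u v)"
  by (cases u; cases v) (simp add: algebra_simps)

lemma scale_0: "scale 0 t = (0, 0, 0)"
  by (cases t) simp

lemma scale_eq_0_iff: "scale k t = (0, 0, 0) \<longleftrightarrow> k = 0 \<or> t = (0, 0, 0)" for k :: "'a::idom"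
  by (cases t) auto

text \<open>If \<open>t\<close> were on the line, it would be a combination of \<open>u\<close> and
  \<open>v\<close> up to a factor, with both coefficients nonzero because the points are distinct.
  Then Q at \<open>t\<close> would be their product times the polar value of \<open>u\<close> and
  \<open>v\<close>, which is nonzero.\<close>

lemma irreducible_no_three_collinear:
  fixes u v t :: "'a::field triple"
  assumes irr: "irreducible (quadratic_form (const_triple a) (const_triple b) vars3)"
    and zeros: "quadratic_form a b u = 0" "quadratic_form a b v = 0" "quadratic_form a b t = 0"
    and dist: "cross u v \<noteq> (0, 0, 0)" "cross u t \<noteq> (0, 0, 0)" "cross v t \<noteq> (0, 0, 0)"
  shows "det3 u v t \<noteq> 0"
proof
  assume col: "det3 u v t = 0"
  obtain w where D: "det3 u v w \<noteq> 0"
    using ex_det3_ne_0[OF dist(1)] by blast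
  have *: "combine (det3 t v w, det3 u t w, 0) u v w = scale (det3 u v w) t"
    using combine_coordinates[of u v w t] col by simp
  have "det3 t v w \<noteq> 0"
    using arg_cong[OF *[symmetric], of "cross v"] D dist(3) by (auto simp: cross_combine cross_scale scale_0 scale_eq_0_iff)
  moreover have "det3 u t w \<noteq> 0"
    using arg_cong[OF *[symmetric], of "cross u"] D dist(2) by (auto simp: cross_combine cross_scale scale_0 scale_eq_0_iff)
  moreover have "polar_form a b u v \<noteq> 0"
    by (rule irreducible_not_totally_isotropic[OF irr D zeros(1,2)])
  ultimately show False
    using quadratic_form_in_coordinates[of u v w a b t] zeros col by simp
qed

text \<open>A form vanishing at the three base points is determined by its three polar values. These
  are the coefficients of a linear form that is nonzero and annihilates the Cremona images of
  \<open>p\<close>, \<open>q\<close>, \<open>r\<close>.\<close>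

lemma conic_det_eq_0_if_conic:
  fixes u :: "'a::field triple"
  assumes irr: "irreducible (quadratic_form (const_triple a) (const_triple b) vars3)"
    and D: "det3 u v w \<noteq> 0"
    and zeros: "\<forall>t\<in>{u, v, w, p, q, r}. quadratic_form a b t = 0"
  shows "conic_det u v w p q r = 0"
proof -
  let ?\<beta> = "(polar_form a b v w, polar_form a b u w, polar_form a b u v)"
  have "?\<beta> \<noteq> (0, 0, 0)"
    using irreducible_not_totally_isotropic[OF irr D] zeros by simp
  moreover have "linear_form ?\<beta> (cremona (coordinates u v w t)) = 0" if "quadratic_form a b t = 0" for t
    using quadratic_form_in_coordinates[of u v w a b t] zeros that
    by (simp add: linear_form_def algebra_simps)
  ultimately show ?thesis
    unfolding conic_det_def using zeros by (intro det3_eq_0_if_kernel[of ?\<beta>]) simp_all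
qed

text \<open>Pigeonhole: one of the two lines contains at least three of the six vectors. This
  excludes products of two linear forms in the construction of a conic.\<close>

lemma two_lines_three_collinear:
  fixes T :: "'a::idom triple set"
  assumes "card T = 6" "a \<noteq> (0, 0, 0)" "b \<noteq> (0, 0, 0)" "\<forall>t\<in>T. linear_form a t = 0 \<or> linear_form b t = 0"
  shows "\<exists>x\<in>T. \<exists>y\<in>T. \<exists>z\<in>T. x \<noteq> y \<and> x \<noteq> z \<and> y \<noteq> z \<and> det3 x y z = 0"
proof -
  have *: ?thesis if c: "c \<noteq> (0, 0, 0)" "3 \<le> card {t \<in> T. linear_form c t = 0}" for c
  proof -
    obtain S where S: "S \<subseteq> {t \<in> T. linear_form c t = 0}" "card S = 3"
      using obtain_subset_with_card_n[OF c(2)] by blast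
    from S(2) obtain x y z where "S = {x, y, z}" "x \<noteq> y" "x \<noteq> z" "y \<noteq> z"
      unfolding card_3_iff by blast
    moreover have "x \<in> T" "y \<in> T" "z \<in> T" "linear_form c x = 0" "linear_form c y = 0" "linear_form c z = 0"
      using S(1) unfolding \<open>S = {x, y, z}\<close> by blast+
    ultimately show ?thesis
      using det3_eq_0_if_kernel[OF c(1)] by blast
  qed
  have "{t \<in> T. linear_form a t = 0} \<union> {t \<in> T. linear_form b t = 0} = T"
    using assms(4) by blast
  then have "6 \<le> card {t \<in> T. linear_form a t = 0} + card {t \<in> T. linear_form b t = 0}"
    using card_Un_le[of "{t \<in> T. linear_form a t = 0}" "{t \<in> T. linear_form b t = 0}"] assms(1) by argo
  then have "card {t \<in> T. linear_form a t = 0} \<ge> 3 \<or> card {t \<in> T. linear_form b t = 0} \<ge> 3"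
    by linarith
  then show ?thesis
    using *[OF assms(2)] *[OF assms(3)] by blast
qed

section \<open>The conic through six points\<close>

definition conic_form :: "'a::comm_ring_1 triple \<Rightarrow> 'a triple \<Rightarrow> 'a triple \<Rightarrow> 'a triple \<Rightarrow> 'a triple \<Rightarrow> 'a" where
  "conic_form c u v w t = linear_form c (cremona (coordinates u v w t))"

lemma eval_conic_form:
  "eval_mpoly3 (conic_form (const_triple c) (const_triple u) (const_triple v) (const_triple w) vars3) x =
     conic_form c u v w (coords x)"
  by (cases c) (simp add: conic_form_def linear_form_def eval_simps eval_det3_vars)

lemma homogeneous_conic_form:
  "homogeneous 2 (conic_form (const_triple c) (const_triple u) (const_triple v) (const_triple w) vars3)"
proof -
  have cross: "cross (const_triple u) (const_triple v) = const_triple (cross u v)" for u v :: "'a triple"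
    by (cases u; cases v) simp
  have "homogeneous 1 (det3 (const_triple u) (const_triple v) vars3)" for u v :: "'a triple"
    using homogeneous_linear_form[of "cross u v"] by (simp add: cross flip: linear_form_cross)
  then have 1: "homogeneous 1 (det3 vars3 (const_triple v) (const_triple w))"
      "homogeneous 1 (det3 (const_triple u) vars3 (const_triple w))"
      "homogeneous 1 (det3 (const_triple u) (const_triple v) vars3)"
    by (metis det3_rotate)+
  have "homogeneous 2 (const3 k * (f * g))" if "homogeneous 1 f" "homogeneous 1 g" for k and f g :: "'a mpoly3"
    using homogeneous_mult[OF homogeneous_const3[of k] homogeneous_mult[OF that]] by (simp add: numeral_2_eq_2)
  with 1 show ?thesis
    by (cases c) (simp add: conic_form_def linear_form_def homogeneous_add)
qed

text \<open>At v + w, u + w and u + v the form takes the values of the three coefficients in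
  \<open>c\<close>, each times the square of \<open>det3 u v w\<close>.\<close>

lemma conic_form_ne_0:
  fixes u :: "'a::idom triple"
  assumes "c \<noteq> (0, 0, 0)" "det3 u v w \<noteq> 0"
  shows "\<exists>t. conic_form c u v w t \<noteq> 0"
proof -
  obtain c1 c2 c3 where c: "c = (c1, c2, c3)" by (cases c)
  let ?D = "det3 u v w"
  have add: "conic_form c u v w (combine (x, y, z) u v w) = ?D * ?D * linear_form c (y * z, x * z, x * y)" for x y z
  proof -
    have "det3 (combine (x, y, z) u v w) v w = x * ?D" "det3 u (combine (x, y, z) u v w) w = y * ?D"
        "det3 u v (combine (x, y, z) u v w) = z * ?D"
      by (cases u; cases v; cases w; simp add: algebra_simps)+
    then show ?thesis
      by (simp add: conic_form_def c linear_form_def algebra_simps)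
  qed
  have "conic_form c u v w (combine (0, 1, 1) u v w) \<noteq> 0 \<or> conic_form c u v w (combine (1, 0, 1) u v w) \<noteq> 0 \<or>
      conic_form c u v w (combine (1, 1, 0) u v w) \<noteq> 0"
    unfolding add using assms by (simp add: c linear_form_def)
  then show ?thesis by blast
qed

text \<open>A kernel vector of the vanishing determinant supplies the coefficients of the form. In a
  factorization both factors are homogeneous with degrees adding up to 2. A factor of degree 0 is a
  nonzero constant, hence a unit, and two factors of degree 1 would put three of the six points on a
  line.\<close>

lemma conic_if_conic_det_eq_0:
  fixes u :: "'a::field triple"
  assumes T: "T = {u, v, w, p, q, r}" and card: "card T = 6"
    and nocol: "\<And>x y z. x \<in> T \<Longrightarrow> y \<in> T \<Longrightarrow> z \<in> T \<Longrightarrow> x \<noteq> y \<Longrightarrow> x \<noteq> z \<Longrightarrow> y \<noteq> z \<Longrightarrow> det3 x y z \<noteq> 0"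
    and det: "conic_det u v w p q r = 0"
  shows "\<exists>f. homogeneous 2 f \<and> irreducible f \<and> (\<forall>x. coords x \<in> T \<longrightarrow> eval_mpoly3 f x = 0)"
proof -
  have "distinct [u, v, w, p, q, r]"
    using card unfolding T by (intro card_distinct) simp
  then have D: "det3 u v w \<noteq> 0"
    using nocol by (simp add: T)
  obtain c where c: "c \<noteq> (0, 0, 0)" "\<forall>t\<in>{p, q, r}. conic_form c u v w t = 0"
    using det3_eq_0_imp_kernel[OF det[unfolded conic_det_def]] by (auto simp: conic_form_def)
  then have zero: "conic_form c u v w t = 0" if "t \<in> T" for t
    using that unfolding T by (cases c) (auto simp: conic_form_def linear_form_def)
  define f where "f = conic_form (const_triple c) (const_triple u) (const_triple v) (const_triple w) vars3"
  have eval: "eval_mpoly3 f x = conic_form c u v w (coords x)" for x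
    by (simp add: f_def eval_conic_form)
  have hom: "homogeneous 2 f"
    unfolding f_def by (rule homogeneous_conic_form)
  obtain x where x: "eval_mpoly3 f x \<noteq> 0"
  proof -
    obtain t1 t2 t3 where "conic_form c u v w (t1, t2, t3) \<noteq> 0"
      using conic_form_ne_0[OF c(1) D] by (metis prod_cases3)
    then have "eval_mpoly3 f (vector [t1, t2, t3]) \<noteq> 0"
      by (simp add: eval coords_def)
    then show ?thesis using that by blast
  qed
  then have "f \<noteq> 0"
    by (auto simp: eval_mpoly3_0)
  have "irreducible f"
  proof (rule irreducibleI)
    show "f \<noteq> 0" by fact
    show "\<not> f dvd 1"
      by (rule not_unit_if_eval_0[of _ 0]) (cases c, simp add: eval coords_0 conic_form_def linear_form_def)
    fix g h assume fgh: "f = g * h"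
    obtain i j where ij: "homogeneous i g" "homogeneous j h" "i + j = 2"
      using homogeneous_factors[OF hom \<open>f \<noteq> 0\<close> fgh] by blast
    have unit: "k dvd 1" if k: "homogeneous 0 k" "k dvd f" for k
    proof -
      obtain d where "k = const3 d"
        using homogeneous_0_cases[OF k(1)] by blast
      with \<open>f \<noteq> 0\<close> k(2) show ?thesis
        by (metis const3_simps(1) const3_unit dvd_0_left)
    qed
    consider "i = 0" | "j = 0" | "i = 1" "j = 1"
      using ij(3) by linarith
    then show "g dvd 1 \<or> h dvd 1"
    proof cases
      case 3
      obtain a b where a: "g = linear_form (const_triple a) vars3" and b: "h = linear_form (const_triple b) vars3"
        using ij 3 homogeneous_1_cases by metis
      have ev: "eval_mpoly3 f x = linear_form a (coords x) * linear_form b (coords x)" for x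
        unfolding fgh a b by (simp add: eval_mpoly3_mult eval_linear_form)
      have "a \<noteq> (0, 0, 0)" "b \<noteq> (0, 0, 0)"
        using x ev by (auto simp: linear_form_def coords_def)
      moreover have "linear_form a t = 0 \<or> linear_form b t = 0" if "t \<in> T" for t
      proof -
        obtain t1 t2 t3 where "t = (t1, t2, t3)" by (cases t)
        then have "coords (vector [t1, t2, t3]) = t" by (simp add: coords_def)
        with ev[of "vector [t1, t2, t3]"] zero[OF that] eval[of "vector [t1, t2, t3]"] show ?thesis
          by simp
      qed
      ultimately show ?thesis
        using two_lines_three_collinear[OF card, of a b] nocol by blast
    qed (use ij unit fgh in auto)
  qed
  then show ?thesis
    using hom zero eval by (intro exI[of _ f]) simp
qed

subsection \<open>Points, lines and conics of the projective plane in coordinates\<close>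

definition vec3 :: "'a::zero triple \<Rightarrow> 'a ^ 3" where
  "vec3 = (\<lambda>(x, y, z). vector [x, y, z])"

definition pt :: "'a::field triple \<Rightarrow> 'a proj_plane" where
  "pt t = abs_proj_plane (vec3 t)"

lemma coords_vec3 [simp]: "coords (vec3 t) = t"
  by (cases t) (simp add: vec3_def coords_def)

lemma vec3_coords [simp]: "vec3 (coords v) = v"
  by (simp add: vec3_def coords_def vec_eq_iff forall_3)

lemma vec3_eq_0_iff: "vec3 t = 0 \<longleftrightarrow> t = (0, 0, 0)"
  by (metis coords_0 coords_vec3 vec3_coords)

lemma coords_scale: "coords (c *s v) = scale c (coords v)"
  by (simp add: coords_def)

lemma abs_proj_plane_eq_iff:
  assumes "v \<noteq> 0" "w \<noteq> 0"
  shows "abs_proj_plane v = abs_proj_plane w \<longleftrightarrow> (\<exists>c. c \<noteq> 0 \<and> w = c *s v)"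
proof -
  have refl: "proj_rel v v" "proj_rel w w"
    using assms by (auto simp: proj_rel_def intro!: exI[of _ 1])
  then have "abs_proj_plane v = abs_proj_plane w \<longleftrightarrow> proj_rel v w"
    using Quotient_rel[OF Quotient_proj_plane, of v w] by blast
  then show ?thesis
    using assms by (simp add: proj_rel_def)
qed

text \<open>Lines and conics are images under the quotient map. Invariance of \<open>P\<close> under
  scaling makes membership independent of the representative of a point.\<close>

lemma abs_proj_plane_mem_iff:
  assumes "v \<noteq> 0" and P: "\<And>c w. c \<noteq> 0 \<Longrightarrow> P (c *s w) \<Longrightarrow> P w"
  shows "abs_proj_plane v \<in> abs_proj_plane ` {w. w \<noteq> 0 \<and> P w} \<longleftrightarrow> P v"
proof
  assume "abs_proj_plane v \<in> abs_proj_plane ` {w. w \<noteq> 0 \<and> P w}"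
  then obtain w where "w \<noteq> 0" "P w" "abs_proj_plane v = abs_proj_plane w"
    by blast
  with assms show "P v"
    by (metis abs_proj_plane_eq_iff)
qed (use assms in blast)

lemma ex_pt: "\<exists>t. t \<noteq> (0, 0, 0) \<and> P = pt t"
proof -
  have "proj_rel (rep_proj_plane P) (rep_proj_plane P)"
    using Quotient_rep_reflp[OF Quotient_proj_plane] .
  moreover have "P = abs_proj_plane (rep_proj_plane P)"
    using Quotient_abs_rep[OF Quotient_proj_plane] by metis
  ultimately show ?thesis
    by (intro exI[of _ "coords (rep_proj_plane P)"])
       (metis coords_vec3 pt_def proj_rel_def vec3_coords vec3_eq_0_iff)
qed

lemma ex_pt_family: "\<exists>p. (\<forall>i. p i \<noteq> (0, 0, 0)) \<and> P = (\<lambda>i. pt (p i))"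
proof -
  have "\<forall>i. \<exists>t. t \<noteq> (0, 0, 0) \<and> P i = pt t"
    using ex_pt by blast
  then obtain p where "\<forall>i. p i \<noteq> (0, 0, 0) \<and> P i = pt (p i)"
    by metis
  then show ?thesis by (intro exI[of _ p]) auto
qed

lemma cross_eq_0_iff:
  fixes u v :: "'a::field triple"
  assumes "u \<noteq> (0, 0, 0)" "v \<noteq> (0, 0, 0)"
  shows "cross u v = (0, 0, 0) \<longleftrightarrow> (\<exists>c. c \<noteq> 0 \<and> v = scale c u)"
proof
  assume cr: "cross u v = (0, 0, 0)"
  obtain x y z where u: "u = (x, y, z)" by (cases u)
  obtain x' y' z' where v: "v = (x', y', z')" by (cases v)
  have eqs: "y * z' = z * y'" "z * x' = x * z'" "x * y' = y * x'"
    using cr by (simp_all add: u v)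
  have "\<exists>c. v = scale c u"
  proof -
    consider "x \<noteq> 0" | "y \<noteq> 0" | "z \<noteq> 0" using assms u by auto
    then show ?thesis
    proof cases
      case 1 then show ?thesis using eqs by (intro exI[of _ "x' / x"]) (simp add: u v field_simps)
    next
      case 2 then show ?thesis using eqs by (intro exI[of _ "y' / y"]) (simp add: u v field_simps)
    next
      case 3 then show ?thesis using eqs by (intro exI[of _ "z' / z"]) (simp add: u v field_simps)
    qed
  qed
  then show "\<exists>c. c \<noteq> 0 \<and> v = scale c u"
    using assms(2) by (metis scale_0)
next
  assume "\<exists>c. c \<noteq> 0 \<and> v = scale c u"
  then show "cross u v = (0, 0, 0)"
    by (cases u) auto
qed

lemma pt_eq_iff:
  fixes u v :: "'a::field triple"
  assumes "u \<noteq> (0, 0, 0)" "v \<noteq> (0, 0, 0)"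
  shows "pt u = pt v \<longleftrightarrow> cross u v = (0, 0, 0)"
proof -
  have "pt u = pt v \<longleftrightarrow> (\<exists>c. c \<noteq> 0 \<and> vec3 v = c *s vec3 u)"
    unfolding pt_def using assms by (intro abs_proj_plane_eq_iff) (simp_all add: vec3_eq_0_iff)
  also have "\<dots> \<longleftrightarrow> (\<exists>c. c \<noteq> 0 \<and> v = scale c u)"
    by (metis coords_scale coords_vec3 vec3_coords)
  finally show ?thesis
    using cross_eq_0_iff[OF assms] by simp
qed

lemma on_line_iff:
  assumes "\<forall>t\<in>T. t \<noteq> (0, 0, 0)"
  shows "(\<exists>L\<in>lines. pt ` T \<subseteq> L) \<longleftrightarrow> (\<exists>a. a \<noteq> (0, 0, 0) \<and> (\<forall>t\<in>T. linear_form a t = 0))"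
proof -
  have sum: "(\<Sum>i\<in>UNIV. a $ i * v $ i) = linear_form (coords a) (coords v)" for a v :: "'a ^ 3"
    by (simp add: sum_3 coords_def linear_form_def)
  have mem: "pt t \<in> abs_proj_plane ` {v. v \<noteq> 0 \<and> (\<Sum>i\<in>UNIV. a $ i * v $ i) = 0} \<longleftrightarrow> linear_form (coords a) t = 0"
    if "t \<noteq> (0, 0, 0)" for t and a :: "'a ^ 3"
    unfolding pt_def sum
    by (subst abs_proj_plane_mem_iff) (auto simp: that vec3_eq_0_iff coords_scale linear_form_scale)
  have line: "pt ` T \<subseteq> abs_proj_plane ` {v. v \<noteq> 0 \<and> (\<Sum>i\<in>UNIV. a $ i * v $ i) = 0} \<longleftrightarrow>
      (\<forall>t\<in>T. linear_form (coords a) t = 0)" for a :: "'a ^ 3"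
    unfolding image_subset_iff using assms mem by (intro ball_cong) blast+
  have "(\<exists>L\<in>lines. pt ` T \<subseteq> L) \<longleftrightarrow> (\<exists>a::'a ^ 3. a \<noteq> 0 \<and> (\<forall>t\<in>T. linear_form (coords a) t = 0))"
    unfolding line[symmetric] lines_def by blast
  also have "\<dots> \<longleftrightarrow> (\<exists>a. a \<noteq> (0, 0, 0) \<and> (\<forall>t\<in>T. linear_form a t = 0))"
  proof -
    have ex: "(\<exists>a. P a) \<longleftrightarrow> (\<exists>t. P (vec3 t))" for P :: "'a ^ 3 \<Rightarrow> bool"
      by (metis vec3_coords)
    show ?thesis
      by (subst ex) (simp only: vec3_eq_0_iff coords_vec3)
  qed
  finally show ?thesis .
qed

lemma collinear_iff_det3:
  assumes "u \<noteq> (0, 0, 0)" "v \<noteq> (0, 0, 0)" "w \<noteq> (0, 0, 0)"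
  shows "(\<exists>L\<in>lines. {pt u, pt v, pt w} \<subseteq> L) \<longleftrightarrow> det3 u v w = 0"
  using on_line_iff[of "{u, v, w}"] assms by (simp add: det3_eq_0_iff)

lemma on_conic_iff:
  assumes "\<forall>t\<in>T. t \<noteq> (0, 0, 0)"
  shows "(\<exists>C\<in>conics. pt ` T \<subseteq> C) \<longleftrightarrow>
     (\<exists>f. homogeneous 2 f \<and> irreducible f \<and> (\<forall>t\<in>T. eval_mpoly3 f (vec3 t) = 0))"
proof -
  have mem: "pt t \<in> abs_proj_plane ` {v. v \<noteq> 0 \<and> eval_mpoly3 f v = 0} \<longleftrightarrow> eval_mpoly3 f (vec3 t) = 0"
    if t: "t \<noteq> (0, 0, 0)" and f2: "homogeneous 2 f" for t and f :: "'a mpoly3"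
  proof -
    obtain a b where f: "f = quadratic_form (const_triple a) (const_triple b) vars3"
      using homogeneous_2_cases[OF f2] .
    show ?thesis
      unfolding pt_def f
      by (subst abs_proj_plane_mem_iff)
         (auto simp: t vec3_eq_0_iff eval_quadratic_form coords_scale quadratic_form_scale)
  qed
  have conic: "pt ` T \<subseteq> abs_proj_plane ` {v. v \<noteq> 0 \<and> eval_mpoly3 f v = 0} \<longleftrightarrow>
      (\<forall>t\<in>T. eval_mpoly3 f (vec3 t) = 0)" if "homogeneous 2 f" for f :: "'a mpoly3"
    unfolding image_subset_iff using assms mem that by (intro ball_cong) blast+
  show ?thesis
    unfolding conics_def using conic by blast
qed

text \<open>The condition on triples is not implied by the determinant: \<open>conic_det\<close>
  vanishes for six points on a pair of lines as well.\<close>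

lemma coconic_iff:
  assumes T: "T = {u, v, w, p, q, r}" and card: "card T = 6"
    and nz: "\<And>t. t \<in> T \<Longrightarrow> t \<noteq> (0, 0, 0)"
    and dist: "\<And>s t. s \<in> T \<Longrightarrow> t \<in> T \<Longrightarrow> s \<noteq> t \<Longrightarrow> cross s t \<noteq> (0, 0, 0)"
  shows "(\<exists>C\<in>conics. pt ` T \<subseteq> C) \<longleftrightarrow>
     (\<forall>x\<in>T. \<forall>y\<in>T. \<forall>z\<in>T. x \<noteq> y \<and> x \<noteq> z \<and> y \<noteq> z \<longrightarrow> det3 x y z \<noteq> 0) \<and> conic_det u v w p q r = 0"
    (is "?L \<longleftrightarrow> ?R")
proof
  assume ?L
  then obtain f where f: "homogeneous 2 f" "irreducible f" "\<forall>t\<in>T. eval_mpoly3 f (vec3 t) = 0"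
    using on_conic_iff nz by metis
  obtain a b where q: "f = quadratic_form (const_triple a) (const_triple b) vars3"
    using homogeneous_2_cases[OF f(1)] .
  have z: "quadratic_form a b t = 0" if "t \<in> T" for t
    using f(3) that by (simp add: q eval_quadratic_form)
  have nocol: "det3 x y z \<noteq> 0" if "x \<in> T" "y \<in> T" "z \<in> T" "x \<noteq> y" "x \<noteq> z" "y \<noteq> z" for x y z
    using irreducible_no_three_collinear[OF f(2)[unfolded q]] z that dist by simp
  have "distinct [u, v, w, p, q, r]"
    using card unfolding T by (intro card_distinct) simp
  then have "det3 u v w \<noteq> 0"
    using nocol by (simp add: T)
  then have "conic_det u v w p q r = 0"
    using conic_det_eq_0_if_conic[OF f(2)[unfolded q]] z by (simp add: T)
  with nocol show ?R by blast
next
  assume ?R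
  then obtain f where "homogeneous 2 f" "irreducible f" "\<forall>x. coords x \<in> T \<longrightarrow> eval_mpoly3 f x = 0"
    using conic_if_conic_det_eq_0[OF T card] by blast
  then show ?L
    using on_conic_iff[of T] nz by (metis coords_vec3)
qed

subsection \<open>Configurations of maximal lines and conics\<close>

text \<open>Polymorphic because the points of a block occur as a set in the theory, as a list in the
  catalogue and as a Boolean vector in computations; \<open>Line ()\<close> and
  \<open>Conic ()\<close> stand for the bare kind of a block.\<close>

datatype 'a block = Line (points: 'a) | Conic (points: 'a)

fun max_meet :: "'a block \<Rightarrow> 'b block \<Rightarrow> nat" where
  "max_meet (Line _) (Line _) = 1"
| "max_meet (Conic _) (Conic _) = 4"
| "max_meet (Line _) (Conic _) = 2"
| "max_meet (Conic _) (Line _) = 2"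

fun min_points :: "'a block \<Rightarrow> nat" where
  "min_points (Line _) = 3"
| "min_points (Conic _) = 6"

definition admissible :: "nat set block \<Rightarrow> bool" where
  "admissible b \<longleftrightarrow> points b \<subseteq> {1..8} \<and> min_points b \<le> card (points b)"

definition compatible :: "nat set block \<Rightarrow> nat set block \<Rightarrow> bool" where
  "compatible b c \<longleftrightarrow> card (points b \<inter> points c) \<le> max_meet b c"

definition configuration :: "nat set block set \<Rightarrow> bool" where
  "configuration S \<longleftrightarrow> (\<forall>b\<in>S. admissible b) \<and> (\<forall>b\<in>S. \<forall>c\<in>S. b \<noteq> c \<longrightarrow> compatible b c)"

text \<open>Configurations are built up by adding first the lines and then the conics, each time in decreasing order of size.\<close>

fun rank :: "nat set block \<Rightarrow> nat" where
  "rank (Conic C) = card C"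
| "rank (Line L) = 8 + card L"

section \<open>Encoding of configurations and enumeration of their extensions\<close>

type_synonym config = "nat list block list"

definition blocks :: "config \<Rightarrow> nat set block set" where
  "blocks R = map_block set ` set R"

text \<open>The index i has its entry at position i - 1. For subsets of \<open>{1..8}\<close>
  equality of sets becomes equality of lists, which can be decided without sorting.\<close>

definition char_vec :: "nat set \<Rightarrow> bool list" where
  "char_vec A = map (\<lambda>i. i \<in> A) [1..<9]"

definition vecs :: "config \<Rightarrow> bool list block list" where
  "vecs = map (map_block (\<lambda>xs. char_vec (set xs)))"

fun weight :: "bool list \<Rightarrow> nat" where
  "weight [] = 0"
| "weight (True # v) = Suc (weight v)"
| "weight (False # v) = weight v"

text \<open>The largest size that the next line may have in the order by rank. The value 0 after a
  conic expresses that no line may follow a conic.\<close>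

fun max_line :: "bool list block list \<Rightarrow> nat" where
  "max_line [] = 8"
| "max_line (Line v # R) = min (weight v) (max_line R)"
| "max_line (Conic v # R) = 0"

fun max_conic :: "bool list block list \<Rightarrow> nat" where
  "max_conic [] = 8"
| "max_conic (Line v # R) = max_conic R"
| "max_conic (Conic v # R) = min (weight v) (max_conic R)"

text \<open>A pair \<open>(k, v)\<close> is a constraint whose budget \<open>k\<close> bounds the
  entries \<open>True\<close> still to be shared with the rest \<open>v\<close>. Choosing
  \<open>True\<close> for the next entry costs one unit in each vector that begins with
  \<open>True\<close>; \<open>None\<close> means that some budget is exhausted.\<close>

fun add_point :: "(nat \<times> bool list) list \<Rightarrow> (nat \<times> bool list) list option" where
  "add_point [] = Some []"
| "add_point ((k, []) # bs) = None"
| "add_point ((k, True # v) # bs) =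
     (case k of 0 \<Rightarrow> None | Suc k \<Rightarrow> map_option (Cons (k, v)) (add_point bs))"
| "add_point ((k, False # v) # bs) = map_option (Cons (k, v)) (add_point bs)"

text \<open>
  \<open>vectors n s bs\<close> enumerates the vectors of length \<open>n\<close> with at most \<open>s\<close> entries \<open>False\<close> that have at most
  \<open>k\<close> entries \<open>True\<close> in common with \<open>v\<close>, for each \<open>(k, v)\<close> in \<open>bs\<close>.
\<close>

fun vectors :: "nat \<Rightarrow> nat \<Rightarrow> (nat \<times> bool list) list \<Rightarrow> bool list list" where
  "vectors 0 s bs = [[]]"
| "vectors (Suc n) s bs =
     (case add_point bs of None \<Rightarrow> [] | Some bs' \<Rightarrow> map (Cons True) (vectors n s bs')) @
     (case s of 0 \<Rightarrow> [] | Suc s \<Rightarrow> map (Cons False) (vectors n s (map (map_prod id tl) bs)))"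

text \<open>The constraint with the constant vector \<open>True\<close> bounds the size of the new
  block from above. At most 5 or 2 entries \<open>False\<close> among 8 means at least 3 points for
  a line and 6 for a conic.\<close>

definition candidates :: "bool list block list \<Rightarrow> bool list block list" where
  "candidates R =
     (case max_line R of 0 \<Rightarrow> [] | Suc l \<Rightarrow>
       map Line (vectors 8 5 ((Suc l, replicate 8 True) # map (\<lambda>b. (max_meet (Line ()) b, points b)) R))) @
     map Conic (vectors 8 2 ((max_conic R, replicate 8 True) # map (\<lambda>b. (max_meet (Conic ()) b, points b)) R))"

definition same_elements :: "'a list \<Rightarrow> 'a list \<Rightarrow> bool" where
  "same_elements xs ys \<longleftrightarrow> list_all (List.member xs) ys \<and> list_all (List.member ys) xs"

text \<open>
  A permutation of \<open>{1..8}\<close> is given by the list \<open>\<tau>\<close> of its values; the leading \<open>0\<close> accounts for the indices starting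
  at 1. An entry \<open>(\<tau>, R')\<close> of a certificate says that \<open>\<tau>\<close> maps \<open>R'\<close> to the extension of \<open>R\<close> by a candidate block.
\<close>

definition relabels :: "nat list \<Rightarrow> config \<Rightarrow> bool list block list \<Rightarrow> bool" where
  "relabels \<tau> R S \<longleftrightarrow> length \<tau> = 8 \<and> list_all (List.member \<tau>) [1..<9] \<and>
     same_elements (map (map_block (\<lambda>xs. char_vec (nth (0 # \<tau>) ` set xs))) R) S"

text \<open>The certificate lists its entries in the order in which the candidates are enumerated,
  so checking it involves no search for a matching entry.\<close>

fun all_relabelled :: "bool list block list \<Rightarrow> bool list block list \<Rightarrow> (nat list \<times> config) list \<Rightarrow> bool" where
  "all_relabelled S [] [] \<longleftrightarrow> True"
| "all_relabelled S (b # bs) ((\<tau>, R) # cs) \<longleftrightarrow> relabels \<tau> R (b # S) \<and> all_relabelled S bs cs"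
| "all_relabelled _ _ _ \<longleftrightarrow> False"

definition in_range :: "config \<Rightarrow> bool" where
  "in_range R \<longleftrightarrow> list_all (\<lambda>b. list_all (\<lambda>i. 1 \<le> i \<and> i \<le> 8) (points b)) R"

definition extends :: "config \<Rightarrow> (nat list \<times> config) list \<Rightarrow> bool" where
  "extends R cs \<longleftrightarrow> in_range R \<and> all_relabelled (vecs R) (candidates (vecs R)) cs"

definition common :: "bool list \<Rightarrow> bool list \<Rightarrow> nat" where
  "common v w = length (filter (\<lambda>(x, y). x \<and> y) (zip v w))"

section \<open>Completeness of the enumeration\<close>

lemma add_point_Some:
  assumes "\<forall>(k, w)\<in>set bs. length w = Suc n \<and> common (True # v) w \<le> k"
  obtains bs' where "add_point bs = Some bs'" "\<forall>(k, w)\<in>set bs'. length w = n \<and> common v w \<le> k"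
proof -
  have "\<exists>bs'. add_point bs = Some bs' \<and> (\<forall>(k, w)\<in>set bs'. length w = n \<and> common v w \<le> k)"
    using assms
  proof (induction bs rule: add_point.induct)
    case (3 k w bs)
    then obtain k' where k': "k = Suc k'"
      by (cases k) (auto simp: common_def)
    with 3 show ?case by (auto simp: common_def)
  qed (auto simp: common_def)
  then show ?thesis using that by blast
qed

lemma vectors_complete:
  assumes "length v = n" "length (filter Not v) \<le> s"
    and "\<forall>(k, w)\<in>set bs. length w = n \<and> common v w \<le> k"
  shows "v \<in> set (vectors n s bs)"
  using assms
proof (induction n arbitrary: v s bs)
  case (Suc n)
  obtain x u where v: "v = x # u"
    using Suc.prems(1) by (metis length_Suc_conv)
  show ?case
  proof (cases x)
    case True
    then obtain bs' where "add_point bs = Some bs'" "\<forall>(k, w)\<in>set bs'. length w = n \<and> common u w \<le> k"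
      using add_point_Some[of bs n u] Suc.prems v by auto
    then show ?thesis
      using Suc.IH[of u s bs'] Suc.prems v True by auto
  next
    case False
    then obtain s' where s: "s = Suc s'" using Suc.prems v by (cases s) auto
    have "\<forall>(k, w)\<in>set (map (map_prod id tl) bs). length w = n \<and> common u w \<le> k"
    proof (clarsimp)
      fix k w assume "(k, w) \<in> set bs"
      with Suc.prems have "length w = Suc n" "common v w \<le> k" by auto
      then show "length w - Suc 0 = n \<and> common u (tl w) \<le> k"
        using v by (cases w) (auto simp: common_def split: if_splits)
    qed
    then show ?thesis
      using Suc.IH[of u s' "map (map_prod id tl) bs"] Suc.prems v s False by auto
  qed
qed simp

lemma length_char_vec [simp]: "length (char_vec A) = 8"
  by (simp add: char_vec_def)

lemma card_filter_upt: "length (filter (\<lambda>i. i \<in> A) [1..<9]) = card (A \<inter> {1..8})"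
proof -
  have "length (filter (\<lambda>i. i \<in> A) [1..<9]) = card (set (filter (\<lambda>i. i \<in> A) [1..<9]))"
    by (intro distinct_card[symmetric]) simp
  also have "set (filter (\<lambda>i. i \<in> A) [1..<9]) = A \<inter> {1..8}"
    by auto
  finally show ?thesis .
qed

lemma common_char_vec: "common (char_vec A) (char_vec B) = card (A \<inter> B \<inter> {1..8})"
  unfolding common_def char_vec_def zip_map_map
  using card_filter_upt[of "A \<inter> B"] by (simp add: filter_map o_def zip_same_conv_map split_def)

lemma weight_eq: "weight v = length (filter id v)"
  by (induction v rule: weight.induct) auto

lemma weight_char_vec: "weight (char_vec A) = card (A \<inter> {1..8})"
  using card_filter_upt[of A] by (simp add: weight_eq char_vec_def filter_map o_def)

lemma common_replicate: "common v (replicate (length v) True) = weight v"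
  by (induction v rule: weight.induct) (auto simp: common_def)

lemma filter_Not_char_vec: "length (filter Not (char_vec A)) = 8 - card (A \<inter> {1..8})"
proof -
  have "length (filter id (char_vec A)) + length (filter Not (char_vec A)) = 8"
    using sum_length_filter_compl[of id "char_vec A"] by (simp add: comp_def)
  then show ?thesis
    using weight_char_vec[of A] by (simp add: weight_eq)
qed

lemma char_vec_inject:
  assumes "A \<subseteq> {1..8}" "B \<subseteq> {1..8}" "char_vec A = char_vec B"
  shows "A = B"
proof -
  have "\<forall>i\<in>{1..8}. i \<in> A \<longleftrightarrow> i \<in> B"
    using assms(3) by (simp add: char_vec_def)
  then show ?thesis using assms by blast
qed

lemma points_map_block [simp]: "points (map_block f b) = f (points b)"
  by (cases b) simp_all

lemma max_meet_map_block [simp]: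
  "max_meet (map_block f b) c = max_meet b c" "max_meet b (map_block g c) = max_meet b c"
  by (cases b; cases c; simp)+

lemma max_meet_shape:
  "max_meet (Line A) c = max_meet (Line B) c" "max_meet (Conic A) c = max_meet (Conic B) c"
  by (cases c; simp)+

text \<open>A line has rank at least 11 and a conic of \<open>R\<close> rank at most 8. A line of
  least rank therefore rules out conics in \<open>R\<close>, the only case in which
  \<open>max_line\<close> would be 0.\<close>

lemma max_line_ge:
  assumes "in_range R" "\<forall>b\<in>blocks R. rank (Line A) \<le> rank b" "card A \<le> 8" "3 \<le> card A"
  shows "card A \<le> max_line (vecs R)"
  using assms
proof (induction R)
  case (Cons b R)
  then have IH: "card A \<le> max_line (vecs R)"
    by (simp add: in_range_def blocks_def)
  show ?case
  proof (cases b)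
    case (Line L)
    moreover have "set L \<subseteq> {1..8}"
      using Cons.prems(1) Line by (auto simp: in_range_def list_all_iff)
    ultimately show ?thesis
      using IH Cons.prems(2) by (simp add: vecs_def blocks_def weight_char_vec Int_absorb2)
  next
    case (Conic C)
    moreover have "set C \<subseteq> {1..8}"
      using Cons.prems(1) Conic by (auto simp: in_range_def list_all_iff)
    then have "card (set C) \<le> 8"
      using card_mono[of "{1..8::nat}" "set C"] by simp
    ultimately show ?thesis
      using Cons.prems(2,4) by (simp add: blocks_def)
  qed
qed (simp add: vecs_def)

lemma max_conic_ge:
  assumes "in_range R" "\<forall>b\<in>blocks R. rank (Conic A) \<le> rank b" "card A \<le> 8"
  shows "card A \<le> max_conic (vecs R)"
  using assms
proof (induction R)
  case (Cons b R)
  then have IH: "card A \<le> max_conic (vecs R)"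
    by (simp add: in_range_def blocks_def)
  show ?case
  proof (cases b)
    case (Line L)
    then show ?thesis
      using IH by (simp add: vecs_def)
  next
    case (Conic C)
    moreover have "set C \<subseteq> {1..8}"
      using Cons.prems(1) Conic by (auto simp: in_range_def list_all_iff)
    ultimately show ?thesis
      using IH Cons.prems(2) by (simp add: vecs_def blocks_def weight_char_vec Int_absorb2)
  qed
qed (simp add: vecs_def)

text \<open>Treats lines and conics at once: \<open>f\<close> and \<open>g\<close> give the
  admissible intersection with an existing block, the former in terms of sets and the latter in
  terms of vectors.\<close>

lemma char_vec_in_vectors:
  assumes A: "A \<subseteq> {1..8}" "card A \<le> m" "8 - card A \<le> s"
    and meet: "\<forall>b\<in>blocks R. card (A \<inter> points b) \<le> f b"
    and f: "\<And>xs::nat list block. f (map_block set xs) = g (map_block (\<lambda>xs. char_vec (set xs)) xs)"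
  shows "char_vec A \<in> set (vectors 8 s ((m, replicate 8 True) # map (\<lambda>b. (g b, points b)) (vecs R)))"
proof (rule vectors_complete)
  have "common (char_vec A) (replicate 8 True) = card A"
    using common_replicate[of "char_vec A"] A by (simp add: weight_char_vec Int_absorb2)
  moreover have "common (char_vec A) (char_vec (set (points b))) \<le> g (map_block (\<lambda>xs. char_vec (set xs)) b)"
    if "b \<in> set R" for b
  proof -
    have "card (A \<inter> set (points b)) \<le> f (map_block set b)"
      using meet that by (auto simp: blocks_def)
    moreover have "A \<inter> set (points b) \<inter> {1..8} = A \<inter> set (points b)"
      using A by blast
    ultimately show ?thesis
      by (simp only: common_char_vec f)
  qed
  ultimately show "\<forall>(k, w)\<in>set ((m, replicate 8 True) # map (\<lambda>b. (g b, points b)) (vecs R)).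
      length w = 8 \<and> common (char_vec A) w \<le> k"
    using A by (auto simp: vecs_def)
  show "length (filter Not (char_vec A)) \<le> s"
    using A by (simp add: filter_Not_char_vec Int_absorb2)
qed simp

lemma candidates_complete:
  assumes R: "in_range R" and b: "admissible b" "\<forall>c\<in>blocks R. compatible b c" "\<forall>c\<in>blocks R. rank b \<le> rank c"
  shows "map_block char_vec b \<in> set (candidates (vecs R))"
proof (cases b)
  case (Line A)
  then have A: "A \<subseteq> {1..8}" "3 \<le> card A"
    using b(1) by (simp_all add: admissible_def)
  then have "card A \<le> 8"
    using card_mono[of "{1..8::nat}" A] by simp
  then have max: "card A \<le> max_line (vecs R)"
    using max_line_ge[OF R] b(3) A Line by simp
  have "char_vec A \<in> set (vectors 8 5 ((max_line (vecs R), replicate 8 True) #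
      map (\<lambda>b. (max_meet (Line ()) b, points b)) (vecs R)))"
    using A max b(2) Line
    by (intro char_vec_in_vectors[where f = "max_meet (Line ())"]) (auto simp: compatible_def max_meet_shape(1)[of "()" _ A])
  then show ?thesis
    using max A Line by (cases "max_line (vecs R)") (auto simp: candidates_def)
next
  case (Conic A)
  then have A: "A \<subseteq> {1..8}" "6 \<le> card A"
    using b(1) by (simp_all add: admissible_def)
  then have "card A \<le> 8"
    using card_mono[of "{1..8::nat}" A] by simp
  then have max: "card A \<le> max_conic (vecs R)"
    using max_conic_ge[OF R] b(3) A Conic by simp
  have "char_vec A \<in> set (vectors 8 2 ((max_conic (vecs R), replicate 8 True) #
      map (\<lambda>b. (max_meet (Conic ()) b, points b)) (vecs R)))"
    using A max b(2) Conic
    by (intro char_vec_in_vectors[where f = "max_meet (Conic ())"]) (auto simp: compatible_def max_meet_shape(2)[of "()" _ A])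
  then show ?thesis
    using Conic by (simp add: candidates_def)
qed

section \<open>Relabelling and the classification of configurations\<close>

lemma list_permutes:
  assumes "length \<tau> = 8" "list_all (List.member \<tau>) [1..<9]"
  defines "\<sigma> \<equiv> \<lambda>i. if i \<in> {1..8} then (0 # \<tau>) ! i else i"
  shows "\<sigma> permutes {1..8}"
proof (rule bij_imp_permutes)
  have "{1..8} \<subseteq> set \<tau>"
    using assms(2) by (auto simp: list_all_iff)
  moreover have "card (set \<tau>) \<le> 8"
    using card_length[of \<tau>] assms(1) by simp
  ultimately have "{1..8} = set \<tau>"
    by (intro card_seteq) auto
  also have "set \<tau> = (\<lambda>i. (0 # \<tau>) ! i) ` {1..8}"
  proof -
    have "{1..8} = Suc ` {..<8::nat}"
      by (simp add: image_Suc_lessThan)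
    then show ?thesis
      using assms(1) by (auto simp: image_image set_conv_nth)
  qed
  also have "\<dots> = \<sigma> ` {1..8}"
    by (simp add: \<sigma>_def)
  finally have img: "\<sigma> ` {1..8} = {1..8}" ..
  then show "bij_betw \<sigma> {1..8} {1..8}"
    by (simp add: bij_betw_def eq_card_imp_inj_on)
qed (auto simp: \<sigma>_def)

text \<open>The check compares lists of vectors. Since \<open>char_vec\<close> is injective on
  subsets of \<open>{1..8}\<close>, equality of the sets of vectors carries over to equality of the
  sets of blocks.\<close>

lemma relabels_blocks:
  assumes "relabels \<tau> R (map_block char_vec b # vecs R')" "in_range R" "in_range R'" "points b \<subseteq> {1..8}"
  shows "\<exists>\<sigma>. \<sigma> permutes {1..8} \<and> insert b (blocks R') = map_block (image \<sigma>) ` blocks R"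
proof -
  define \<sigma> where "\<sigma> = (\<lambda>i. if i \<in> {1..8} then (0 # \<tau>) ! i else i)"
  have perm: "\<sigma> permutes {1..8}"
    unfolding \<sigma>_def using assms(1) by (intro list_permutes) (auto simp: relabels_def)
  have "(nth (0 # \<tau>)) ` set (points c) = \<sigma> ` set (points c)" if "c \<in> set R" for c
    using assms(2) that by (intro image_cong) (auto simp: in_range_def list_all_iff \<sigma>_def)
  then have R: "map_block (\<lambda>xs. char_vec (nth (0 # \<tau>) ` set xs)) c = map_block char_vec (map_block (image \<sigma>) (map_block set c))"
    if "c \<in> set R" for c
    using that by (cases c) fastforce+
  have "map_block char_vec ` insert b (blocks R') = set (map_block char_vec b # vecs R')"
    by (auto simp: blocks_def vecs_def image_image block.map_comp o_def)
  also have "\<dots> = set (map (map_block (\<lambda>xs. char_vec (nth (0 # \<tau>) ` set xs))) R)"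
    using assms(1) by (auto simp: relabels_def same_elements_def list_all_iff)
  also have "\<dots> = map_block char_vec ` map_block (image \<sigma>) ` blocks R"
    using R by (simp add: blocks_def image_image cong: image_cong_simp)
  finally have eq: "map_block char_vec ` insert b (blocks R') = map_block char_vec ` map_block (image \<sigma>) ` blocks R" .
  have inj: "inj_on (map_block char_vec) {c. points c \<subseteq> {1..8}}"
  proof (rule inj_onI)
    fix c d :: "nat set block"
    assume "c \<in> {c. points c \<subseteq> {1..8}}" "d \<in> {c. points c \<subseteq> {1..8}}" "map_block char_vec c = map_block char_vec d"
    then show "c = d"
      by (cases c; cases d) (auto dest: char_vec_inject[unfolded One_nat_def])
  qed
  have range: "points c \<subseteq> {1..8}" if "c \<in> blocks R" "in_range R" for c R
    using that by (auto simp: blocks_def in_range_def list_all_iff)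
  have "insert b (blocks R') = map_block (image \<sigma>) ` blocks R"
  proof (rule inj_on_image_eq_iff[THEN iffD1, OF inj _ _ eq])
    show "insert b (blocks R') \<subseteq> {c. points c \<subseteq> {1..8}}"
      using assms(3,4) range by blast
    show "map_block (image \<sigma>) ` blocks R \<subseteq> {c. points c \<subseteq> {1..8}}"
    proof -
      have "\<sigma> ` points c \<subseteq> {1..8}" if "c \<in> blocks R" for c
        using range[OF that assms(2)] permutes_image[OF perm] by blast
      then show ?thesis
        by (simp only: image_subset_iff[of "map_block (image \<sigma>)"] mem_Collect_eq points_map_block) blast
    qed
  qed
  with perm show ?thesis by blast
qed

lemma all_relabelled_member:
  assumes "all_relabelled S bs cs" "b \<in> set bs"
  shows "\<exists>\<tau> R. (\<tau>, R) \<in> set cs \<and> relabels \<tau> R (b # S)"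
  using assms by (induction S bs cs rule: all_relabelled.induct) auto

definition extension_closed :: "config set \<Rightarrow> bool" where
  "extension_closed \<C> \<longleftrightarrow> [] \<in> \<C> \<and> (\<forall>R\<in>\<C>. \<exists>cs. extends R cs \<and> snd ` set cs \<subseteq> \<C>)"

lemma map_block_image_comp: "map_block (image f) ` map_block (image g) ` S = map_block (image (f \<circ> g)) ` S"
proof -
  have "map_block (image f) (map_block (image g) b) = map_block (image (f \<circ> g)) b" for b
    by (cases b) (simp_all add: image_comp)
  then show ?thesis by (simp add: image_image)
qed

text \<open>The block taken away in the induction is one of least rank. The rest is a relabelling of
  some \<open>R\<close>, and the block, moved to the labels of \<open>R\<close>, is among the
  candidates because sizes, intersections and ranks survive relabelling. Its certificate leads to
  the next entry, and the two permutations are composed.\<close>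

theorem configuration_classification:
  assumes \<C>: "extension_closed \<C>" and S: "configuration S"
  shows "\<exists>R\<in>\<C>. \<exists>\<sigma>. \<sigma> permutes {1..8} \<and> S = map_block (image \<sigma>) ` blocks R"
proof -
  have "S \<subseteq> Line ` Pow {1..8} \<union> Conic ` Pow {1..8}"
  proof
    fix b assume "b \<in> S"
    with S show "b \<in> Line ` Pow {1..8} \<union> Conic ` Pow {1..8}"
      by (cases b) (auto simp: configuration_def admissible_def)
  qed
  then have "finite S"
    by (rule finite_subset) simp
  then show ?thesis
    using S
  proof (induction "card S" arbitrary: S)
    case 0
    then show ?case
      using \<C> by (intro bexI[of _ "[]"] exI[of _ id]) (auto simp: extension_closed_def blocks_def permutes_def)
  next
    case (Suc n)
    then have "S \<noteq> {}" by auto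
    then obtain b where b: "b \<in> S" "\<forall>c\<in>S. rank b \<le> rank c"
      using Suc.prems(1) by (metis arg_min_least arg_min_if_finite(1))
    have "n = card (S - {b})" "finite (S - {b})"
      using Suc.hyps(2) Suc.prems(1) b(1) by simp_all
    moreover have "configuration (S - {b})"
      using Suc.prems(2) by (auto simp: configuration_def)
    ultimately obtain R \<sigma> where R: "R \<in> \<C>" "\<sigma> permutes {1..8}" "S - {b} = map_block (image \<sigma>) ` blocks R"
      using Suc.hyps(1)[of "S - {b}"] by blast
    \<comment> \<open>The removed block in the labels of \<open>R\<close>, to which the enumeration
      applies.\<close>
    define b' where "b' = map_block (image (inv \<sigma>)) b"
    have inv: "inv \<sigma> permutes {1..8}"
      using R(2) by (rule permutes_inv)
    have inj: "inj \<sigma>" "inj (inv \<sigma>)"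
      using permutes_inj[OF R(2)] permutes_inj[OF inv] by blast+
    have bb': "b = map_block (image \<sigma>) b'"
      unfolding b'_def using permutes_surj[OF R(2)] by (cases b) (simp_all add: image_comp surj_iff)
    obtain cs where cs: "extends R cs" "snd ` set cs \<subseteq> \<C>"
      using \<C> R(1) by (auto simp: extension_closed_def)
    have rk: "rank (map_block (image \<sigma>) c) = rank c" for c
      using inj(1) by (cases c) (simp_all add: card_image inj_on_subset)
    have "admissible b" using Suc.prems(2) b(1) by (simp add: configuration_def)
    then have adm: "admissible b'"
      using permutes_image[OF inv] inj(2) unfolding b'_def
      by (cases b) (auto simp: admissible_def card_image inj_on_subset)
    have "compatible b' c" "rank b' \<le> rank c" if "c \<in> blocks R" for c
    proof -
      let ?d = "map_block (image \<sigma>) c"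
      have d: "?d \<in> S" "?d \<noteq> b" using R(3) that by blast+
      then have "compatible b ?d"
        using Suc.prems(2) b(1) by (auto simp: configuration_def)
      moreover have "card (points b \<inter> points ?d) = card (points b' \<inter> points c)"
        using inj(1) by (simp add: bb' card_image inj_on_subset flip: image_Int)
      ultimately show "compatible b' c"
        by (simp add: compatible_def bb')
      show "rank b' \<le> rank c"
        using b(2) d(1) rk by (metis bb')
    qed
    then have "map_block char_vec b' \<in> set (candidates (vecs R))"
      using cs(1) adm by (intro candidates_complete) (auto simp: extends_def)
    then obtain \<tau> R' where R': "(\<tau>, R') \<in> set cs" "relabels \<tau> R' (map_block char_vec b' # vecs R)"
      using cs(1) all_relabelled_member by (metis extends_def)
    then have "R' \<in> \<C>" using cs(2) by force
    then have "in_range R'" using \<C> by (auto simp: extension_closed_def extends_def)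
    then obtain \<rho> where \<rho>: "\<rho> permutes {1..8}" "insert b' (blocks R) = map_block (image \<rho>) ` blocks R'"
      using relabels_blocks[OF R'(2)] cs(1) adm by (auto simp: extends_def admissible_def)
    have "S = insert b (S - {b})" using b(1) by blast
    also have "\<dots> = map_block (image \<sigma>) ` insert b' (blocks R)"
      using R(3) bb' by simp
    also have "\<dots> = map_block (image (\<sigma> \<circ> \<rho>)) ` blocks R'"
      by (simp only: \<rho>(2) map_block_image_comp)
    finally show ?case
      using \<open>R' \<in> \<C>\<close> permutes_compose[OF \<rho>(1) R(2)] by blast
  qed
qed

section \<open>From index pairs to configurations\<close>

definition pair_of :: "nat set block set \<Rightarrow> index_pair" where
  "pair_of S = ({I. I \<subseteq> {1..8} \<and> card I = 3 \<and> (\<exists>L. Line L \<in> S \<and> I \<subseteq> L)},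
     {J. J \<subseteq> {1..8} \<and> card J = 6 \<and> (\<exists>C. Conic C \<in> S \<and> J \<subseteq> C)})"

text \<open>The common abstraction of collinear sets, with k = 3, and coconic sets, with k = 6. In
  \<open>meet_closed\<close> the bound k - 2 yields 1 and 4, the second and third of the weak
  criteria.\<close>

definition full :: "nat \<Rightarrow> 'a set set \<Rightarrow> 'a set \<Rightarrow> bool" where
  "full k F B \<longleftrightarrow> finite B \<and> k \<le> card B \<and> (\<forall>T. T \<subseteq> B \<and> card T = k \<longrightarrow> T \<in> F)"

definition maximal_full :: "nat \<Rightarrow> 'a set set \<Rightarrow> 'a set \<Rightarrow> 'a set \<Rightarrow> bool" where
  "maximal_full k F U B \<longleftrightarrow> B \<subseteq> U \<and> full k F B \<and> (\<forall>C. C \<subseteq> U \<and> full k F C \<and> B \<subseteq> C \<longrightarrow> C = B)"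

definition meet_closed :: "nat \<Rightarrow> 'a set set \<Rightarrow> bool" where
  "meet_closed k F \<longleftrightarrow> (\<forall>T1\<in>F. \<forall>T2\<in>F. T1 \<noteq> T2 \<and> card (T1 \<inter> T2) > k - 2 \<longrightarrow>
     (\<forall>T. T \<subseteq> T1 \<union> T2 \<and> card T = k \<longrightarrow> T \<in> F))"

text \<open>An exchange argument shows that adjoining \<open>c\<close> to any (k - 1)-subset
  \<open>T\<close> of \<open>B\<close> gives a member of \<open>F\<close>, by induction on the
  number of elements of \<open>T\<close> outside \<open>A\<close>. For \<open>T = A\<close> the
  result is a k-subset of \<open>C\<close>.\<close>

lemma full_insert:
  assumes closed: "meet_closed k F" and k: "2 \<le> k"
    and B: "full k F B" and C: "full k F C"
    and A: "A \<subseteq> B \<inter> C" "card A = k - 1" and c: "c \<in> C" "c \<notin> B"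
  shows "full k F (insert c B)"
proof -
  have finB: "finite B" and finA: "finite A"
    using B A(1) by (auto simp: full_def intro: finite_subset)
  have "insert c T \<in> F" if "T \<subseteq> B" "card T = k - 1" for T
    using that
  proof (induction "card (T - A)" arbitrary: T)
    case 0
    have "finite T" using 0 finB by (auto intro: finite_subset)
    then have "T \<subseteq> A" using 0 by simp
    then have "T = A" using 0 A(2) finA by (intro card_subset_eq) auto
    moreover have "card (insert c A) = k"
      using A c finA k by (subst card_insert_disjoint) auto
    ultimately show ?case
      using C A(1) c(1) by (auto simp: full_def)
  next
    case (Suc n)
    have finT: "finite T" using Suc.prems finB by (auto intro: finite_subset)
    obtain b where b: "b \<in> T" "b \<notin> A"
      using Suc.hyps(2) by (metis DiffE card.empty equals0I nat.distinct(1))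
    have "\<not> A \<subseteq> T"
      using card_subset_eq[OF finT, of A] A(2) Suc.prems(2) b by auto
    then obtain a where a: "a \<in> A" "a \<notin> T" by blast
    \<comment> \<open>\<open>A'\<close> is closer to \<open>A\<close> than \<open>T\<close> is.
      Adjoining \<open>c\<close> to it gives a member of \<open>F\<close> by induction, adjoining
      \<open>b\<close> gives a k-subset of \<open>B\<close>; the two share the k - 1 elements of
      \<open>A'\<close>, and their union contains \<open>insert c T\<close>.\<close>
    define A' where "A' = insert a (T - {b})"
    have cardA': "card A' = k - 1"
      using a b finT Suc.prems(2) k by (simp add: A'_def)
    have "A' - A = (T - A) - {b}" using a by (auto simp: A'_def)
    then have "n = card (A' - A)" using Suc.hyps(2) b finT by simp
    moreover have subA': "A' \<subseteq> B" using a A(1) Suc.prems(1) by (auto simp: A'_def)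
    ultimately have 1: "insert c A' \<in> F" using Suc.hyps(1) cardA' by blast
    have "insert b A' = insert a T" using b by (auto simp: A'_def)
    moreover have "card (insert a T) = k" using a finT Suc.prems(2) k by simp
    ultimately have 2: "insert b A' \<in> F"
      using B subA' b Suc.prems(1) unfolding full_def by (metis insert_subset subsetD)
    have "b \<noteq> c" "c \<notin> A'" using b c Suc.prems(1) subA' by auto
    then have "insert c A' \<noteq> insert b A'" by (metis insertE insertI1)
    moreover have "insert c A' \<inter> insert b A' = A'" using \<open>b \<noteq> c\<close> \<open>c \<notin> A'\<close> by (auto simp: A'_def)
    then have "card (insert c A' \<inter> insert b A') > k - 2" using cardA' k by simp
    moreover have "insert c T \<subseteq> insert c A' \<union> insert b A'" by (auto simp: A'_def)
    moreover have "card (insert c T) = k"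
      using finT c Suc.prems k by (subst card_insert_disjoint) auto
    ultimately show ?case
      using closed[unfolded meet_closed_def, rule_format, OF 1 2, of "insert c T"] by blast
  qed
  then have "T \<in> F" if "T \<subseteq> insert c B" "card T = k" for T
  proof (cases "c \<in> T")
    case True
    then have "T = insert c (T - {c})" "T - {c} \<subseteq> B" "card (T - {c}) = k - 1"
      using that by auto
    then show ?thesis
      using \<open>\<And>T. T \<subseteq> B \<Longrightarrow> card T = k - 1 \<Longrightarrow> insert c T \<in> F\<close> by metis
  next
    case False
    then show ?thesis using that B by (auto simp: full_def)
  qed
  moreover have "k \<le> card (insert c B)"
    using B card_insert_le[of B c] unfolding full_def by linarith
  ultimately show ?thesis
    using finB by (simp add: full_def)
qed

text \<open>With k - 1 common elements, \<open>B\<close> could be enlarged by a point of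
  \<open>C\<close> outside it, against maximality.\<close>

lemma maximal_full_meet:
  assumes "meet_closed k F" "2 \<le> k" "maximal_full k F U B" "maximal_full k F U C" "B \<noteq> C"
  shows "card (B \<inter> C) \<le> k - 2"
proof (rule ccontr)
  assume "\<not> ?thesis"
  then have "k - 1 \<le> card (B \<inter> C)" using assms(2) by linarith
  then obtain A where A: "A \<subseteq> B \<inter> C" "card A = k - 1"
    by (rule obtain_subset_with_card_n)
  have "\<not> C \<subseteq> B" using assms(3-5) unfolding maximal_full_def by blast
  then obtain c where c: "c \<in> C" "c \<notin> B" by blast
  then have "full k F (insert c B)"
    using full_insert[OF assms(1,2) _ _ A] assms(3,4) unfolding maximal_full_def by blast
  moreover have "insert c B \<subseteq> U"
    using assms(3,4) c(1) unfolding maximal_full_def by blast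
  ultimately have "insert c B = B"
    using assms(3) unfolding maximal_full_def by (metis subset_insertI)
  then show False using c(2) by blast
qed

lemma ex_maximal_full:
  assumes "T \<in> F" "card T = k" "T \<subseteq> U" "finite U"
  shows "\<exists>B. maximal_full k F U B \<and> T \<subseteq> B"
proof -
  have "finite T" using assms by (auto intro: finite_subset)
  then have "full k F T"
    using assms(1,2) card_subset_eq[of T] by (simp add: full_def) metis
  with assms(3) have T: "T \<in> {B. B \<subseteq> U \<and> full k F B}" by blast
  have fin: "finite {B. B \<subseteq> U \<and> full k F B}"
    using assms(4) by simp
  obtain B where B: "B \<in> {B. B \<subseteq> U \<and> full k F B}" "T \<subseteq> B"
      "\<forall>C\<in>{B. B \<subseteq> U \<and> full k F B}. B \<subseteq> C \<longrightarrow> B = C"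
    using finite_has_maximal2[OF fin T] by blast
  have "C = B" if "C \<subseteq> U" "full k F C" "B \<subseteq> C" for C
    using B(3) that by (metis (mono_tags, lifting) mem_Collect_eq)
  with B(1,2) show ?thesis
    unfolding maximal_full_def by blast
qed

lemma mem_iff_maximal_full:
  assumes "\<forall>T\<in>F. T \<subseteq> U \<and> card T = k" "finite U"
  shows "F = {T. T \<subseteq> U \<and> card T = k \<and> (\<exists>B. maximal_full k F U B \<and> T \<subseteq> B)}"
proof (intro equalityI subsetI)
  fix T assume "T \<in> F"
  then show "T \<in> {T. T \<subseteq> U \<and> card T = k \<and> (\<exists>B. maximal_full k F U B \<and> T \<subseteq> B)}"
    using assms ex_maximal_full[of T F k U] by blast
qed (auto simp: maximal_full_def full_def)

theorem bezout_configuration: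
  assumes "is_index_pair Q" "bezout_weak Q"
  shows "\<exists>S. configuration S \<and> pair_of S = Q"
proof -
  define lin con where "lin = maximal_full 3 (fst Q) {1..8}" and "con = maximal_full 6 (snd Q) {1..8}"
  define S where "S = {Line L | L. lin L} \<union> {Conic C | C. con C}"
  have minus23: "3 - 2 = (1::nat)" "6 - 2 = (4::nat)" by simp_all
  have closed: "meet_closed 3 (fst Q)" "meet_closed 6 (snd Q)"
    using assms(2) unfolding bezout_weak_def meet_closed_def minus23 by - (elim conjE, assumption)+
  have Q: "fst Q = {T. T \<subseteq> {1..8} \<and> card T = 3 \<and> (\<exists>B. lin B \<and> T \<subseteq> B)}"
      "snd Q = {T. T \<subseteq> {1..8} \<and> card T = 6 \<and> (\<exists>B. con B \<and> T \<subseteq> B)}"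
    unfolding lin_def con_def
    by (rule mem_iff_maximal_full; use assms(1) in \<open>auto simp: is_index_pair_def\<close>)+
  have "pair_of S = (fst Q, snd Q)"
    unfolding Q by (auto simp: pair_of_def S_def)
  moreover have LL: "card (L \<inter> L') \<le> 1" if "lin L" "lin L'" "L \<noteq> L'" for L L'
    using maximal_full_meet[OF closed(1) _ _ _ that(3)] that by (simp add: lin_def)
  have CC: "card (C \<inter> C') \<le> 4" if "con C" "con C'" "C \<noteq> C'" for C C'
    using maximal_full_meet[OF closed(2) _ _ _ that(3)] that by (simp add: con_def)
  have LC: "card (L \<inter> C) \<le> 2" if "lin L" "con C" for L C
  proof (rule ccontr)
    assume "\<not> ?thesis"
    then have "3 \<le> card (L \<inter> C)" by simp
    then obtain T where T: "T \<subseteq> L \<inter> C" "card T = 3"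
      by (rule obtain_subset_with_card_n)
    have C: "full 6 (snd Q) C" and L: "full 3 (fst Q) L"
      using that by (auto simp: lin_def con_def maximal_full_def)
    \<comment> \<open>The first criterion speaks of six-element sets only, so the three common
      points are completed to such a subset of the possibly larger \<open>C\<close>.\<close>
    obtain J where J: "T \<subseteq> J" "J \<subseteq> C" "card J = 6"
      using T C exists_subset_between[of T 6 C] by (auto simp: full_def)
    then have "T \<inter> J = T" by blast
    moreover have "T \<in> fst Q" "J \<in> snd Q"
      using T L J C by (auto simp: full_def)
    ultimately show False
      using assms(2) T(2) unfolding bezout_weak_def by fastforce
  qed
  then have CL: "card (C \<inter> L) \<le> 2" if "lin L" "con C" for L C
    using LC[OF that] by (simp add: Int_commute)
  have "admissible b" if "b \<in> S" for b
    using that by (auto simp: S_def lin_def con_def maximal_full_def full_def admissible_def)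
  moreover have "compatible b c" if "b \<in> S" "c \<in> S" "b \<noteq> c" for b c
    using that LL CC LC CL unfolding S_def compatible_def
    by (cases b; cases c) auto
  ultimately show ?thesis
    by (auto simp: configuration_def)
qed

lemma permute_pair_of:
  assumes "\<sigma> permutes {1..8}"
  shows "permute_pair \<sigma> (pair_of S) = pair_of (map_block (image \<sigma>) ` S)"
proof -
  have inj: "inj \<sigma>" using assms by (rule permutes_inj)
  have sub: "\<sigma> ` A \<subseteq> {1..8} \<longleftrightarrow> A \<subseteq> {1..8}" for A
    using permutes_image[OF assms] inj by (metis inj_image_subset_iff)
  have card: "card (\<sigma> ` A) = card A" for A
    using inj by (simp add: card_image inj_on_subset)
  have surj: "\<exists>A. B = \<sigma> ` A" for B
    using permutes_surj[OF assms] by (metis surj_image_vimage_eq)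
  have img: "(\<lambda>I. \<sigma> ` I) ` {I. P I} = {I. P' I}" if "\<And>I. P' (\<sigma> ` I) \<longleftrightarrow> P I" for P P'
  proof (intro equalityI subsetI)
    fix B assume "B \<in> {I. P' I}"
    moreover obtain A where "B = \<sigma> ` A" using surj by blast
    ultimately show "B \<in> (\<lambda>I. \<sigma> ` I) ` {I. P I}" using that by blast
  qed (use that in blast)
  have "Line (\<sigma> ` L) \<in> map_block (image \<sigma>) ` S \<longleftrightarrow> Line L \<in> S"
      "Conic (\<sigma> ` L) \<in> map_block (image \<sigma>) ` S \<longleftrightarrow> Conic L \<in> S" for L
  proof -
    have "inj (map_block (image \<sigma>))"
      using inj by (intro block.inj_map) (simp add: inj_def inj_image_eq_iff[OF inj])
    then show "Line (\<sigma> ` L) \<in> map_block (image \<sigma>) ` S \<longleftrightarrow> Line L \<in> S"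
        "Conic (\<sigma> ` L) \<in> map_block (image \<sigma>) ` S \<longleftrightarrow> Conic L \<in> S"
      by (metis block.map inj_image_mem_iff)+
  qed
  then have ex: "(\<exists>L. Line L \<in> map_block (image \<sigma>) ` S \<and> \<sigma> ` I \<subseteq> L) \<longleftrightarrow> (\<exists>L. Line L \<in> S \<and> I \<subseteq> L)"
      "(\<exists>L. Conic L \<in> map_block (image \<sigma>) ` S \<and> \<sigma> ` I \<subseteq> L) \<longleftrightarrow> (\<exists>L. Conic L \<in> S \<and> I \<subseteq> L)" for I
    using surj inj by (metis inj_image_subset_iff)+
  show ?thesis
    unfolding permute_pair_def pair_of_def fst_conv snd_conv
    by (intro arg_cong2[of _ _ _ _ Pair] img) (simp_all only: sub card ex)
qed

subsection \<open>The catalogue of configurations\<close>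

text \<open>The entries are ordered by their number of blocks. Within an entry lines precede conics
  and larger lines precede smaller ones.\<close>

definition "K0 = ([] :: config)"
definition "K1 = ([Line [1,2,3]] :: config)"
definition "K2 = ([Line [1,2,3,4]] :: config)"
definition "K3 = ([Line [1,2,3,4,5]] :: config)"
definition "K4 = ([Line [1,2,3,4,5,6]] :: config)"
definition "K5 = ([Line [1,2,3,4,5,6,7]] :: config)"
definition "K6 = ([Line [1,2,3,4,5,6,7,8]] :: config)"
definition "K7 = ([Conic [1,2,3,4,5,6]] :: config)"
definition "K8 = ([Conic [1,2,3,4,5,6,7]] :: config)"
definition "K9 = ([Conic [1,2,3,4,5,6,7,8]] :: config)"
definition "K10 = ([Line [1,2,3], Line [1,4,5]] :: config)"
definition "K11 = ([Line [1,2,3], Line [4,5,6]] :: config)"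
definition "K12 = ([Line [1,2,3], Conic [1,2,4,5,6,7]] :: config)"
definition "K13 = ([Line [1,2,3], Conic [1,4,5,6,7,8]] :: config)"
definition "K14 = ([Line [1,2,3], Conic [1,2,4,5,6,7,8]] :: config)"
definition "K15 = ([Line [1,2,3,4], Line [1,5,6]] :: config)"
definition "K16 = ([Line [1,2,3,4], Line [5,6,7]] :: config)"
definition "K17 = ([Line [1,2,3,4], Line [1,5,6,7]] :: config)"
definition "K18 = ([Line [1,2,3,4], Line [5,6,7,8]] :: config)"
definition "K19 = ([Line [1,2,3,4], Conic [1,2,5,6,7,8]] :: config)"
definition "K20 = ([Line [1,2,3,4,5], Line [1,6,7]] :: config)"
definition "K21 = ([Line [1,2,3,4,5], Line [6,7,8]] :: config)"
definition "K22 = ([Line [1,2,3,4,5], Line [1,6,7,8]] :: config)"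
definition "K23 = ([Line [1,2,3,4,5,6], Line [1,7,8]] :: config)"
definition "K24 = ([Conic [1,2,3,4,5,6], Conic [1,2,3,4,7,8]] :: config)"
definition "K25 = ([Line [1,2,3], Line [1,4,5], Line [2,4,6]] :: config)"
definition "K26 = ([Line [1,2,3], Line [1,4,5], Line [1,6,7]] :: config)"
definition "K27 = ([Line [1,2,3], Line [1,4,5], Line [2,6,7]] :: config)"
definition "K28 = ([Line [1,2,3], Line [1,4,5], Line [6,7,8]] :: config)"
definition "K29 = ([Line [1,2,3], Line [1,4,5], Conic [2,3,4,5,6,7]] :: config)"
definition "K30 = ([Line [1,2,3], Line [1,4,5], Conic [1,2,4,6,7,8]] :: config)"
definition "K31 = ([Line [1,2,3], Line [1,4,5], Conic [2,3,4,6,7,8]] :: config)"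
definition "K32 = ([Line [1,2,3], Line [1,4,5], Conic [2,3,4,5,6,7,8]] :: config)"
definition "K33 = ([Line [1,2,3], Line [4,5,6], Conic [1,2,4,5,7,8]] :: config)"
definition "K34 = ([Line [1,2,3], Conic [1,2,4,5,6,7], Conic [1,3,4,5,6,8]] :: config)"
definition "K35 = ([Line [1,2,3], Conic [1,2,4,5,6,7], Conic [3,4,5,6,7,8]] :: config)"
definition "K36 = ([Line [1,2,3,4], Line [1,5,6], Line [2,5,7]] :: config)"
definition "K37 = ([Line [1,2,3,4], Line [1,5,6], Line [1,7,8]] :: config)"
definition "K38 = ([Line [1,2,3,4], Line [1,5,6], Line [2,7,8]] :: config)"
definition "K39 = ([Line [1,2,3,4], Line [1,5,6], Line [5,7,8]] :: config)"
definition "K40 = ([Line [1,2,3,4], Line [1,5,6], Conic [2,3,5,6,7,8]] :: config)"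
definition "K41 = ([Line [1,2,3,4], Line [1,5,6,7], Line [2,5,8]] :: config)"
definition "K42 = ([Line [1,2,3,4], Conic [1,2,5,6,7,8], Conic [3,4,5,6,7,8]] :: config)"
definition "K43 = ([Line [1,2,3,4,5], Line [1,6,7], Line [2,6,8]] :: config)"
definition "K44 = ([Conic [1,2,3,4,5,6], Conic [1,2,3,4,7,8], Conic [1,2,5,6,7,8]] :: config)"
definition "K45 = ([Line [1,2,3], Line [1,4,5], Line [2,4,6], Line [3,5,6]] :: config)"
definition "K46 = ([Line [1,2,3], Line [1,4,5], Line [2,4,6], Line [3,4,7]] :: config)"
definition "K47 = ([Line [1,2,3], Line [1,4,5], Line [2,4,6], Line [3,5,7]] :: config)"
definition "K48 = ([Line [1,2,3], Line [1,4,5], Line [2,4,6], Line [1,7,8]] :: config)"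
definition "K49 = ([Line [1,2,3], Line [1,4,5], Line [2,4,6], Line [3,7,8]] :: config)"
definition "K50 = ([Line [1,2,3], Line [1,4,5], Line [2,4,6], Conic [2,3,4,5,7,8]] :: config)"
definition "K51 = ([Line [1,2,3], Line [1,4,5], Line [2,4,6], Conic [1,3,5,6,7,8]] :: config)"
definition "K52 = ([Line [1,2,3], Line [1,4,5], Line [1,6,7], Conic [2,3,4,5,6,7]] :: config)"
definition "K53 = ([Line [1,2,3], Line [1,4,5], Line [1,6,7], Conic [2,3,4,5,6,8]] :: config)"
definition "K54 = ([Line [1,2,3], Line [1,4,5], Line [1,6,7], Conic [2,3,4,5,6,7,8]] :: config)"
definition "K55 = ([Line [1,2,3], Line [1,4,5], Line [2,6,7], Line [4,6,8]] :: config)"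
definition "K56 = ([Line [1,2,3], Line [1,4,5], Line [2,6,7], Conic [2,3,4,5,6,8]] :: config)"
definition "K57 = ([Line [1,2,3], Line [1,4,5], Line [2,6,7], Conic [3,4,5,6,7,8]] :: config)"
definition "K58 = ([Line [1,2,3], Line [1,4,5], Line [6,7,8], Conic [2,3,4,5,6,7]] :: config)"
definition "K59 = ([Line [1,2,3], Line [1,4,5], Conic [2,3,4,5,6,7], Conic [1,2,4,6,7,8]] :: config)"
definition "K60 = ([Line [1,2,3], Line [1,4,5], Conic [1,2,4,6,7,8], Conic [1,3,5,6,7,8]] :: config)"
definition "K61 = ([Line [1,2,3], Line [1,4,5], Conic [1,2,4,6,7,8], Conic [2,3,5,6,7,8]] :: config)"
definition "K62 = ([Line [1,2,3], Line [4,5,6], Conic [1,2,4,5,7,8], Conic [1,3,4,6,7,8]] :: config)"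
definition "K63 = ([Line [1,2,3], Conic [1,2,4,5,6,7], Conic [1,3,4,5,6,8], Conic [2,3,4,5,7,8]] :: config)"
definition "K64 = ([Line [1,2,3,4], Line [1,5,6], Line [2,5,7], Line [3,6,7]] :: config)"
definition "K65 = ([Line [1,2,3,4], Line [1,5,6], Line [2,5,7], Line [3,5,8]] :: config)"
definition "K66 = ([Line [1,2,3,4], Line [1,5,6], Line [2,5,7], Line [2,6,8]] :: config)"
definition "K67 = ([Line [1,2,3,4], Line [1,5,6], Line [2,5,7], Line [3,6,8]] :: config)"
definition "K68 = ([Line [1,2,3,4], Line [1,5,6], Line [2,5,7], Line [6,7,8]] :: config)"
definition "K69 = ([Line [1,2,3,4], Line [1,5,6], Line [2,5,7], Conic [3,4,5,6,7,8]] :: config)"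
definition "K70 = ([Line [1,2,3,4], Line [1,5,6], Line [1,7,8], Conic [2,3,5,6,7,8]] :: config)"
definition "K71 = ([Line [1,2,3,4], Line [1,5,6], Line [2,7,8], Conic [3,4,5,6,7,8]] :: config)"
definition "K72 = ([Line [1,2,3,4], Line [1,5,6,7], Line [2,5,8], Line [3,6,8]] :: config)"
definition "K73 = ([Line [1,2,3,4,5], Line [1,6,7], Line [2,6,8], Line [3,7,8]] :: config)"
definition "K74 = ([Conic [1,2,3,4,5,6], Conic [1,2,3,4,7,8], Conic [1,2,5,6,7,8], Conic [3,4,5,6,7,8]] :: config)"
definition "K75 = ([Line [1,2,3], Line [1,4,5], Line [2,4,6], Line [3,5,6], Line [3,4,7]] :: config)"
definition "K76 = ([Line [1,2,3], Line [1,4,5], Line [2,4,6], Line [3,5,6], Line [1,7,8]] :: config)"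
definition "K77 = ([Line [1,2,3], Line [1,4,5], Line [2,4,6], Line [3,5,6], Conic [2,3,4,5,7,8]] :: config)"
definition "K78 = ([Line [1,2,3], Line [1,4,5], Line [2,4,6], Line [3,4,7], Line [5,6,7]] :: config)"
definition "K79 = ([Line [1,2,3], Line [1,4,5], Line [2,4,6], Line [3,4,7], Line [2,5,8]] :: config)"
definition "K80 = ([Line [1,2,3], Line [1,4,5], Line [2,4,6], Line [3,4,7], Line [5,6,8]] :: config)"
definition "K81 = ([Line [1,2,3], Line [1,4,5], Line [2,4,6], Line [3,4,7], Conic [1,2,5,6,7,8]] :: config)"
definition "K82 = ([Line [1,2,3], Line [1,4,5], Line [2,4,6], Line [3,5,7], Line [3,6,8]] :: config)"
definition "K83 = ([Line [1,2,3], Line [1,4,5], Line [2,4,6], Line [3,5,7], Line [6,7,8]] :: config)"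
definition "K84 = ([Line [1,2,3], Line [1,4,5], Line [2,4,6], Line [3,5,7], Conic [1,3,4,6,7,8]] :: config)"
definition "K85 = ([Line [1,2,3], Line [1,4,5], Line [2,4,6], Line [1,7,8], Conic [2,3,4,5,7,8]] :: config)"
definition "K86 = ([Line [1,2,3], Line [1,4,5], Line [2,4,6], Line [1,7,8], Conic [2,3,5,6,7,8]] :: config)"
definition "K87 = ([Line [1,2,3], Line [1,4,5], Line [2,4,6], Line [3,7,8], Conic [1,2,5,6,7,8]] :: config)"
definition "K88 = ([Line [1,2,3], Line [1,4,5], Line [2,4,6], Conic [2,3,4,5,7,8], Conic [1,3,4,6,7,8]] :: config)"
definition "K89 = ([Line [1,2,3], Line [1,4,5], Line [2,4,6], Conic [2,3,4,5,7,8], Conic [1,3,5,6,7,8]] :: config)"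
definition "K90 = ([Line [1,2,3], Line [1,4,5], Line [2,6,7], Line [4,6,8], Conic [2,3,4,5,7,8]] :: config)"
definition "K91 = ([Line [1,2,3], Line [1,4,5], Line [2,6,7], Conic [2,3,4,5,6,8], Conic [1,3,4,6,7,8]] :: config)"
definition "K92 = ([Line [1,2,3], Line [1,4,5], Conic [2,3,4,5,6,7], Conic [1,2,4,6,7,8], Conic [1,3,5,6,7,8]] :: config)"
definition "K93 = ([Line [1,2,3], Line [4,5,6], Conic [1,2,4,5,7,8], Conic [1,3,4,6,7,8], Conic [2,3,5,6,7,8]] :: config)"
definition "K94 = ([Line [1,2,3,4], Line [1,5,6], Line [2,5,7], Line [3,6,7], Line [3,5,8]] :: config)"
definition "K95 = ([Line [1,2,3,4], Line [1,5,6], Line [2,5,7], Line [3,6,7], Line [4,5,8]] :: config)"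
definition "K96 = ([Line [1,2,3,4], Line [1,5,6], Line [2,5,7], Line [3,5,8], Line [6,7,8]] :: config)"
definition "K97 = ([Line [1,2,3,4], Line [1,5,6], Line [2,5,7], Line [2,6,8], Line [1,7,8]] :: config)"
definition "K98 = ([Line [1,2,3,4], Line [1,5,6], Line [2,5,7], Line [2,6,8], Line [3,7,8]] :: config)"
definition "K99 = ([Line [1,2,3,4], Line [1,5,6], Line [2,5,7], Line [2,6,8], Conic [3,4,5,6,7,8]] :: config)"
definition "K100 = ([Line [1,2,3,4], Line [1,5,6], Line [2,5,7], Line [3,6,8], Line [4,7,8]] :: config)"
definition "K101 = ([Line [1,2,3,4], Line [1,5,6,7], Line [2,5,8], Line [3,6,8], Line [4,7,8]] :: config)"
definition "K102 = ([Line [1,2,3], Line [1,4,5], Line [2,4,6], Line [3,5,6], Line [3,4,7], Line [2,5,7]] :: config)"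
definition "K103 = ([Line [1,2,3], Line [1,4,5], Line [2,4,6], Line [3,5,6], Line [3,4,7], Line [2,5,8]] :: config)"
definition "K104 = ([Line [1,2,3], Line [1,4,5], Line [2,4,6], Line [3,5,6], Line [3,4,7], Line [1,7,8]] :: config)"
definition "K105 = ([Line [1,2,3], Line [1,4,5], Line [2,4,6], Line [3,5,6], Line [3,4,7], Conic [1,2,5,6,7,8]] :: config)"
definition "K106 = ([Line [1,2,3], Line [1,4,5], Line [2,4,6], Line [3,5,6], Line [1,7,8], Conic [2,3,4,5,7,8]] :: config)"
definition "K107 = ([Line [1,2,3], Line [1,4,5], Line [2,4,6], Line [3,5,6], Conic [2,3,4,5,7,8], Conic [1,3,4,6,7,8]] :: config)"
definition "K108 = ([Line [1,2,3], Line [1,4,5], Line [2,4,6], Line [3,4,7], Line [5,6,7], Line [2,5,8]] :: config)"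
definition "K109 = ([Line [1,2,3], Line [1,4,5], Line [2,4,6], Line [3,4,7], Line [2,5,8], Line [6,7,8]] :: config)"
definition "K110 = ([Line [1,2,3], Line [1,4,5], Line [2,4,6], Line [3,4,7], Line [2,5,8], Conic [1,3,5,6,7,8]] :: config)"
definition "K111 = ([Line [1,2,3], Line [1,4,5], Line [2,4,6], Line [3,5,7], Line [3,6,8], Line [4,7,8]] :: config)"
definition "K112 = ([Line [1,2,3], Line [1,4,5], Line [2,4,6], Line [3,5,7], Line [3,6,8], Conic [1,2,5,6,7,8]] :: config)"
definition "K113 = ([Line [1,2,3], Line [1,4,5], Line [2,4,6], Line [3,5,7], Conic [1,3,4,6,7,8], Conic [1,2,5,6,7,8]] :: config)"
definition "K114 = ([Line [1,2,3], Line [1,4,5], Line [2,4,6], Conic [2,3,4,5,7,8], Conic [1,3,4,6,7,8], Conic [1,2,5,6,7,8]] :: config)"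
definition "K115 = ([Line [1,2,3], Line [1,4,5], Line [2,6,7], Line [4,6,8], Conic [2,3,4,5,7,8], Conic [1,3,5,6,7,8]] :: config)"
definition "K116 = ([Line [1,2,3,4], Line [1,5,6], Line [2,5,7], Line [3,6,7], Line [3,5,8], Line [2,6,8]] :: config)"
definition "K117 = ([Line [1,2,3,4], Line [1,5,6], Line [2,5,7], Line [3,6,7], Line [3,5,8], Line [4,6,8]] :: config)"
definition "K118 = ([Line [1,2,3,4], Line [1,5,6], Line [2,5,7], Line [2,6,8], Line [1,7,8], Conic [3,4,5,6,7,8]] :: config)"
text \<open>The Fano plane on 1, ..., 7, with 8 on none of its lines.\<close>

definition "K_fano = ([Line [1,2,3], Line [1,4,5], Line [2,4,6], Line [3,5,6], Line [3,4,7], Line [2,5,7], Line [1,6,7]] :: config)"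
definition "K120 = ([Line [1,2,3], Line [1,4,5], Line [2,4,6], Line [3,5,6], Line [3,4,7], Line [2,5,7], Line [1,6,8]] :: config)"
definition "K121 = ([Line [1,2,3], Line [1,4,5], Line [2,4,6], Line [3,5,6], Line [3,4,7], Line [2,5,8], Line [1,7,8]] :: config)"
definition "K_Q63 = ([Line [1,2,3], Line [1,4,5], Line [2,4,6], Line [3,5,6], Conic [1,2,5,6,7,8], Conic [1,3,4,6,7,8], Conic [2,3,4,5,7,8]] :: config)"
definition "K123 = ([Line [1,2,3], Line [1,4,5], Line [2,4,6], Line [3,4,7], Line [5,6,7], Line [2,5,8], Line [3,6,8]] :: config)"
definition "K124 = ([Line [1,2,3], Line [1,4,5], Line [2,4,6], Line [3,5,7], Line [3,6,8], Line [4,7,8], Conic [1,2,5,6,7,8]] :: config)"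
definition "K_fano_point = ([Line [1,2,3,4], Line [1,5,6], Line [2,5,7], Line [3,6,7], Line [3,5,8], Line [2,6,8], Line [1,7,8]] :: config)"
definition "K126 = ([Line [1,2,3,4], Line [1,5,6], Line [2,5,7], Line [3,6,7], Line [3,5,8], Line [2,6,8], Line [4,7,8]] :: config)"
text \<open>The Moebius-Kantor configuration: eight points and eight lines, with three points on
  each line and three lines through each point.\<close>

definition "K_Q41 = ([Line [1,2,3], Line [1,4,5], Line [1,6,7], Line [2,4,6], Line [2,5,8], Line [3,5,7], Line [3,6,8], Line [4,7,8]] :: config)"

definition catalogue :: "config set" where
  "catalogue = {
     K0, K1, K2, K3, K4, K5, K6, K7, K8, K9, K10, K11, K12, K13, K14, K15, K16, K17, K18, K19, K20, K21, K22, K23,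
     K24, K25, K26, K27, K28, K29, K30, K31, K32, K33, K34, K35, K36, K37, K38, K39, K40, K41, K42, K43, K44, K45,
     K46, K47, K48, K49, K50, K51, K52, K53, K54, K55, K56, K57, K58, K59, K60, K61, K62, K63, K64, K65, K66, K67,
     K68, K69, K70, K71, K72, K73, K74, K75, K76, K77, K78, K79, K80, K81, K82, K83, K84, K85, K86, K87, K88, K89,
     K90, K91, K92, K93, K94, K95, K96, K97, K98, K99, K100, K101, K102, K103, K104, K105, K106, K107, K108, K109,
     K110, K111, K112, K113, K114, K115, K116, K117, K118, K_fano, K120, K121, K_Q63, K123, K124, K_fano_point, K126,
     K_Q41}"

text \<open>One pair of a permutation and a catalogue entry for each candidate block, in the order
  of \<open>candidates\<close>. An empty list records that there are no candidates.\<close>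

lemma extends_1:
  "extends K0 [
    ([1,2,3,4,5,6,7,8],K6), ([1,2,3,4,5,6,7,8],K5), ([1,2,3,4,5,6,8,7],K5), ([1,2,3,4,5,6,7,8],K4),
    ([1,2,3,4,5,7,8,6],K5), ([1,2,3,4,5,7,6,8],K4), ([1,2,3,4,5,8,6,7],K4), ([1,2,3,4,5,6,7,8],K3),
    ([1,2,3,4,6,7,8,5],K5), ([1,2,3,4,6,7,5,8],K4), ([1,2,3,4,6,8,5,7],K4), ([1,2,3,4,6,5,7,8],K3),
    ([1,2,3,4,7,8,5,6],K4), ([1,2,3,4,7,5,6,8],K3), ([1,2,3,4,8,5,6,7],K3), ([1,2,3,4,5,6,7,8],K2),
    ([1,2,3,5,6,7,8,4],K5), ([1,2,3,5,6,7,4,8],K4), ([1,2,3,5,6,8,4,7],K4), ([1,2,3,5,6,4,7,8],K3),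
    ([1,2,3,5,7,8,4,6],K4), ([1,2,3,5,7,4,6,8],K3), ([1,2,3,5,8,4,6,7],K3), ([1,2,3,5,4,6,7,8],K2),
    ([1,2,3,6,7,8,4,5],K4), ([1,2,3,6,7,4,5,8],K3), ([1,2,3,6,8,4,5,7],K3), ([1,2,3,6,4,5,7,8],K2),
    ([1,2,3,7,8,4,5,6],K3), ([1,2,3,7,4,5,6,8],K2), ([1,2,3,8,4,5,6,7],K2), ([1,2,3,4,5,6,7,8],K1),
    ([1,2,4,5,6,7,8,3],K5), ([1,2,4,5,6,7,3,8],K4), ([1,2,4,5,6,8,3,7],K4), ([1,2,4,5,6,3,7,8],K3),
    ([1,2,4,5,7,8,3,6],K4), ([1,2,4,5,7,3,6,8],K3), ([1,2,4,5,8,3,6,7],K3), ([1,2,4,5,3,6,7,8],K2),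
    ([1,2,4,6,7,8,3,5],K4), ([1,2,4,6,7,3,5,8],K3), ([1,2,4,6,8,3,5,7],K3), ([1,2,4,6,3,5,7,8],K2),
    ([1,2,4,7,8,3,5,6],K3), ([1,2,4,7,3,5,6,8],K2), ([1,2,4,8,3,5,6,7],K2), ([1,2,4,3,5,6,7,8],K1),
    ([1,2,5,6,7,8,3,4],K4), ([1,2,5,6,7,3,4,8],K3), ([1,2,5,6,8,3,4,7],K3), ([1,2,5,6,3,4,7,8],K2),
    ([1,2,5,7,8,3,4,6],K3), ([1,2,5,7,3,4,6,8],K2), ([1,2,5,8,3,4,6,7],K2), ([1,2,5,3,4,6,7,8],K1),
    ([1,2,6,7,8,3,4,5],K3), ([1,2,6,7,3,4,5,8],K2), ([1,2,6,8,3,4,5,7],K2), ([1,2,6,3,4,5,7,8],K1),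
    ([1,2,7,8,3,4,5,6],K2), ([1,2,7,3,4,5,6,8],K1), ([1,2,8,3,4,5,6,7],K1), ([1,3,4,5,6,7,8,2],K5),
    ([1,3,4,5,6,7,2,8],K4), ([1,3,4,5,6,8,2,7],K4), ([1,3,4,5,6,2,7,8],K3), ([1,3,4,5,7,8,2,6],K4),
    ([1,3,4,5,7,2,6,8],K3), ([1,3,4,5,8,2,6,7],K3), ([1,3,4,5,2,6,7,8],K2), ([1,3,4,6,7,8,2,5],K4),
    ([1,3,4,6,7,2,5,8],K3), ([1,3,4,6,8,2,5,7],K3), ([1,3,4,6,2,5,7,8],K2), ([1,3,4,7,8,2,5,6],K3),
    ([1,3,4,7,2,5,6,8],K2), ([1,3,4,8,2,5,6,7],K2), ([1,3,4,2,5,6,7,8],K1), ([1,3,5,6,7,8,2,4],K4),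
    ([1,3,5,6,7,2,4,8],K3), ([1,3,5,6,8,2,4,7],K3), ([1,3,5,6,2,4,7,8],K2), ([1,3,5,7,8,2,4,6],K3),
    ([1,3,5,7,2,4,6,8],K2), ([1,3,5,8,2,4,6,7],K2), ([1,3,5,2,4,6,7,8],K1), ([1,3,6,7,8,2,4,5],K3),
    ([1,3,6,7,2,4,5,8],K2), ([1,3,6,8,2,4,5,7],K2), ([1,3,6,2,4,5,7,8],K1), ([1,3,7,8,2,4,5,6],K2),
    ([1,3,7,2,4,5,6,8],K1), ([1,3,8,2,4,5,6,7],K1), ([1,4,5,6,7,8,2,3],K4), ([1,4,5,6,7,2,3,8],K3),
    ([1,4,5,6,8,2,3,7],K3), ([1,4,5,6,2,3,7,8],K2), ([1,4,5,7,8,2,3,6],K3), ([1,4,5,7,2,3,6,8],K2),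
    ([1,4,5,8,2,3,6,7],K2), ([1,4,5,2,3,6,7,8],K1), ([1,4,6,7,8,2,3,5],K3), ([1,4,6,7,2,3,5,8],K2),
    ([1,4,6,8,2,3,5,7],K2), ([1,4,6,2,3,5,7,8],K1), ([1,4,7,8,2,3,5,6],K2), ([1,4,7,2,3,5,6,8],K1),
    ([1,4,8,2,3,5,6,7],K1), ([1,5,6,7,8,2,3,4],K3), ([1,5,6,7,2,3,4,8],K2), ([1,5,6,8,2,3,4,7],K2),
    ([1,5,6,2,3,4,7,8],K1), ([1,5,7,8,2,3,4,6],K2), ([1,5,7,2,3,4,6,8],K1), ([1,5,8,2,3,4,6,7],K1),
    ([1,6,7,8,2,3,4,5],K2), ([1,6,7,2,3,4,5,8],K1), ([1,6,8,2,3,4,5,7],K1), ([1,7,8,2,3,4,5,6],K1),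
    ([2,3,4,5,6,7,8,1],K5), ([2,3,4,5,6,7,1,8],K4), ([2,3,4,5,6,8,1,7],K4), ([2,3,4,5,6,1,7,8],K3),
    ([2,3,4,5,7,8,1,6],K4), ([2,3,4,5,7,1,6,8],K3), ([2,3,4,5,8,1,6,7],K3), ([2,3,4,5,1,6,7,8],K2),
    ([2,3,4,6,7,8,1,5],K4), ([2,3,4,6,7,1,5,8],K3), ([2,3,4,6,8,1,5,7],K3), ([2,3,4,6,1,5,7,8],K2),
    ([2,3,4,7,8,1,5,6],K3), ([2,3,4,7,1,5,6,8],K2), ([2,3,4,8,1,5,6,7],K2), ([2,3,4,1,5,6,7,8],K1),
    ([2,3,5,6,7,8,1,4],K4), ([2,3,5,6,7,1,4,8],K3), ([2,3,5,6,8,1,4,7],K3), ([2,3,5,6,1,4,7,8],K2),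
    ([2,3,5,7,8,1,4,6],K3), ([2,3,5,7,1,4,6,8],K2), ([2,3,5,8,1,4,6,7],K2), ([2,3,5,1,4,6,7,8],K1),
    ([2,3,6,7,8,1,4,5],K3), ([2,3,6,7,1,4,5,8],K2), ([2,3,6,8,1,4,5,7],K2), ([2,3,6,1,4,5,7,8],K1),
    ([2,3,7,8,1,4,5,6],K2), ([2,3,7,1,4,5,6,8],K1), ([2,3,8,1,4,5,6,7],K1), ([2,4,5,6,7,8,1,3],K4),
    ([2,4,5,6,7,1,3,8],K3), ([2,4,5,6,8,1,3,7],K3), ([2,4,5,6,1,3,7,8],K2), ([2,4,5,7,8,1,3,6],K3),
    ([2,4,5,7,1,3,6,8],K2), ([2,4,5,8,1,3,6,7],K2), ([2,4,5,1,3,6,7,8],K1), ([2,4,6,7,8,1,3,5],K3),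
    ([2,4,6,7,1,3,5,8],K2), ([2,4,6,8,1,3,5,7],K2), ([2,4,6,1,3,5,7,8],K1), ([2,4,7,8,1,3,5,6],K2),
    ([2,4,7,1,3,5,6,8],K1), ([2,4,8,1,3,5,6,7],K1), ([2,5,6,7,8,1,3,4],K3), ([2,5,6,7,1,3,4,8],K2),
    ([2,5,6,8,1,3,4,7],K2), ([2,5,6,1,3,4,7,8],K1), ([2,5,7,8,1,3,4,6],K2), ([2,5,7,1,3,4,6,8],K1),
    ([2,5,8,1,3,4,6,7],K1), ([2,6,7,8,1,3,4,5],K2), ([2,6,7,1,3,4,5,8],K1), ([2,6,8,1,3,4,5,7],K1),
    ([2,7,8,1,3,4,5,6],K1), ([3,4,5,6,7,8,1,2],K4), ([3,4,5,6,7,1,2,8],K3), ([3,4,5,6,8,1,2,7],K3),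
    ([3,4,5,6,1,2,7,8],K2), ([3,4,5,7,8,1,2,6],K3), ([3,4,5,7,1,2,6,8],K2), ([3,4,5,8,1,2,6,7],K2),
    ([3,4,5,1,2,6,7,8],K1), ([3,4,6,7,8,1,2,5],K3), ([3,4,6,7,1,2,5,8],K2), ([3,4,6,8,1,2,5,7],K2),
    ([3,4,6,1,2,5,7,8],K1), ([3,4,7,8,1,2,5,6],K2), ([3,4,7,1,2,5,6,8],K1), ([3,4,8,1,2,5,6,7],K1),
    ([3,5,6,7,8,1,2,4],K3), ([3,5,6,7,1,2,4,8],K2), ([3,5,6,8,1,2,4,7],K2), ([3,5,6,1,2,4,7,8],K1),
    ([3,5,7,8,1,2,4,6],K2), ([3,5,7,1,2,4,6,8],K1), ([3,5,8,1,2,4,6,7],K1), ([3,6,7,8,1,2,4,5],K2),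
    ([3,6,7,1,2,4,5,8],K1), ([3,6,8,1,2,4,5,7],K1), ([3,7,8,1,2,4,5,6],K1), ([4,5,6,7,8,1,2,3],K3),
    ([4,5,6,7,1,2,3,8],K2), ([4,5,6,8,1,2,3,7],K2), ([4,5,6,1,2,3,7,8],K1), ([4,5,7,8,1,2,3,6],K2),
    ([4,5,7,1,2,3,6,8],K1), ([4,5,8,1,2,3,6,7],K1), ([4,6,7,8,1,2,3,5],K2), ([4,6,7,1,2,3,5,8],K1),
    ([4,6,8,1,2,3,5,7],K1), ([4,7,8,1,2,3,5,6],K1), ([5,6,7,8,1,2,3,4],K2), ([5,6,7,1,2,3,4,8],K1),
    ([5,6,8,1,2,3,4,7],K1), ([5,7,8,1,2,3,4,6],K1), ([6,7,8,1,2,3,4,5],K1), ([1,2,3,4,5,6,7,8],K9),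
    ([1,2,3,4,5,6,7,8],K8), ([1,2,3,4,5,6,8,7],K8), ([1,2,3,4,5,6,7,8],K7), ([1,2,3,4,5,7,8,6],K8),
    ([1,2,3,4,5,7,6,8],K7), ([1,2,3,4,5,8,6,7],K7), ([1,2,3,4,6,7,8,5],K8), ([1,2,3,4,6,7,5,8],K7),
    ([1,2,3,4,6,8,5,7],K7), ([1,2,3,4,7,8,5,6],K7), ([1,2,3,5,6,7,8,4],K8), ([1,2,3,5,6,7,4,8],K7),
    ([1,2,3,5,6,8,4,7],K7), ([1,2,3,5,7,8,4,6],K7), ([1,2,3,6,7,8,4,5],K7), ([1,2,4,5,6,7,8,3],K8),
    ([1,2,4,5,6,7,3,8],K7), ([1,2,4,5,6,8,3,7],K7), ([1,2,4,5,7,8,3,6],K7), ([1,2,4,6,7,8,3,5],K7),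
    ([1,2,5,6,7,8,3,4],K7), ([1,3,4,5,6,7,8,2],K8), ([1,3,4,5,6,7,2,8],K7), ([1,3,4,5,6,8,2,7],K7),
    ([1,3,4,5,7,8,2,6],K7), ([1,3,4,6,7,8,2,5],K7), ([1,3,5,6,7,8,2,4],K7), ([1,4,5,6,7,8,2,3],K7),
    ([2,3,4,5,6,7,8,1],K8), ([2,3,4,5,6,7,1,8],K7), ([2,3,4,5,6,8,1,7],K7), ([2,3,4,5,7,8,1,6],K7),
    ([2,3,4,6,7,8,1,5],K7), ([2,3,5,6,7,8,1,4],K7), ([2,4,5,6,7,8,1,3],K7), ([3,4,5,6,7,8,1,2],K7)]"
  "extends K1 [
    ([1,2,3,4,5,6,7,8],K10), ([1,2,3,4,6,5,7,8],K10), ([1,2,3,4,7,5,6,8],K10), ([1,2,3,4,8,5,6,7],K10),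
    ([1,2,3,5,6,4,7,8],K10), ([1,2,3,5,7,4,6,8],K10), ([1,2,3,5,8,4,6,7],K10), ([1,2,3,6,7,4,5,8],K10),
    ([1,2,3,6,8,4,5,7],K10), ([1,2,3,7,8,4,5,6],K10), ([2,1,3,4,5,6,7,8],K10), ([2,1,3,4,6,5,7,8],K10),
    ([2,1,3,4,7,5,6,8],K10), ([2,1,3,4,8,5,6,7],K10), ([2,1,3,5,6,4,7,8],K10), ([2,1,3,5,7,4,6,8],K10),
    ([2,1,3,5,8,4,6,7],K10), ([2,1,3,6,7,4,5,8],K10), ([2,1,3,6,8,4,5,7],K10), ([2,1,3,7,8,4,5,6],K10),
    ([3,1,2,4,5,6,7,8],K10), ([3,1,2,4,6,5,7,8],K10), ([3,1,2,4,7,5,6,8],K10), ([3,1,2,4,8,5,6,7],K10),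
    ([3,1,2,5,6,4,7,8],K10), ([3,1,2,5,7,4,6,8],K10), ([3,1,2,5,8,4,6,7],K10), ([3,1,2,6,7,4,5,8],K10),
    ([3,1,2,6,8,4,5,7],K10), ([3,1,2,7,8,4,5,6],K10), ([1,2,3,4,5,6,7,8],K11), ([1,2,3,4,5,7,6,8],K11),
    ([1,2,3,4,5,8,6,7],K11), ([1,2,3,4,6,7,5,8],K11), ([1,2,3,4,6,8,5,7],K11), ([1,2,3,4,7,8,5,6],K11),
    ([1,2,3,5,6,7,4,8],K11), ([1,2,3,5,6,8,4,7],K11), ([1,2,3,5,7,8,4,6],K11), ([1,2,3,6,7,8,4,5],K11),
    ([1,2,3,4,5,6,7,8],K14), ([1,2,3,4,5,6,7,8],K12), ([1,2,3,4,5,6,8,7],K12), ([1,2,3,4,5,7,8,6],K12),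
    ([1,2,3,4,6,7,8,5],K12), ([1,2,3,5,6,7,8,4],K12), ([1,3,2,4,5,6,7,8],K14), ([1,3,2,4,5,6,7,8],K12),
    ([1,3,2,4,5,6,8,7],K12), ([1,3,2,4,5,7,8,6],K12), ([1,3,2,4,6,7,8,5],K12), ([1,3,2,5,6,7,8,4],K12),
    ([1,2,3,4,5,6,7,8],K13), ([2,3,1,4,5,6,7,8],K14), ([2,3,1,4,5,6,7,8],K12), ([2,3,1,4,5,6,8,7],K12),
    ([2,3,1,4,5,7,8,6],K12), ([2,3,1,4,6,7,8,5],K12), ([2,3,1,5,6,7,8,4],K12), ([2,1,3,4,5,6,7,8],K13),
    ([3,1,2,4,5,6,7,8],K13)]"
  "extends K2 [
    ([1,2,3,4,5,6,7,8],K17), ([1,2,3,4,5,6,8,7],K17), ([1,2,3,4,5,6,7,8],K15), ([1,2,3,4,5,7,8,6],K17),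
    ([1,2,3,4,5,7,6,8],K15), ([1,2,3,4,5,8,6,7],K15), ([1,2,3,4,6,7,8,5],K17), ([1,2,3,4,6,7,5,8],K15),
    ([1,2,3,4,6,8,5,7],K15), ([1,2,3,4,7,8,5,6],K15), ([2,1,3,4,5,6,7,8],K17), ([2,1,3,4,5,6,8,7],K17),
    ([2,1,3,4,5,6,7,8],K15), ([2,1,3,4,5,7,8,6],K17), ([2,1,3,4,5,7,6,8],K15), ([2,1,3,4,5,8,6,7],K15),
    ([2,1,3,4,6,7,8,5],K17), ([2,1,3,4,6,7,5,8],K15), ([2,1,3,4,6,8,5,7],K15), ([2,1,3,4,7,8,5,6],K15),
    ([3,1,2,4,5,6,7,8],K17), ([3,1,2,4,5,6,8,7],K17), ([3,1,2,4,5,6,7,8],K15), ([3,1,2,4,5,7,8,6],K17),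
    ([3,1,2,4,5,7,6,8],K15), ([3,1,2,4,5,8,6,7],K15), ([3,1,2,4,6,7,8,5],K17), ([3,1,2,4,6,7,5,8],K15),
    ([3,1,2,4,6,8,5,7],K15), ([3,1,2,4,7,8,5,6],K15), ([4,1,2,3,5,6,7,8],K17), ([4,1,2,3,5,6,8,7],K17),
    ([4,1,2,3,5,6,7,8],K15), ([4,1,2,3,5,7,8,6],K17), ([4,1,2,3,5,7,6,8],K15), ([4,1,2,3,5,8,6,7],K15),
    ([4,1,2,3,6,7,8,5],K17), ([4,1,2,3,6,7,5,8],K15), ([4,1,2,3,6,8,5,7],K15), ([4,1,2,3,7,8,5,6],K15),
    ([1,2,3,4,5,6,7,8],K18), ([1,2,3,4,5,6,7,8],K16), ([1,2,3,4,5,6,8,7],K16), ([1,2,3,4,5,7,8,6],K16),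
    ([1,2,3,4,6,7,8,5],K16), ([1,2,3,4,5,6,7,8],K19), ([1,3,2,4,5,6,7,8],K19), ([1,4,2,3,5,6,7,8],K19),
    ([2,3,1,4,5,6,7,8],K19), ([2,4,1,3,5,6,7,8],K19), ([3,4,1,2,5,6,7,8],K19)]"
  "extends K3 [
    ([1,2,3,4,5,6,7,8],K22), ([1,2,3,4,5,6,7,8],K20), ([1,2,3,4,5,6,8,7],K20), ([1,2,3,4,5,7,8,6],K20),
    ([2,1,3,4,5,6,7,8],K22), ([2,1,3,4,5,6,7,8],K20), ([2,1,3,4,5,6,8,7],K20), ([2,1,3,4,5,7,8,6],K20),
    ([3,1,2,4,5,6,7,8],K22), ([3,1,2,4,5,6,7,8],K20), ([3,1,2,4,5,6,8,7],K20), ([3,1,2,4,5,7,8,6],K20),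
    ([4,1,2,3,5,6,7,8],K22), ([4,1,2,3,5,6,7,8],K20), ([4,1,2,3,5,6,8,7],K20), ([4,1,2,3,5,7,8,6],K20),
    ([5,1,2,3,4,6,7,8],K22), ([5,1,2,3,4,6,7,8],K20), ([5,1,2,3,4,6,8,7],K20), ([5,1,2,3,4,7,8,6],K20),
    ([1,2,3,4,5,6,7,8],K21)]"
  "extends K4 [
    ([1,2,3,4,5,6,7,8],K23), ([2,1,3,4,5,6,7,8],K23), ([3,1,2,4,5,6,7,8],K23), ([4,1,2,3,5,6,7,8],K23),
    ([5,1,2,3,4,6,7,8],K23), ([6,1,2,3,4,5,7,8],K23)]"
  "extends K5 []"
  "extends K6 []"
  "extends K7 [
    ([1,2,3,4,5,6,7,8],K24), ([1,2,3,5,4,6,7,8],K24), ([1,2,3,6,4,5,7,8],K24), ([1,2,4,5,3,6,7,8],K24),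
    ([1,2,4,6,3,5,7,8],K24), ([1,2,5,6,3,4,7,8],K24), ([1,3,4,5,2,6,7,8],K24), ([1,3,4,6,2,5,7,8],K24),
    ([1,3,5,6,2,4,7,8],K24), ([1,4,5,6,2,3,7,8],K24), ([2,3,4,5,1,6,7,8],K24), ([2,3,4,6,1,5,7,8],K24),
    ([2,3,5,6,1,4,7,8],K24), ([2,4,5,6,1,3,7,8],K24), ([3,4,5,6,1,2,7,8],K24)]"
  "extends K8 []"
  "extends K9 []"
  "extends K10 [
    ([1,2,3,4,5,6,7,8],K26), ([1,2,3,4,5,6,8,7],K26), ([1,2,3,4,5,7,8,6],K26), ([1,2,3,4,5,6,7,8],K25),
    ([1,2,3,4,5,7,6,8],K25), ([1,2,3,4,5,8,6,7],K25), ([1,2,3,5,4,6,7,8],K25), ([1,2,3,5,4,7,6,8],K25),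
    ([1,2,3,5,4,8,6,7],K25), ([1,2,3,4,5,6,7,8],K27), ([1,2,3,4,5,6,8,7],K27), ([1,2,3,4,5,7,8,6],K27),
    ([1,3,2,4,5,6,7,8],K25), ([1,3,2,4,5,7,6,8],K25), ([1,3,2,4,5,8,6,7],K25), ([1,3,2,5,4,6,7,8],K25),
    ([1,3,2,5,4,7,6,8],K25), ([1,3,2,5,4,8,6,7],K25), ([1,3,2,4,5,6,7,8],K27), ([1,3,2,4,5,6,8,7],K27),
    ([1,3,2,4,5,7,8,6],K27), ([1,4,5,2,3,6,7,8],K27), ([1,4,5,2,3,6,8,7],K27), ([1,4,5,2,3,7,8,6],K27),
    ([1,5,4,2,3,6,7,8],K27), ([1,5,4,2,3,6,8,7],K27), ([1,5,4,2,3,7,8,6],K27), ([1,2,3,4,5,6,7,8],K28),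
    ([1,2,3,4,5,6,7,8],K30), ([1,2,3,5,4,6,7,8],K30), ([1,3,2,4,5,6,7,8],K30), ([1,3,2,5,4,6,7,8],K30),
    ([1,2,3,4,5,6,7,8],K32), ([1,2,3,4,5,6,7,8],K29), ([1,2,3,4,5,6,8,7],K29), ([1,2,3,4,5,7,8,6],K29),
    ([1,2,3,4,5,6,7,8],K31), ([1,2,3,5,4,6,7,8],K31), ([1,4,5,2,3,6,7,8],K31), ([1,4,5,3,2,6,7,8],K31)]"
  "extends K11 [
    ([1,4,7,2,3,5,6,8],K27), ([1,4,8,2,3,5,6,7],K27), ([1,5,7,2,3,4,6,8],K27), ([1,5,8,2,3,4,6,7],K27),
    ([1,6,7,2,3,4,5,8],K27), ([1,6,8,2,3,4,5,7],K27), ([1,2,3,7,8,4,5,6],K28), ([2,4,7,1,3,5,6,8],K27),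
    ([2,4,8,1,3,5,6,7],K27), ([2,5,7,1,3,4,6,8],K27), ([2,5,8,1,3,4,6,7],K27), ([2,6,7,1,3,4,5,8],K27),
    ([2,6,8,1,3,4,5,7],K27), ([2,1,3,7,8,4,5,6],K28), ([3,4,7,1,2,5,6,8],K27), ([3,4,8,1,2,5,6,7],K27),
    ([3,5,7,1,2,4,6,8],K27), ([3,5,8,1,2,4,6,7],K27), ([3,6,7,1,2,4,5,8],K27), ([3,6,8,1,2,4,5,7],K27),
    ([3,1,2,7,8,4,5,6],K28), ([4,5,6,7,8,1,2,3],K28), ([5,4,6,7,8,1,2,3],K28), ([6,4,5,7,8,1,2,3],K28),
    ([1,2,3,4,5,6,7,8],K33), ([1,2,3,4,6,5,7,8],K33), ([1,2,3,5,6,4,7,8],K33), ([1,3,2,4,5,6,7,8],K33),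
    ([1,3,2,4,6,5,7,8],K33), ([1,3,2,5,6,4,7,8],K33), ([2,3,1,4,5,6,7,8],K33), ([2,3,1,4,6,5,7,8],K33),
    ([2,3,1,5,6,4,7,8],K33)]"
  "extends K12 [
    ([1,2,3,4,5,6,7,8],K34), ([1,2,3,4,5,7,6,8],K34), ([1,2,3,4,6,7,5,8],K34), ([1,2,3,5,6,7,4,8],K34),
    ([2,1,3,4,5,6,7,8],K34), ([2,1,3,4,5,7,6,8],K34), ([2,1,3,4,6,7,5,8],K34), ([2,1,3,5,6,7,4,8],K34),
    ([1,2,3,4,5,6,7,8],K35)]"
  "extends K13 [
    ([2,3,1,4,5,6,7,8],K35), ([2,3,1,4,5,6,8,7],K35), ([2,3,1,4,5,7,8,6],K35), ([2,3,1,4,6,7,8,5],K35),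
    ([2,3,1,5,6,7,8,4],K35)]"
  "extends K14 []"
  "extends K15 [
    ([1,2,3,4,5,6,7,8],K37), ([1,2,3,4,5,6,7,8],K36), ([1,2,3,4,5,6,8,7],K36), ([1,2,3,4,6,5,7,8],K36),
    ([1,2,3,4,6,5,8,7],K36), ([1,2,3,4,5,6,7,8],K38), ([1,3,2,4,5,6,7,8],K36), ([1,3,2,4,5,6,8,7],K36),
    ([1,3,2,4,6,5,7,8],K36), ([1,3,2,4,6,5,8,7],K36), ([1,3,2,4,5,6,7,8],K38), ([1,4,2,3,5,6,7,8],K36),
    ([1,4,2,3,5,6,8,7],K36), ([1,4,2,3,6,5,7,8],K36), ([1,4,2,3,6,5,8,7],K36), ([1,4,2,3,5,6,7,8],K38),
    ([1,2,3,4,5,6,7,8],K39), ([1,2,3,4,6,5,7,8],K39), ([1,2,3,4,5,6,7,8],K40), ([1,2,4,3,5,6,7,8],K40),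
    ([1,3,4,2,5,6,7,8],K40)]"
  by code_simp+

lemma extends_2:
  "extends K16 [
    ([1,2,3,4,5,8,6,7],K39), ([1,2,3,4,6,8,5,7],K39), ([1,2,3,4,7,8,5,6],K39), ([2,1,3,4,5,8,6,7],K39),
    ([2,1,3,4,6,8,5,7],K39), ([2,1,3,4,7,8,5,6],K39), ([3,1,2,4,5,8,6,7],K39), ([3,1,2,4,6,8,5,7],K39),
    ([3,1,2,4,7,8,5,6],K39), ([4,1,2,3,5,8,6,7],K39), ([4,1,2,3,6,8,5,7],K39), ([4,1,2,3,7,8,5,6],K39)]"
  "extends K17 [
    ([1,2,3,4,5,6,7,8],K41), ([1,2,3,4,6,5,7,8],K41), ([1,2,3,4,7,5,6,8],K41), ([1,3,2,4,5,6,7,8],K41),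
    ([1,3,2,4,6,5,7,8],K41), ([1,3,2,4,7,5,6,8],K41), ([1,4,2,3,5,6,7,8],K41), ([1,4,2,3,6,5,7,8],K41),
    ([1,4,2,3,7,5,6,8],K41)]"
  "extends K18 []"
  "extends K19 [
    ([1,2,3,4,5,6,7,8],K42)]"
  "extends K20 [
    ([1,2,3,4,5,6,7,8],K43), ([1,2,3,4,5,7,6,8],K43), ([1,3,2,4,5,6,7,8],K43), ([1,3,2,4,5,7,6,8],K43),
    ([1,4,2,3,5,6,7,8],K43), ([1,4,2,3,5,7,6,8],K43), ([1,5,2,3,4,6,7,8],K43), ([1,5,2,3,4,7,6,8],K43)]"
  "extends K21 []"
  "extends K22 []"
  "extends K23 []"
  "extends K24 [
    ([1,2,3,4,5,6,7,8],K44), ([1,3,2,4,5,6,7,8],K44), ([1,4,2,3,5,6,7,8],K44), ([2,3,1,4,5,6,7,8],K44),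
    ([2,4,1,3,5,6,7,8],K44), ([3,4,1,2,5,6,7,8],K44)]"
  "extends K25 [
    ([2,4,6,1,3,5,7,8],K46), ([2,4,6,1,3,5,8,7],K46), ([1,2,3,4,5,6,7,8],K48), ([1,4,5,2,3,6,7,8],K46),
    ([1,4,5,2,3,6,8,7],K46), ([2,1,3,4,6,5,7,8],K48), ([1,2,3,4,5,6,7,8],K46), ([1,2,3,4,5,6,8,7],K46),
    ([1,2,3,4,5,6,7,8],K45), ([1,2,3,4,5,6,7,8],K47), ([1,2,3,4,5,6,8,7],K47), ([2,1,3,4,6,5,7,8],K47),
    ([2,1,3,4,6,5,8,7],K47), ([1,2,3,4,5,6,7,8],K49), ([4,1,5,2,6,3,7,8],K48), ([4,1,5,2,6,3,7,8],K47),
    ([4,1,5,2,6,3,8,7],K47), ([1,4,5,2,3,6,7,8],K49), ([2,4,6,1,3,5,7,8],K49), ([4,1,5,2,6,3,7,8],K50),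
    ([2,1,3,4,6,5,7,8],K50), ([1,2,3,4,5,6,7,8],K51), ([1,2,3,4,5,6,7,8],K50), ([2,1,3,4,6,5,7,8],K51),
    ([4,1,5,2,6,3,7,8],K51)]"
  "extends K26 [
    ([2,4,6,1,3,5,7,8],K46), ([2,4,7,1,3,5,6,8],K46), ([1,2,3,4,5,8,6,7],K48), ([2,5,6,1,3,4,7,8],K46),
    ([2,5,7,1,3,4,6,8],K46), ([1,2,3,5,4,8,6,7],K48), ([1,2,3,6,7,8,4,5],K48), ([1,2,3,7,6,8,4,5],K48),
    ([3,4,6,1,2,5,7,8],K46), ([3,4,7,1,2,5,6,8],K46), ([1,3,2,4,5,8,6,7],K48), ([3,5,6,1,2,4,7,8],K46),
    ([3,5,7,1,2,4,6,8],K46), ([1,3,2,5,4,8,6,7],K48), ([1,3,2,6,7,8,4,5],K48), ([1,3,2,7,6,8,4,5],K48),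
    ([1,4,5,6,7,8,2,3],K48), ([1,4,5,7,6,8,2,3],K48), ([1,5,4,6,7,8,2,3],K48), ([1,5,4,7,6,8,2,3],K48),
    ([1,2,3,4,5,6,7,8],K54), ([1,2,3,4,5,6,7,8],K52), ([1,2,3,4,5,6,7,8],K53), ([1,2,3,4,5,7,6,8],K53),
    ([1,2,3,6,7,4,5,8],K53), ([1,2,3,6,7,5,4,8],K53), ([1,4,5,6,7,2,3,8],K53), ([1,4,5,6,7,3,2,8],K53)]"
  "extends K27 [
    ([1,2,3,6,8,7,4,5],K48), ([1,2,3,7,8,6,4,5],K48), ([2,1,3,4,8,5,6,7],K48), ([2,1,3,5,8,4,6,7],K48),
    ([3,1,2,4,6,5,7,8],K47), ([3,1,2,4,7,5,6,8],K47), ([1,3,2,4,5,8,6,7],K49), ([3,1,2,5,6,4,7,8],K47),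
    ([3,1,2,5,7,4,6,8],K47), ([1,3,2,5,4,8,6,7],K49), ([2,3,1,6,7,8,4,5],K49), ([2,3,1,7,6,8,4,5],K49),
    ([1,2,3,4,5,6,7,8],K55), ([1,2,3,4,5,7,6,8],K55), ([1,2,3,5,4,6,7,8],K55), ([1,2,3,5,4,7,6,8],K55),
    ([2,1,3,6,7,4,5,8],K56), ([2,1,3,6,7,5,4,8],K56), ([1,2,3,4,5,6,7,8],K56), ([1,2,3,4,5,7,6,8],K56),
    ([1,2,3,4,5,6,7,8],K57)]"
  "extends K28 [
    ([2,4,6,1,3,5,7,8],K49), ([2,4,7,1,3,5,6,8],K49), ([2,4,8,1,3,5,6,7],K49), ([2,5,6,1,3,4,7,8],K49),
    ([2,5,7,1,3,4,6,8],K49), ([2,5,8,1,3,4,6,7],K49), ([3,4,6,1,2,5,7,8],K49), ([3,4,7,1,2,5,6,8],K49),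
    ([3,4,8,1,2,5,6,7],K49), ([3,5,6,1,2,4,7,8],K49), ([3,5,7,1,2,4,6,8],K49), ([3,5,8,1,2,4,6,7],K49),
    ([1,2,3,4,5,6,7,8],K58), ([1,2,3,4,5,6,8,7],K58), ([1,2,3,4,5,7,8,6],K58)]"
  "extends K29 [
    ([1,2,3,4,5,6,7,8],K59), ([1,2,3,5,4,6,7,8],K59), ([1,3,2,4,5,6,7,8],K59), ([1,3,2,5,4,6,7,8],K59)]"
  "extends K30 [
    ([1,2,3,4,5,6,7,8],K60), ([1,2,3,4,5,6,7,8],K59), ([1,2,3,4,5,6,8,7],K59), ([1,2,3,4,5,7,8,6],K59),
    ([1,2,3,4,5,6,7,8],K61), ([1,4,5,2,3,6,7,8],K61)]"
  "extends K31 [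
    ([1,2,3,5,4,6,7,8],K61), ([1,3,2,5,4,6,7,8],K61)]"
  by code_simp+

lemma extends_3:
  "extends K32 []"
  "extends K33 [
    ([1,2,3,4,5,6,7,8],K62), ([1,2,3,5,4,6,7,8],K62), ([2,1,3,4,5,6,7,8],K62), ([2,1,3,5,4,6,7,8],K62)]"
  "extends K34 [
    ([1,2,3,4,5,6,7,8],K63), ([1,2,3,4,6,5,7,8],K63), ([1,2,3,5,6,4,7,8],K63)]"
  "extends K35 []"
  "extends K36 [
    ([2,1,3,4,5,7,6,8],K66), ([1,2,3,4,5,6,7,8],K66), ([1,2,3,4,5,6,7,8],K65), ([1,2,3,4,5,6,7,8],K64),
    ([1,2,3,4,5,6,7,8],K67), ([2,1,3,4,5,7,6,8],K67), ([1,2,4,3,5,6,7,8],K65), ([1,2,4,3,5,6,7,8],K64),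
    ([1,2,4,3,5,6,7,8],K67), ([2,1,4,3,5,7,6,8],K67), ([1,2,3,4,5,6,7,8],K68), ([1,2,3,4,5,6,7,8],K69)]"
  "extends K37 [
    ([2,1,3,4,5,7,6,8],K66), ([2,1,3,4,5,8,6,7],K66), ([2,1,3,4,6,7,5,8],K66), ([2,1,3,4,6,8,5,7],K66),
    ([3,1,2,4,5,7,6,8],K66), ([3,1,2,4,5,8,6,7],K66), ([3,1,2,4,6,7,5,8],K66), ([3,1,2,4,6,8,5,7],K66),
    ([4,1,2,3,5,7,6,8],K66), ([4,1,2,3,5,8,6,7],K66), ([4,1,2,3,6,7,5,8],K66), ([4,1,2,3,6,8,5,7],K66),
    ([1,2,3,4,5,6,7,8],K70), ([1,2,4,3,5,6,7,8],K70), ([1,3,4,2,5,6,7,8],K70)]"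
  "extends K38 [
    ([3,1,2,4,5,7,6,8],K67), ([3,1,2,4,5,8,6,7],K67), ([3,1,2,4,6,7,5,8],K67), ([3,1,2,4,6,8,5,7],K67),
    ([4,1,2,3,5,7,6,8],K67), ([4,1,2,3,5,8,6,7],K67), ([4,1,2,3,6,7,5,8],K67), ([4,1,2,3,6,8,5,7],K67),
    ([1,2,3,4,5,6,7,8],K71)]"
  "extends K39 [
    ([1,2,3,4,6,5,7,8],K68), ([1,2,3,4,6,5,8,7],K68), ([1,3,2,4,6,5,7,8],K68), ([1,3,2,4,6,5,8,7],K68),
    ([1,4,2,3,6,5,7,8],K68), ([1,4,2,3,6,5,8,7],K68)]"
  "extends K40 []"
  "extends K41 [
    ([1,2,3,4,5,6,7,8],K72), ([1,2,3,4,5,7,6,8],K72), ([1,2,4,3,5,6,7,8],K72), ([1,2,4,3,5,7,6,8],K72)]"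
  "extends K42 []"
  "extends K43 [
    ([1,2,3,4,5,6,7,8],K73), ([1,2,4,3,5,6,7,8],K73), ([1,2,5,3,4,6,7,8],K73)]"
  "extends K44 [
    ([1,2,3,4,5,6,7,8],K74)]"
  "extends K45 [
    ([2,3,1,6,4,5,7,8],K75), ([2,3,1,6,4,5,8,7],K75), ([1,2,3,4,5,6,7,8],K76), ([1,3,2,5,4,6,7,8],K75),
    ([1,3,2,5,4,6,8,7],K75), ([2,1,3,4,6,5,7,8],K76), ([1,2,3,4,5,6,7,8],K75), ([1,2,3,4,5,6,8,7],K75),
    ([3,1,2,5,6,4,7,8],K76), ([4,1,5,2,6,3,7,8],K76), ([5,1,4,3,6,2,7,8],K76), ([6,2,4,3,5,1,7,8],K76),
    ([3,1,2,5,6,4,7,8],K77), ([2,1,3,4,6,5,7,8],K77), ([1,2,3,4,5,6,7,8],K77)]"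
  "extends K46 [
    ([2,3,1,4,6,7,5,8],K75), ([2,1,3,4,6,5,7,8],K79), ([3,1,2,4,7,5,6,8],K79), ([1,3,2,4,5,7,6,8],K75),
    ([1,2,3,4,5,6,7,8],K79), ([3,2,1,4,7,6,5,8],K79), ([1,2,3,4,5,6,7,8],K75), ([1,3,2,4,5,7,6,8],K79),
    ([2,3,1,4,6,7,5,8],K79), ([1,2,3,4,5,6,7,8],K78), ([1,2,3,4,5,6,7,8],K80), ([1,3,2,4,5,7,6,8],K80),
    ([2,3,1,4,6,7,5,8],K80), ([1,2,3,4,5,6,7,8],K81), ([1,3,2,4,5,7,6,8],K81), ([2,3,1,4,6,7,5,8],K81)]"
  "extends K47 [
    ([2,4,6,1,3,5,7,8],K78), ([2,4,6,1,3,5,8,7],K80), ([3,5,7,1,2,4,8,6],K80), ([1,2,3,5,4,8,7,6],K79),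
    ([1,3,2,5,4,7,6,8],K82), ([1,3,2,4,5,8,6,7],K79), ([1,2,3,4,5,6,7,8],K82), ([1,5,4,3,2,7,6,8],K82),
    ([1,4,5,2,3,6,7,8],K82), ([1,2,3,4,5,6,7,8],K83), ([1,3,2,5,4,7,6,8],K84), ([1,2,3,4,5,6,7,8],K84)]"
  by code_simp+

lemma extends_4:
  "extends K48 [
    ([5,1,4,2,7,3,6,8],K79), ([5,1,4,2,8,3,6,7],K79), ([3,1,2,4,7,5,6,8],K79), ([3,1,2,4,8,5,6,7],K79),
    ([1,2,3,4,5,6,7,8],K76), ([3,5,7,1,2,4,8,6],K80), ([3,5,8,1,2,4,7,6],K80), ([2,3,1,6,4,7,5,8],K82),
    ([2,3,1,6,4,8,5,7],K82), ([4,5,1,6,2,7,3,8],K82), ([4,5,1,6,2,8,3,7],K82), ([1,2,3,4,5,6,7,8],K85),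
    ([1,2,3,4,5,6,7,8],K86), ([1,4,5,2,3,6,7,8],K86)]"
  "extends K49 [
    ([2,6,4,1,3,7,5,8],K80), ([2,6,4,1,3,8,5,7],K80), ([1,5,4,2,3,7,6,8],K80), ([1,5,4,2,3,8,6,7],K80),
    ([3,1,2,5,6,4,7,8],K76), ([4,1,5,2,6,3,7,8],K83), ([4,1,5,2,6,3,8,7],K83), ([1,2,3,4,5,6,7,8],K87)]"
  "extends K50 [
    ([1,4,5,2,3,6,7,8],K88), ([1,2,3,4,5,6,7,8],K88), ([1,2,3,4,5,6,7,8],K89)]"
  "extends K51 [
    ([1,2,3,4,5,6,7,8],K89)]"
  "extends K52 []"
  "extends K53 []"
  "extends K54 []"
  "extends K55 [
    ([7,8,1,6,2,4,3,5],K82), ([5,8,2,4,1,6,3,7],K82), ([3,7,4,2,1,6,5,8],K82), ([3,5,6,1,2,4,7,8],K82),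
    ([3,1,2,5,7,4,6,8],K83), ([5,1,4,3,8,2,6,7],K83), ([7,2,6,3,8,1,4,5],K83), ([8,4,6,5,7,1,2,3],K83),
    ([2,1,3,6,7,4,5,8],K90), ([1,2,3,4,5,6,7,8],K90)]"
  "extends K56 [
    ([1,2,3,4,5,6,7,8],K91), ([1,2,3,5,4,6,7,8],K91)]"
  "extends K57 []"
  "extends K58 []"
  "extends K59 [
    ([1,2,3,4,5,6,7,8],K92)]"
  "extends K60 [
    ([1,2,3,4,5,6,7,8],K92), ([1,2,3,4,5,6,8,7],K92), ([1,2,3,4,5,7,8,6],K92)]"
  "extends K61 []"
  "extends K62 [
    ([1,2,3,4,5,6,7,8],K93)]"
  "extends K63 []"
  by code_simp+

lemma extends_5:
  "extends K64 [
    ([2,3,1,4,7,5,6,8],K94), ([1,3,2,4,6,5,7,8],K94), ([1,2,3,4,5,6,7,8],K94), ([1,2,3,4,5,6,7,8],K95),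
    ([1,3,2,4,6,5,7,8],K95), ([2,3,1,4,7,5,6,8],K95)]"
  "extends K65 [
    ([2,3,1,4,5,7,8,6],K94), ([1,3,2,4,5,6,8,7],K94), ([1,2,3,4,5,6,7,8],K94), ([1,2,4,3,5,6,7,8],K95),
    ([1,3,4,2,5,6,8,7],K95), ([2,3,4,1,5,7,8,6],K95), ([1,2,3,4,5,6,7,8],K96)]"
  "extends K66 [
    ([1,2,3,4,5,6,7,8],K97), ([1,3,2,4,5,6,8,7],K94), ([1,3,2,4,6,5,7,8],K94), ([1,2,3,4,5,6,7,8],K98),
    ([1,4,2,3,5,6,8,7],K94), ([1,4,2,3,6,5,7,8],K94), ([1,2,4,3,5,6,7,8],K98), ([1,2,3,4,5,6,7,8],K99)]"
  "extends K67 [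
    ([2,1,3,4,5,7,6,8],K98), ([1,4,3,2,5,6,8,7],K95), ([1,4,2,3,6,5,7,8],K95), ([1,2,3,4,5,6,7,8],K100)]"
  "extends K68 [
    ([1,2,3,4,5,6,7,8],K96), ([1,2,4,3,5,6,7,8],K96)]"
  "extends K69 []"
  "extends K70 []"
  "extends K71 []"
  "extends K72 [
    ([1,2,3,4,5,6,7,8],K101)]"
  "extends K73 []"
  "extends K74 []"
  "extends K75 [
    ([2,1,3,4,6,5,7,8],K102), ([2,1,3,4,6,5,7,8],K103), ([1,2,3,4,5,6,7,8],K104), ([1,2,3,4,5,6,7,8],K102),
    ([1,2,3,4,5,6,7,8],K103), ([2,1,3,4,6,5,7,8],K104), ([5,1,4,3,6,2,7,8],K104), ([6,2,4,3,5,1,7,8],K104),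
    ([1,2,3,4,5,6,7,8],K105)]"
  "extends K76 [
    ([1,3,2,5,4,6,7,8],K104), ([1,3,2,5,4,6,8,7],K104), ([1,2,3,4,5,6,7,8],K104), ([1,2,3,4,5,6,8,7],K104),
    ([1,2,3,4,5,6,7,8],K106)]"
  "extends K77 [
    ([1,3,2,5,4,6,7,8],K107), ([1,2,3,4,5,6,7,8],K107)]"
  "extends K78 [
    ([2,1,3,4,6,5,7,8],K108), ([3,1,2,4,7,5,6,8],K108), ([1,2,3,4,5,6,7,8],K108), ([3,2,1,4,7,6,5,8],K108),
    ([1,3,2,4,5,7,6,8],K108), ([2,3,1,4,6,7,5,8],K108)]"
  "extends K79 [
    ([2,3,1,4,6,7,5,8],K104), ([4,5,1,2,6,8,3,7],K104), ([3,4,7,1,2,5,8,6],K108), ([1,2,3,4,5,6,7,8],K103),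
    ([1,4,5,2,3,6,8,7],K108), ([1,2,3,4,5,6,7,8],K108), ([1,2,3,4,5,6,7,8],K109), ([1,2,3,4,5,6,7,8],K110)]"
  by code_simp+

lemma extends_6:
  "extends K80 [
    ([6,2,4,1,7,3,5,8],K104), ([3,1,2,4,7,5,6,8],K109), ([5,1,4,2,7,3,6,8],K104), ([3,2,1,4,7,6,5,8],K109)]"
  "extends K81 []"
  "extends K82 [
    ([2,6,4,1,3,7,5,8],K108), ([7,3,5,1,8,2,4,6],K109), ([1,5,4,2,3,8,6,7],K108), ([8,3,6,2,7,1,4,5],K109),
    ([1,2,3,4,5,6,7,8],K111), ([1,2,3,4,5,6,7,8],K112)]"
  "extends K83 [
    ([1,2,3,5,4,8,7,6],K109), ([1,3,2,4,5,8,6,7],K109)]"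
  "extends K84 [
    ([1,2,3,4,5,6,7,8],K113)]"
  "extends K85 []"
  "extends K86 []"
  "extends K87 []"
  "extends K88 [
    ([1,2,3,4,5,6,7,8],K114)]"
  "extends K89 []"
  "extends K90 [
    ([1,2,3,4,5,6,7,8],K115)]"
  "extends K91 []"
  "extends K92 []"
  "extends K93 []"
  "extends K94 [
    ([2,1,3,4,5,7,6,8],K116), ([1,2,3,4,5,6,7,8],K116), ([1,2,3,4,5,6,7,8],K117), ([2,1,3,4,5,7,6,8],K117)]"
  "extends K95 [
    ([2,3,1,4,7,5,6,8],K117), ([1,3,2,4,6,5,7,8],K117)]"
  by code_simp+

lemma extends_7:
  "extends K96 []"
  "extends K97 [
    ([3,1,2,4,5,8,6,7],K116), ([3,1,2,4,6,7,5,8],K116), ([4,1,2,3,5,8,6,7],K116), ([4,1,2,3,6,7,5,8],K116),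
    ([1,2,3,4,5,6,7,8],K118)]"
  "extends K98 [
    ([4,1,2,3,5,8,6,7],K117), ([4,1,2,3,6,7,5,8],K117)]"
  "extends K99 []"
  "extends K100 []"
  "extends K101 []"
  "extends K102 [
    ([1,2,3,4,5,6,7,8],K_fano), ([1,2,3,4,5,6,7,8],K120), ([1,2,3,5,4,7,6,8],K120), ([6,2,4,5,3,7,1,8],K120)]"
  "extends K103 [
    ([2,1,3,4,6,5,7,8],K120), ([3,1,2,5,6,4,8,7],K120), ([1,2,3,4,5,6,7,8],K121), ([6,2,4,3,5,1,7,8],K121)]"
  "extends K104 [
    ([1,2,3,5,4,7,6,8],K120), ([1,2,3,4,5,6,7,8],K121)]"
  "extends K105 []"
  "extends K106 []"
  "extends K107 [
    ([1,2,3,4,5,6,7,8],K_Q63)]"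
  "extends K108 [
    ([4,5,1,2,6,8,3,7],K121), ([3,1,2,4,7,5,6,8],K123), ([1,2,3,4,5,6,7,8],K123)]"
  "extends K109 [
    ([6,2,4,3,5,1,7,8],K121)]"
  "extends K110 []"
  "extends K111 [
    ([2,1,3,6,4,7,8,5],K123), ([1,2,3,5,4,8,7,6],K123), ([1,2,3,4,5,6,7,8],K124)]"
  by code_simp+

lemma extends_8:
  "extends K112 []"
  "extends K113 []"
  "extends K114 []"
  "extends K115 []"
  "extends K116 [
    ([1,2,3,4,5,6,7,8],K_fano_point), ([1,2,3,4,5,6,7,8],K126)]"
  "extends K117 [
    ([2,1,3,4,5,7,6,8],K126)]"
  "extends K118 []"
  "extends K_fano []"
  "extends K120 []"
  "extends K121 []"
  "extends K_Q63 []"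
  "extends K123 [
    ([1,2,3,5,4,8,7,6],K_Q41)]"
  "extends K124 []"
  "extends K_fano_point []"
  "extends K126 []"
  "extends K_Q41 []"
  by code_simp+

lemmas catalogue_members = catalogue_def[THEN equalityD2, unfolded insert_subset]

theorem extension_closed_catalogue: "extension_closed catalogue"
  unfolding extension_closed_def
proof (intro conjI ballI)
  show "[] \<in> catalogue"
    using catalogue_members by (simp add: K0_def)
  fix R assume "R \<in> catalogue"
  from this[unfolded catalogue_def] show "\<exists>cs. extends R cs \<and> snd ` set cs \<subseteq> catalogue"
    by (elim insertE emptyE)
      (hypsubst, rule exI, rule conjI, rule extends_1 extends_2 extends_3 extends_4 extends_5 extends_6 extends_7 extends_8,
       simp add: catalogue_members)+
qed

subsection \<open>Rational realizations\<close>

text \<open>Tests \<open>P\<close> on every sublist of length \<open>k\<close> while descending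
  through the list; \<open>acc\<close> holds the elements chosen so far in reverse order.\<close>

fun all_choose :: "nat \<Rightarrow> ('b list \<Rightarrow> bool) \<Rightarrow> 'b list \<Rightarrow> 'b list \<Rightarrow> bool" where
  "all_choose 0 P acc xs = P (rev acc)"
| "all_choose (Suc k) P acc [] = True"
| "all_choose (Suc k) P acc (x # xs) = (all_choose k P (x # acc) xs \<and> all_choose (Suc k) P acc xs)"

definition in_line :: "config \<Rightarrow> nat list \<Rightarrow> bool" where
  "in_line R js \<longleftrightarrow> list_ex (\<lambda>b. case b of Line L \<Rightarrow> list_all (List.member L) js | Conic _ \<Rightarrow> False) R"

definition in_conic :: "config \<Rightarrow> nat list \<Rightarrow> bool" where
  "in_conic R js \<longleftrightarrow> list_ex (\<lambda>b. case b of Line _ \<Rightarrow> False | Conic C \<Rightarrow> list_all (List.member C) js) R"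

fun has_line_triple :: "config \<Rightarrow> nat list \<Rightarrow> bool" where
  "has_line_triple [] js = False"
| "has_line_triple (Line L # R) js = (3 \<le> length (filter (List.member L) js) \<or> has_line_triple R js)"
| "has_line_triple (Conic _ # R) js = has_line_triple R js"

fun check_triple :: "config \<Rightarrow> (nat \<times> 'r::comm_ring_1 triple) list \<Rightarrow> bool" where
  "check_triple R [(i, u), (j, v), (k, w)] = (in_line R [i, j, k] \<longleftrightarrow> det3 u v w = 0)"
| "check_triple R _ = False"

text \<open>Whether three of the six points are collinear is read off from the lines of
  \<open>R\<close>. Together with \<open>check_triple\<close>, which confirms that these are the
  true collinearities, a single conic determinant settles each sextuple.\<close>

fun check_sextuple :: "config \<Rightarrow> (nat \<times> 'r::comm_ring_1 triple) list \<Rightarrow> bool" where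
  "check_sextuple R [(i, u), (j, v), (k, w), (i', p), (j', q), (k', r)] =
     (in_conic R [i, j, k, i', j', k'] \<longleftrightarrow>
       (if has_line_triple R [i, j, k, i', j', k'] then False else conic_det u v w p q r = 0))"
| "check_sextuple R _ = False"

fun check_pair :: "(nat \<times> 'r::comm_ring_1 triple) list \<Rightarrow> bool" where
  "check_pair [(i, u), (j, v)] = (cross u v \<noteq> (0, 0, 0))"
| "check_pair _ = False"

definition realized_by :: "config \<Rightarrow> 'r::comm_ring_1 triple list \<Rightarrow> bool" where
  "realized_by R ps \<longleftrightarrow> length ps = 8 \<and>
     all_choose 2 check_pair [] (zip [1..<9] ps) \<and> all_choose 3 (check_triple R) [] (zip [1..<9] ps) \<and>
     all_choose 6 (check_sextuple R) [] (zip [1..<9] ps)"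

section \<open>Collinear triples and coconic sextuples in terms of brackets\<close>

definition distinct_points :: "(nat \<Rightarrow> 'a::field triple) \<Rightarrow> bool" where
  "distinct_points p \<longleftrightarrow> (\<forall>i\<in>{1..8}. \<forall>j\<in>{1..8}. i \<noteq> j \<longrightarrow> cross (p i) (p j) \<noteq> (0, 0, 0))"

lemma cross_zero [simp]: "cross (0, 0, 0) v = (0, 0, 0)" "cross v (0, 0, 0) = (0, 0, 0)"
  by (cases v; simp)+

lemma distinct_points_ne_0:
  assumes "distinct_points p" "i \<in> {1..8}"
  shows "p i \<noteq> (0, 0, 0)"
proof
  assume z: "p i = (0, 0, 0)"
  obtain j where "j \<in> {1..8}" "j \<noteq> i"
    by (cases "i = 1") (auto intro: that[of 1] that[of 2])
  with assms z show False
    unfolding distinct_points_def by (metis cross_zero(1))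
qed

lemma distinct_points_inj:
  assumes "distinct_points p"
  shows "inj_on p {1..8}"
proof (rule inj_onI)
  have "cross t t = (0, 0, 0)" for t :: "'a triple"
    by (cases t) simp
  then show "i = j" if "i \<in> {1..8}" "j \<in> {1..8}" "p i = p j" for i j
    using assms that unfolding distinct_points_def by metis
qed

lemma distinct_points_iff:
  assumes "\<And>i. i \<in> {1..8} \<Longrightarrow> p i \<noteq> (0, 0, 0)"
  shows "inj_on (\<lambda>i. pt (p i)) {1..8} \<longleftrightarrow> distinct_points p"
  unfolding inj_on_def distinct_points_def
  by (intro ball_cong refl) (use pt_eq_iff[OF assms assms] in blast)

lemma collinear_triples_iff:
  assumes "distinct_points p" "{i, j, k} \<subseteq> {1..8}" "i \<noteq> j" "i \<noteq> k" "j \<noteq> k"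
  shows "{i, j, k} \<in> collinear_triples (\<lambda>i. pt (p i)) \<longleftrightarrow> det3 (p i) (p j) (p k) = 0"
  using collinear_iff_det3[of "p i" "p j" "p k"] distinct_points_ne_0[OF assms(1)] assms
  by (simp add: collinear_triples_def)

lemma coconic_sextuples_iff:
  assumes p: "distinct_points p" and J: "J = {i1, i2, i3, i4, i5, i6}" "J \<subseteq> {1..8}" "card J = 6"
  shows "J \<in> coconic_sextuples (\<lambda>i. pt (p i)) \<longleftrightarrow>
    (\<forall>x\<in>J. \<forall>y\<in>J. \<forall>z\<in>J. x \<noteq> y \<and> x \<noteq> z \<and> y \<noteq> z \<longrightarrow> det3 (p x) (p y) (p z) \<noteq> 0) \<and>
    conic_det (p i1) (p i2) (p i3) (p i4) (p i5) (p i6) = 0"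
proof -
  have inj: "inj_on p J"
    using distinct_points_inj[OF p] J(2) by (rule inj_on_subset)
  have "J \<in> coconic_sextuples (\<lambda>i. pt (p i)) \<longleftrightarrow> (\<exists>C\<in>conics. pt ` p ` J \<subseteq> C)"
    using J by (simp add: coconic_sextuples_def image_image)
  also have "\<dots> \<longleftrightarrow> (\<forall>x\<in>p ` J. \<forall>y\<in>p ` J. \<forall>z\<in>p ` J. x \<noteq> y \<and> x \<noteq> z \<and> y \<noteq> z \<longrightarrow> det3 x y z \<noteq> 0) \<and>
      conic_det (p i1) (p i2) (p i3) (p i4) (p i5) (p i6) = 0"
  proof (rule coconic_iff)
    show "p ` J = {p i1, p i2, p i3, p i4, p i5, p i6}" by (simp add: J(1))
    show "card (p ` J) = 6" using J(3) inj by (simp add: card_image)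
    show "t \<noteq> (0, 0, 0)" if "t \<in> p ` J" for t
      using that distinct_points_ne_0[OF p subsetD[OF J(2)]] by auto
    show "cross s t \<noteq> (0, 0, 0)" if "s \<in> p ` J" "t \<in> p ` J" "s \<noteq> t" for s t
    proof -
      obtain i j where "i \<in> J" "j \<in> J" "s = p i" "t = p j" using \<open>s \<in> p ` J\<close> \<open>t \<in> p ` J\<close> by auto
      then show ?thesis
        using p[unfolded distinct_points_def, rule_format, OF subsetD[OF J(2)] subsetD[OF J(2)], of i j] \<open>s \<noteq> t\<close>
        by auto
    qed
  qed
  also have "(\<forall>x\<in>p ` J. \<forall>y\<in>p ` J. \<forall>z\<in>p ` J. x \<noteq> y \<and> x \<noteq> z \<and> y \<noteq> z \<longrightarrow> det3 x y z \<noteq> 0) \<longleftrightarrow>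
      (\<forall>x\<in>J. \<forall>y\<in>J. \<forall>z\<in>J. x \<noteq> y \<and> x \<noteq> z \<and> y \<noteq> z \<longrightarrow> det3 (p x) (p y) (p z) \<noteq> 0)"
    unfolding ball_simps(9) using inj_on_eq_iff[OF inj] by (intro ball_cong refl) simp
  finally show ?thesis .
qed

lemma all_choose_iff:
  "all_choose k P acc xs \<longleftrightarrow> (\<forall>ys\<in>set (subseqs xs). length ys = k \<longrightarrow> P (rev acc @ ys))"
proof (induction k P acc xs rule: all_choose.induct)
  case (1 P acc xs)
  have "[] \<in> set (subseqs xs)" by (induction xs) (auto simp: Let_def)
  then show ?case by auto
next
  case (3 k P acc x xs)
  then show ?case by (auto simp: Let_def ball_Un)
qed simp

lemma subseqs_map: "subseqs (map f xs) = map (map f) (subseqs xs)"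
  by (induction xs) (simp_all add: Let_def)

text \<open>Each index set is tested in one order only. That is enough, because collinearity and
  lying on a conic are properties of the set of points.\<close>

lemma all_choose_zip:
  assumes "length ps = 8" "all_choose k P [] (zip [1..<9] ps)" "I \<subseteq> {1..8}" "card I = k"
  shows "\<exists>js. set js = I \<and> distinct js \<and> length js = k \<and> P (map (\<lambda>i. (i, ps ! (i - 1))) js)"
proof -
  have "I \<in> set ` set (subseqs [1..<9])"
    using assms(3) by (auto simp: subseqs_powset)
  then obtain js where js: "js \<in> set (subseqs [1..<9])" "set js = I" by blast
  then have dist: "distinct js"
    using subseqs_distinctD[OF js(1) distinct_upt] by simp
  then have len: "length js = k"
    using js assms(4) distinct_card by metis
  have "zip [1..<9] ps = map (\<lambda>i. (i, ps ! (i - 1))) [1..<9]"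
    using assms(1) by (intro nth_equalityI) auto
  then have "P (map (\<lambda>i. (i, ps ! (i - 1))) js)"
    using assms(2) js(1) len by (auto simp: all_choose_iff subseqs_map)
  with js dist len show ?thesis by blast
qed

fun map_triple :: "('a \<Rightarrow> 'b) \<Rightarrow> 'a triple \<Rightarrow> 'b triple" where
  "map_triple h (x, y, z) = (h x, h y, h z)"

text \<open>An injective ring homomorphism preserves both vanishing and nonvanishing of brackets, so
  a check in a ring with computable arithmetic decides the incidences over the field.\<close>

locale ring_embedding =
  fixes h :: "'r::comm_ring_1 \<Rightarrow> 'a::field"
    and ps :: "'r triple list"
  assumes h_add: "h (x + y) = h x + h y" and h_mult: "h (x * y) = h x * h y" and h_eq_0_iff: "h x = 0 \<longleftrightarrow> x = 0"
begin

lemma h_diff: "h (x - y) = h x - h y"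
  using h_add[of "x - y" y] by simp

lemma det3_map_triple: "det3 (map_triple h u) (map_triple h v) (map_triple h w) = h (det3 u v w)"
  by (cases u; cases v; cases w) (simp add: h_add h_diff h_mult)

lemma cross_map_triple: "cross (map_triple h u) (map_triple h v) = map_triple h (cross u v)"
  by (cases u; cases v) (simp add: h_diff h_mult)

lemma conic_det_map_triple:
  "conic_det (map_triple h u) (map_triple h v) (map_triple h w) (map_triple h p) (map_triple h q) (map_triple h r) =
     h (conic_det u v w p q r)"
proof -
  have "cremona (coordinates (map_triple h u) (map_triple h v) (map_triple h w) (map_triple h t)) =
      map_triple h (cremona (coordinates u v w t))" for t
    by (simp add: det3_map_triple h_mult)
  then show ?thesis
    by (simp only: conic_det_def det3_map_triple)
qed

lemma map_triple_eq_0_iff: "map_triple h t = (0, 0, 0) \<longleftrightarrow> t = (0, 0, 0)"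
  by (cases t) (simp add: h_eq_0_iff)

end

lemma in_line_iff: "in_line R js \<longleftrightarrow> (\<exists>L. Line L \<in> blocks R \<and> set js \<subseteq> L)"
proof -
  have case_iff: "(case b of Line L \<Rightarrow> P L | Conic _ \<Rightarrow> False) \<longleftrightarrow> (\<exists>L. b = Line L \<and> P L)" for b :: "nat list block" and P
    by (cases b) auto
  have "in_line R js \<longleftrightarrow> (\<exists>L. Line L \<in> set R \<and> set js \<subseteq> set L)"
    by (auto simp: in_line_def list_ex_iff list_all_iff case_iff)
  also have "\<dots> \<longleftrightarrow> (\<exists>L. Line L \<in> blocks R \<and> set js \<subseteq> L)"
    unfolding blocks_def image_iff by (metis block.map(1) block.distinct(1) block.exhaust block.inject(1) block.map(2))
  finally show ?thesis .
qed

lemma in_conic_iff: "in_conic R js \<longleftrightarrow> (\<exists>C. Conic C \<in> blocks R \<and> set js \<subseteq> C)"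
proof -
  have case_iff: "(case b of Line _ \<Rightarrow> False | Conic L \<Rightarrow> P L) \<longleftrightarrow> (\<exists>L. b = Conic L \<and> P L)" for b :: "nat list block" and P
    by (cases b) auto
  have "in_conic R js \<longleftrightarrow> (\<exists>L. Conic L \<in> set R \<and> set js \<subseteq> set L)"
    by (auto simp: in_conic_def list_ex_iff list_all_iff case_iff)
  also have "\<dots> \<longleftrightarrow> (\<exists>L. Conic L \<in> blocks R \<and> set js \<subseteq> L)"
    unfolding blocks_def image_iff by (metis block.map(1) block.distinct(1) block.exhaust block.inject(2) block.map(2))
  finally show ?thesis .
qed

lemma has_line_triple_iff:
  assumes "distinct js"
  shows "has_line_triple R js \<longleftrightarrow> (\<exists>L. Line L \<in> blocks R \<and> 3 \<le> card (set js \<inter> L))"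
proof (induction R)
  case (Cons b R)
  have "length (filter (List.member L) js) = card (set js \<inter> set L)" for L
  proof -
    have "set (filter (List.member L) js) = set js \<inter> set L" by auto
    then show ?thesis
      using assms by (metis distinct_card distinct_filter)
  qed
  with Cons show ?case
    by (cases b) (auto simp: blocks_def)
qed (simp add: blocks_def)

text \<open>The checks on pairs, triples and sextuples yield injectivity, the collinear triples and
  the coconic sextuples in turn. The sextuples rely on the triples, because the bracket criterion
  for a conic also demands that no three points be collinear.\<close>

lemma realized_by_representable:
  fixes h :: "'r::comm_ring_1 \<Rightarrow> 'a::field"
    and ps :: "'r triple list"
  assumes "ring_embedding h" "realized_by R ps"
  shows "representable TYPE('a) (pair_of (blocks R))"
proof -
  interpret ring_embedding h by fact
  define p :: "nat \<Rightarrow> 'a triple" where "p i = map_triple h (ps ! (i - 1))" for i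
  have len: "length ps = 8"
    using assms by (simp add: realized_by_def)
  have cross_p: "cross (p i) (p j) = (0, 0, 0) \<longleftrightarrow> cross (ps ! (i - 1)) (ps ! (j - 1)) = (0, 0, 0)" for i j
    unfolding p_def cross_map_triple map_triple_eq_0_iff by (rule refl)
  have det_p: "det3 (p i) (p j) (p k) = 0 \<longleftrightarrow> det3 (ps ! (i - 1)) (ps ! (j - 1)) (ps ! (k - 1)) = 0" for i j k
    unfolding p_def det3_map_triple h_eq_0_iff by (rule refl)
  have conic_p: "conic_det (p i) (p j) (p k) (p l) (p m) (p n) = 0 \<longleftrightarrow>
      conic_det (ps ! (i - 1)) (ps ! (j - 1)) (ps ! (k - 1)) (ps ! (l - 1)) (ps ! (m - 1)) (ps ! (n - 1)) = 0"
    for i j k l m n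
    unfolding p_def conic_det_map_triple h_eq_0_iff by (rule refl)
  have cross_commute: "cross u v = (0, 0, 0) \<longleftrightarrow> cross v u = (0, 0, 0)" for u v :: "'a triple"
    by (cases u; cases v) (auto simp: algebra_simps)
  have dist: "distinct_points p"
    unfolding distinct_points_def
  proof (intro ballI impI)
    fix i j :: nat assume ij: "i \<in> {1..8}" "j \<in> {1..8}" "i \<noteq> j"
    then obtain js where js: "set js = {i, j}" "length js = 2" "check_pair (map (\<lambda>i. (i, ps ! (i - 1))) js)"
      using all_choose_zip[OF len, of 2 check_pair "{i, j}"] assms by (auto simp: realized_by_def)
    then obtain a b where ab: "js = [a, b]" by (auto simp: length_Suc_conv numeral_2_eq_2)
    then have "cross (p a) (p b) \<noteq> (0, 0, 0)" using js(3) by (simp add: cross_p)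
    moreover have "a = i \<and> b = j \<or> a = j \<and> b = i" using js(1) ab by (auto simp: doubleton_eq_iff)
    ultimately show "cross (p i) (p j) \<noteq> (0, 0, 0)" using cross_commute by blast
  qed
  have triple: "I \<in> collinear_triples (\<lambda>i. pt (p i)) \<longleftrightarrow> (\<exists>L. Line L \<in> blocks R \<and> I \<subseteq> L)"
    if I: "I \<subseteq> {1..8}" "card I = 3" for I
  proof -
    obtain js where js: "set js = I" "distinct js" "length js = 3" "check_triple R (map (\<lambda>i. (i, ps ! (i - 1))) js)"
      using all_choose_zip[OF len _ I, of "check_triple R"] assms by (auto simp: realized_by_def)
    then obtain i j k where ijk: "js = [i, j, k]" by (auto simp: length_Suc_conv numeral_3_eq_3)
    then have I': "I = {i, j, k}" "i \<noteq> j" "i \<noteq> k" "j \<noteq> k" using js(1,2) by auto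
    have "I \<in> collinear_triples (\<lambda>i. pt (p i)) \<longleftrightarrow> det3 (p i) (p j) (p k) = 0"
      using collinear_triples_iff[OF dist I(1)[unfolded I'(1)] I'(2-4)] by (simp only: I'(1))
    also have "\<dots> \<longleftrightarrow> in_line R js"
      using js(4) unfolding det_p ijk by simp
    finally show ?thesis by (simp only: in_line_iff js(1))
  qed
  have sextuple: "J \<in> coconic_sextuples (\<lambda>i. pt (p i)) \<longleftrightarrow> (\<exists>C. Conic C \<in> blocks R \<and> J \<subseteq> C)"
    if J: "J \<subseteq> {1..8}" "card J = 6" for J
  proof -
    obtain js where js: "set js = J" "distinct js" "length js = 6" "check_sextuple R (map (\<lambda>i. (i, ps ! (i - 1))) js)"
      using all_choose_zip[OF len _ J, of "check_sextuple R"] assms by (auto simp: realized_by_def)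
    have "length js = Suc (Suc (Suc (Suc (Suc (Suc 0)))))" using js(3) by simp
    then obtain a b c d e f where abc: "js = [a, b, c, d, e, f]" by (auto simp: length_Suc_conv)
    have Jeq: "J = {a, b, c, d, e, f}" using js(1) abc by simp
    have "(\<forall>x\<in>J. \<forall>y\<in>J. \<forall>z\<in>J. x \<noteq> y \<and> x \<noteq> z \<and> y \<noteq> z \<longrightarrow> det3 (p x) (p y) (p z) \<noteq> 0) \<longleftrightarrow> \<not> has_line_triple R js"
    proof -
      \<comment> \<open>Three collinear points of \<open>J\<close> form a triple contained in a line
        of \<open>R\<close>, by \<open>triple\<close>; so the test against the lines of
        \<open>R\<close> is equivalent to the vanishing of some bracket in \<open>J\<close>.\<close>
      have "(\<exists>L. Line L \<in> blocks R \<and> 3 \<le> card (J \<inter> L)) \<longleftrightarrow>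
          (\<exists>x\<in>J. \<exists>y\<in>J. \<exists>z\<in>J. x \<noteq> y \<and> x \<noteq> z \<and> y \<noteq> z \<and> det3 (p x) (p y) (p z) = 0)" (is "?A \<longleftrightarrow> ?B")
      proof
        assume ?A
        then obtain L where L: "Line L \<in> blocks R" "3 \<le> card (J \<inter> L)" by blast
        obtain T where T: "T \<subseteq> J \<inter> L" "card T = 3"
          by (rule obtain_subset_with_card_n[OF L(2)])
        obtain x y z where xyz: "T = {x, y, z}" "x \<noteq> y" "x \<noteq> z" "y \<noteq> z"
          using T(2) unfolding card_3_iff by blast
        have T8: "{x, y, z} \<subseteq> {1..8}" using T(1) J(1) unfolding xyz(1) by blast
        then have "{x, y, z} \<in> collinear_triples (\<lambda>i. pt (p i))"
          using triple[of "{x, y, z}"] T L(1) unfolding xyz(1) by blast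
        then have "det3 (p x) (p y) (p z) = 0"
          using collinear_triples_iff[OF dist T8] xyz by simp
        moreover have "x \<in> J" "y \<in> J" "z \<in> J" using T(1) xyz(1) by blast+
        ultimately show ?B using xyz by blast
      next
        assume ?B
        then obtain x y z where xyz: "x \<in> J" "y \<in> J" "z \<in> J" "x \<noteq> y" "x \<noteq> z" "y \<noteq> z" "det3 (p x) (p y) (p z) = 0"
          by blast
        then have T8: "{x, y, z} \<subseteq> {1..8}" and card: "card {x, y, z} = 3" using J(1) by auto
        then obtain L where L: "Line L \<in> blocks R" "{x, y, z} \<subseteq> L"
          using collinear_triples_iff[OF dist T8] triple[of "{x, y, z}"] xyz by blast
        have "finite J" using J(2) by (intro card_ge_0_finite) simp
        then have "card {x, y, z} \<le> card (J \<inter> L)"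
          using xyz(1-3) L(2) by (intro card_mono) auto
        then show ?A using L(1) card by auto
      qed
      then show ?thesis
        unfolding has_line_triple_iff[OF js(2)] js(1) by blast
    qed
    then have "J \<in> coconic_sextuples (\<lambda>i. pt (p i)) \<longleftrightarrow>
        \<not> has_line_triple R js \<and> conic_det (p a) (p b) (p c) (p d) (p e) (p f) = 0"
      using coconic_sextuples_iff[OF dist Jeq J] by blast
    also have "\<dots> \<longleftrightarrow> in_conic R js"
      using js(4) unfolding conic_p abc by simp
    finally show ?thesis by (simp only: in_conic_iff js(1))
  qed
  have "collinear_triples (\<lambda>i. pt (p i)) = fst (pair_of (blocks R))"
    using triple by (auto simp: pair_of_def collinear_triples_def)
  moreover have "coconic_sextuples (\<lambda>i. pt (p i)) = snd (pair_of (blocks R))"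
    using sextuple by (auto simp: pair_of_def coconic_sextuples_def)
  moreover have "inj_on (\<lambda>i. pt (p i)) {1..8}"
    using distinct_points_iff distinct_points_ne_0[OF dist] dist by blast
  ultimately show ?thesis
    unfolding representable_def by blast
qed

section \<open>Explicit integer points\<close>

abbreviation int_realized :: "nat list block list \<Rightarrow> int triple list \<Rightarrow> bool" where
  "int_realized \<equiv> realized_by"

text \<open>Homogeneous coordinates can be cleared of denominators, so rational realizations are
  written with integers. The same lists serve over every field of characteristic 0.\<close>

lemma realized_1:
  "int_realized K0 [(2,-1,-1),(0,1,0),(2,0,1),(1,0,0),(0,2,1),(2,-1,-2),(1,-1,1),(1,1,-2)]"
  "int_realized K1 [(0,1,-1),(1,-3,1),(1,-1,-1),(1,0,-1),(0,1,2),(1,1,0),(1,0,0),(2,2,1)]"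
  "int_realized K2 [(2,-1,0),(1,0,0),(1,-1,0),(0,1,0),(1,-2,-2),(0,1,-1),(1,2,1),(2,0,1)]"
  "int_realized K3 [(0,0,1),(0,1,-1),(0,2,-1),(0,1,-2),(0,3,-2),(1,0,0),(1,-1,0),(1,1,1)]"
  "int_realized K4 [(0,1,0),(0,2,1),(0,1,-1),(0,3,-1),(0,2,-1),(0,0,1),(1,1,0),(1,0,-1)]"
  "int_realized K5 [(4,-1,0),(2,-1,0),(1,-1,0),(0,1,0),(1,1,0),(1,0,0),(3,-1,0),(0,0,1)]"
  "int_realized K6 [(2,0,1),(1,0,-1),(1,0,1),(1,0,2),(1,0,0),(3,0,-1),(1,0,3),(0,0,1)]"
  "int_realized K7 [(1,0,1),(1,1,-1),(1,-2,1),(0,1,2),(0,2,1),(2,2,-1),(1,-1,0),(1,-2,2)]"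
  "int_realized K8 [(1,-2,-2),(1,0,1),(1,-1,-1),(1,-1,0),(1,2,0),(2,0,-1),(1,-4,-1),(1,-2,1)]"
  "int_realized K9 [(1,2,1),(1,1,1),(1,0,-1),(1,-1,2),(0,3,1),(1,2,-2),(0,1,-1),(1,-1,-1)]"
  "int_realized K10 [(1,-1,0),(1,1,2),(0,1,1),(2,-1,0),(1,0,0),(1,0,-1),(0,2,1),(2,1,-2)]"
  "int_realized K11 [(1,0,1),(1,0,-1),(1,0,3),(1,1,-1),(0,2,1),(1,3,0),(1,1,1),(0,1,1)]"
  "int_realized K12 [(5,-1,0),(1,0,0),(0,1,0),(1,0,1),(1,-2,-1),(0,1,-1),(1,2,2),(2,2,-1)]"
  "int_realized K13 [(1,-1,0),(0,1,0),(1,1,0),(7,0,-12),(1,-1,-1),(0,1,-1),(2,0,1),(1,2,2)]"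
  "int_realized K14 [(1,1,0),(1,2,1),(0,1,1),(0,1,-1),(1,-1,1),(2,2,-1),(1,-1,-1),(3,-1,0)]"
  "int_realized K15 [(0,0,1),(3,0,1),(1,0,0),(1,0,1),(0,3,2),(0,1,1),(1,1,0),(1,-1,1)]"
  by code_simp+

lemma realized_2:
  "int_realized K16 [(3,0,-1),(1,0,1),(1,0,-1),(1,0,0),(0,2,-1),(1,-1,0),(1,1,-1),(1,1,1)]"
  "int_realized K17 [(0,0,1),(2,0,1),(1,0,1),(2,0,-1),(0,1,-1),(0,1,0),(0,1,-2),(1,-1,0)]"
  "int_realized K18 [(1,0,-2),(1,0,1),(0,0,1),(1,0,-1),(1,-2,0),(1,1,0),(1,-1,0),(0,1,0)]"
  "int_realized K19 [(1,0,-1),(1,0,1),(5,0,1),(1,0,-3),(1,-1,-1),(0,1,1),(1,-1,1),(0,1,-1)]"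
  "int_realized K20 [(0,1,0),(6,1,0),(3,1,0),(1,0,0),(1,1,0),(0,1,-1),(0,0,1),(1,-1,-1)]"
  "int_realized K21 [(0,2,3),(0,1,0),(0,1,1),(0,1,-1),(0,2,1),(1,0,0),(1,0,-1),(1,0,1)]"
  "int_realized K22 [(0,0,1),(0,1,-1),(0,1,0),(0,1,1),(0,1,-2),(2,0,1),(1,0,-1),(1,0,0)]"
  "int_realized K23 [(1,0,0),(0,1,0),(1,1,0),(1,-2,0),(1,-1,0),(1,-3,0),(1,0,1),(0,0,1)]"
  "int_realized K24 [(1,0,-1),(0,1,-1),(2,2,-1),(2,-14,19),(1,0,0),(0,1,-2),(1,-1,-1),(1,1,0)]"
  "int_realized K25 [(1,0,1),(1,0,0),(0,0,1),(2,-1,0),(5,-2,1),(1,1,0),(0,1,1),(1,-1,1)]"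
  "int_realized K26 [(1,0,0),(3,2,0),(1,1,0),(1,0,1),(3,0,1),(1,1,-1),(1,-1,1),(0,1,1)]"
  "int_realized K27 [(0,0,1),(0,1,0),(0,3,-1),(1,-1,0),(1,-1,-3),(1,1,-1),(1,3,-1),(1,0,1)]"
  "int_realized K28 [(2,0,1),(1,0,1),(1,0,0),(1,1,-1),(1,-1,2),(0,1,1),(0,2,3),(0,1,0)]"
  "int_realized K29 [(1,1,-1),(0,2,-1),(1,-1,0),(1,-1,-1),(1,2,-1),(1,1,0),(0,1,1),(1,0,2)]"
  "int_realized K30 [(0,0,1),(1,-1,2),(1,-1,0),(1,1,-4),(1,1,-1),(0,1,0),(1,-6,3),(1,0,1)]"
  "int_realized K31 [(1,0,-1),(1,-1,-1),(1,1,-1),(1,0,1),(1,0,-3),(0,1,1),(1,-1,1),(0,3,-2)]"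
  by code_simp+

lemma realized_3:
  "int_realized K32 [(0,1,0),(1,3,0),(1,1,0),(1,0,-1),(1,-1,-1),(1,3,-3),(2,0,1),(0,1,-1)]"
  "int_realized K33 [(1,1,-1),(0,1,1),(3,2,-4),(1,-1,0),(1,1,0),(3,1,0),(1,-1,-1),(0,1,-1)]"
  "int_realized K34 [(1,1,0),(1,1,1),(1,1,-9),(0,1,-1),(1,0,-1),(1,0,4),(1,-1,-1),(1,-1,1)]"
  "int_realized K35 [(5,0,1),(0,0,1),(2,0,-1),(1,-1,0),(2,-1,0),(2,1,1),(0,1,1),(3,-1,-2)]"
  "int_realized K36 [(0,1,1),(0,3,-1),(0,0,1),(0,1,0),(2,-1,1),(1,0,1),(1,1,0),(1,-1,-1)]"
  "int_realized K37 [(0,1,0),(1,2,0),(1,-1,0),(1,-3,0),(1,0,1),(1,3,1),(0,1,-1),(0,0,1)]"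
  "int_realized K38 [(0,1,0),(0,1,2),(0,1,1),(0,0,1),(2,3,0),(1,1,0),(1,0,1),(1,-1,-1)]"
  "int_realized K39 [(1,0,0),(0,1,0),(1,-1,0),(1,3,0),(2,1,1),(1,-1,-1),(1,0,1),(0,1,-1)]"
  "int_realized K40 [(0,0,1),(1,0,-1),(1,0,2),(2,0,1),(0,1,-4),(0,1,-1),(2,-1,0),(1,1,0)]"
  "int_realized K41 [(0,0,1),(1,0,1),(1,0,-1),(1,0,0),(0,1,0),(0,1,-1),(0,2,1),(1,1,1)]"
  "int_realized K42 [(1,0,2),(1,0,-2),(1,0,1),(1,0,-1),(1,-1,0),(1,-1,1),(1,1,-1),(1,1,0)]"
  "int_realized K43 [(0,1,1),(0,1,0),(0,1,-4),(0,1,-1),(0,0,1),(1,0,0),(1,-1,-1),(1,1,0)]"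
  "int_realized K44 [(0,1,-1),(2,1,2),(1,1,2),(3,1,-1),(1,0,-1),(1,0,1),(2,1,-5),(0,1,-2)]"
  "int_realized K45 [(0,0,1),(1,0,-1),(1,0,1),(0,1,0),(0,1,1),(1,-2,-1),(1,2,0),(1,-1,2)]"
  "int_realized K46 [(1,1,0),(2,0,1),(1,-1,1),(1,0,0),(0,1,0),(1,0,-1),(4,-1,1),(0,2,1)]"
  "int_realized K47 [(1,0,-1),(0,1,0),(1,-1,-1),(0,1,1),(1,1,0),(0,2,-1),(3,1,-1),(1,0,1)]"
  by code_simp+

lemma realized_4:
  "int_realized K48 [(0,1,0),(1,-1,0),(1,-4,0),(1,-2,-1),(1,1,-1),(1,0,1),(0,1,-1),(0,0,1)]"
  "int_realized K49 [(1,0,0),(1,1,-1),(1,-1,1),(0,0,1),(3,0,-1),(1,1,0),(0,1,1),(1,-3,-1)]"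
  "int_realized K50 [(1,1,0),(0,0,1),(1,1,-3),(0,1,0),(5,-1,0),(0,1,1),(1,-1,-1),(1,0,1)]"
  "int_realized K51 [(1,0,0),(1,0,-1),(2,0,-1),(1,2,0),(0,1,0),(0,2,1),(1,-1,1),(1,-1,-2)]"
  "int_realized K52 [(1,0,0),(0,1,-1),(2,-1,1),(1,0,-1),(4,0,1),(1,1,0),(0,1,0),(1,1,1)]"
  "int_realized K53 [(0,1,0),(3,1,3),(1,0,1),(1,-1,0),(3,-2,0),(0,1,-1),(0,0,1),(1,1,-1)]"
  "int_realized K54 [(0,1,0),(1,-1,0),(3,1,0),(3,-5,3),(1,0,1),(0,0,1),(0,1,-1),(1,1,-1)]"
  "int_realized K55 [(0,0,1),(0,1,-1),(0,1,1),(1,0,0),(2,0,3),(1,-1,0),(1,-4,3),(1,1,0)]"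
  "int_realized K56 [(0,1,-1),(1,0,-1),(1,-1,0),(1,1,1),(1,2,0),(0,0,1),(1,0,1),(1,5,-1)]"
  "int_realized K57 [(0,0,1),(0,1,0),(0,1,-1),(5,-5,-2),(1,-1,1),(1,1,0),(1,-2,0),(1,0,-1)]"
  "int_realized K58 [(0,2,-1),(1,-1,1),(1,1,0),(1,1,-1),(1,-1,0),(1,0,-1),(1,0,1),(3,0,1)]"
  "int_realized K59 [(1,1,0),(1,-1,0),(7,-2,0),(1,-1,1),(5,-1,3),(1,0,-1),(1,0,1),(1,1,-1)]"
  "int_realized K60 [(0,1,0),(1,-1,0),(1,3,0),(1,0,1),(2,1,2),(0,0,1),(3,-1,1),(1,1,-1)]"
  "int_realized K61 [(1,-1,0),(1,0,0),(4,-1,0),(1,1,-1),(1,-3,1),(1,0,-1),(1,1,1),(1,4,-2)]"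
  "int_realized K62 [(2,0,1),(0,0,1),(1,0,-1),(1,3,-3),(3,-1,1),(0,1,-1),(1,-1,-1),(1,1,0)]"
  "int_realized K63 [(0,3,-1),(0,1,0),(0,0,1),(1,1,0),(2,-1,2),(2,7,-2),(2,0,1),(1,-1,2)]"
  by code_simp+

lemma realized_5:
  "int_realized K64 [(0,1,0),(1,0,0),(1,-1,0),(1,-2,0),(0,1,1),(0,2,1),(1,1,1),(1,0,-1)]"
  "int_realized K65 [(0,1,0),(1,1,0),(1,-1,0),(1,0,0),(1,1,-1),(1,0,-1),(1,1,1),(0,2,-1)]"
  "int_realized K66 [(0,1,1),(1,0,0),(2,-1,-1),(1,-1,-1),(0,0,1),(0,1,0),(1,0,1),(1,1,0)]"
  "int_realized K67 [(0,1,0),(0,0,1),(0,1,-1),(0,3,-1),(1,-1,0),(1,1,0),(1,-1,-1),(1,0,1)]"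
  "int_realized K68 [(3,0,-1),(0,0,1),(2,0,-1),(1,0,-1),(0,3,-1),(1,-1,0),(0,1,0),(1,1,0)]"
  "int_realized K69 [(0,1,0),(0,2,-1),(0,0,1),(0,1,-1),(1,-1,0),(3,1,0),(1,1,-1),(1,0,1)]"
  "int_realized K70 [(1,0,0),(0,0,1),(1,0,1),(1,0,-2),(1,1,-1),(0,1,-1),(3,1,0),(1,-1,0)]"
  "int_realized K71 [(0,0,1),(0,1,0),(0,2,-1),(0,1,3),(1,0,1),(2,0,3),(1,1,0),(1,-1,0)]"
  "int_realized K72 [(0,0,1),(0,1,1),(0,1,0),(0,1,-1),(1,0,1),(1,0,0),(3,0,1),(1,-1,0)]"
  "int_realized K73 [(0,0,1),(0,1,1),(0,1,-1),(0,1,2),(0,1,0),(1,0,1),(1,0,-1),(1,-1,0)]"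
  "int_realized K74 [(1,0,-1),(1,1,0),(1,2,-2),(1,-1,1),(1,-1,-1),(1,2,0),(1,0,1),(1,1,-2)]"
  "int_realized K75 [(0,1,0),(1,-1,0),(1,0,0),(1,1,-1),(1,0,-1),(2,0,-1),(1,-1,1),(0,1,1)]"
  "int_realized K76 [(1,1,0),(1,1,1),(0,0,1),(2,1,0),(1,0,0),(1,0,-1),(0,1,-1),(1,2,-1)]"
  "int_realized K77 [(1,0,1),(1,0,0),(1,0,-1),(1,1,0),(0,1,-1),(1,-1,0),(1,-1,-1),(0,3,1)]"
  "int_realized K78 [(1,0,0),(1,2,0),(0,1,0),(0,1,-1),(1,1,-1),(1,1,1),(0,0,1),(1,-1,-2)]"
  "int_realized K79 [(3,1,0),(1,0,0),(0,1,0),(0,0,1),(3,1,-1),(1,0,-1),(0,1,1),(1,-1,1)]"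
  by code_simp+

lemma realized_6:
  "int_realized K80 [(0,0,1),(0,1,-1),(0,1,0),(1,1,0),(1,1,-1),(1,0,1),(1,-1,0),(3,1,1)]"
  "int_realized K81 [(0,1,-1),(1,0,0),(1,1,-1),(0,1,0),(0,1,3),(1,-1,0),(1,-1,-1),(1,0,1)]"
  "int_realized K82 [(0,1,-1),(1,0,-1),(1,-1,0),(1,0,0),(1,1,-1),(1,0,1),(1,-3,1),(0,1,1)]"
  "int_realized K83 [(1,1,-1),(0,1,-1),(1,0,0),(0,3,-1),(1,-2,0),(0,1,1),(1,1,0),(1,0,-1)]"
  "int_realized K84 [(1,-1,0),(1,0,1),(0,1,1),(1,0,-1),(2,1,-3),(1,0,0),(1,1,-1),(0,3,-1)]"
  "int_realized K85 [(1,0,0),(0,1,0),(2,1,0),(0,1,-1),(3,1,-1),(0,3,-1),(2,0,-1),(1,0,1)]"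
  "int_realized K86 [(0,1,0),(1,1,0),(1,-4,0),(0,0,1),(0,1,1),(1,1,-1),(1,-1,1),(1,0,1)]"
  "int_realized K87 [(0,1,1),(0,0,1),(0,1,0),(1,1,1),(5,-1,-1),(1,1,-1),(1,-2,0),(1,-1,0)]"
  "int_realized K88 [(1,0,-1),(2,0,1),(1,0,1),(1,-3,-1),(1,1,-1),(1,-1,0),(1,3,1),(1,1,0)]"
  "int_realized K89 [(1,1,0),(1,0,0),(2,1,0),(0,1,1),(1,0,-1),(1,-1,-1),(1,-1,1),(3,5,-7)]"
  "int_realized K90 [(1,0,1),(1,-2,-1),(1,-1,0),(0,0,1),(3,0,1),(0,1,0),(1,1,-1),(0,1,2)]"
  "int_realized K91 [(1,2,0),(1,-2,-2),(1,0,-1),(3,2,0),(1,-1,0),(0,1,1),(1,1,1),(0,0,1)]"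
  "int_realized K92 [(1,1,1),(3,1,2),(1,-1,0),(1,0,0),(0,1,1),(2,0,-1),(1,-1,1),(1,1,-7)]"
  "int_realized K93 [(2,0,-3),(1,0,-1),(0,0,1),(1,3,0),(0,1,0),(1,1,0),(1,-1,1),(3,1,-1)]"
  "int_realized K94 [(1,0,0),(1,0,1),(0,0,1),(1,0,-1),(1,1,0),(0,1,0),(0,1,-1),(3,3,-1)]"
  "int_realized K95 [(1,0,1),(1,0,0),(0,0,1),(2,0,-1),(1,1,0),(0,1,-1),(0,1,0),(1,-1,-1)]"
  by code_simp+

lemma realized_7:
  "int_realized K96 [(1,0,0),(1,1,0),(1,-1,0),(1,2,0),(1,0,1),(0,0,1),(0,1,-1),(0,1,1)]"
  "int_realized K97 [(1,0,0),(0,1,0),(1,-1,0),(1,-3,0),(0,0,1),(1,0,-1),(0,2,-1),(1,2,-1)]"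
  "int_realized K98 [(1,-1,0),(0,0,1),(1,-1,-2),(1,-1,1),(0,1,0),(1,0,0),(0,1,1),(1,0,-1)]"
  "int_realized K99 [(1,-1,1),(0,0,1),(1,-1,0),(1,-1,-1),(0,1,-1),(1,0,0),(0,1,3),(1,0,1)]"
  "int_realized K100 [(0,1,0),(0,2,1),(0,1,-1),(0,0,1),(1,-1,0),(1,0,0),(1,1,1),(1,1,-1)]"
  "int_realized K101 [(0,1,0),(1,0,1),(1,-1,1),(1,1,1),(0,0,1),(0,1,-1),(0,1,1),(1,0,0)]"
  "int_realized K102 [(1,1,-1),(1,-1,1),(1,0,0),(1,1,0),(0,0,1),(2,0,1),(1,-1,0),(0,1,1)]"
  "int_realized K103 [(1,0,1),(0,0,1),(1,0,0),(1,1,0),(0,1,-1),(1,1,-1),(3,1,0),(0,1,1)]"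
  "int_realized K104 [(0,0,1),(1,-1,1),(1,-1,0),(1,0,0),(1,0,-1),(0,1,-1),(1,1,0),(1,1,1)]"
  "int_realized K105 [(0,1,0),(0,1,-3),(0,0,1),(1,1,-1),(1,0,-1),(1,0,2),(1,1,1),(1,-2,0)]"
  "int_realized K106 [(0,0,1),(1,-1,0),(1,-1,-1),(1,1,0),(1,1,-1),(0,1,0),(1,0,-2),(1,0,1)]"
  "int_realized K107 [(1,0,0),(1,1,0),(1,-1,0),(1,1,1),(1,-1,-1),(0,0,1),(2,3,5),(0,1,-1)]"
  "int_realized K108 [(0,1,0),(1,0,0),(1,-1,0),(1,0,-1),(1,-1,-1),(1,0,-2),(0,1,-1),(1,1,1)]"
  "int_realized K109 [(1,1,-1),(1,0,1),(1,-1,3),(0,0,1),(1,1,1),(1,0,0),(1,-1,0),(0,1,0)]"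
  "int_realized K110 [(0,1,-1),(1,0,0),(3,1,-1),(1,0,-1),(1,-1,0),(0,0,1),(1,1,1),(3,2,0)]"
  "int_realized K111 [(1,-1,1),(1,-1,0),(0,0,1),(1,-2,0),(0,1,1),(1,0,0),(0,2,-1),(1,0,-1)]"
  by code_simp+

lemma realized_8:
  "int_realized K112 [(1,-1,0),(1,-1,2),(0,0,1),(1,1,0),(0,1,0),(1,0,1),(0,1,-3),(1,0,-2)]"
  "int_realized K113 [(0,1,0),(0,0,1),(0,1,1),(1,1,0),(1,0,0),(1,1,-3),(2,-1,-1),(1,-5,-1)]"
  "int_realized K114 [(0,0,1),(1,-1,2),(1,-1,-1),(1,1,0),(1,1,-3),(1,0,1),(3,1,1),(0,1,0)]"
  "int_realized K115 [(0,1,0),(0,0,1),(0,1,1),(1,0,-1),(1,1,-1),(1,-1,0),(1,-1,1),(2,-1,-1)]"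
  "int_realized K116 [(1,0,0),(1,-1,0),(0,1,0),(1,1,0),(1,0,1),(0,0,1),(0,1,1),(1,-1,1)]"
  "int_realized K117 [(1,0,1),(0,0,1),(1,0,0),(1,0,-1),(1,1,1),(0,1,0),(1,1,0),(1,-1,-1)]"
  "int_realized K118 [(1,1,0),(0,1,0),(1,3,0),(1,-1,0),(1,1,-1),(0,0,1),(1,0,-1),(0,1,1)]"
  "int_realized K120 [(1,1,-1),(0,1,0),(1,0,-1),(0,1,-1),(1,0,0),(0,0,1),(1,-1,0),(1,1,1)]"
  "int_realized K121 [(1,1,0),(0,0,1),(1,1,1),(0,1,0),(1,0,0),(0,1,1),(1,-1,1),(2,0,1)]"
  "int_realized K123 [(1,-1,-1),(0,1,0),(1,0,-1),(0,0,1),(1,-1,0),(0,1,1),(1,0,1),(1,1,0)]"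
  "int_realized K124 [(1,0,1),(1,0,-1),(1,0,0),(0,1,0),(1,-1,1),(1,-1,-1),(0,1,-1),(0,1,1)]"
  "int_realized K126 [(1,1,0),(1,0,0),(0,1,0),(1,-1,0),(0,1,-1),(1,0,1),(1,-1,1),(0,0,1)]"
  by code_simp+

lemma catalogue_representable:
  assumes "R \<in> catalogue" "R \<notin> {K_fano, K_Q63, K_fano_point, K_Q41}"
  shows "representable TYPE('a::field_char_0) (pair_of (blocks R))"
proof -
  have "R \<in> {K_fano, K_Q63, K_fano_point, K_Q41} \<or> (\<exists>ps. int_realized R ps)"
    using assms(1)[unfolded catalogue_def]
    by (elim insertE emptyE)
      (hypsubst, ((rule disjI1, blast) | (rule disjI2, rule exI,
        rule realized_1 realized_2 realized_3 realized_4 realized_5 realized_6 realized_7 realized_8)))+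
  moreover have "ring_embedding (of_int :: int \<Rightarrow> 'a)"
    by unfold_locales simp_all
  ultimately show ?thesis
    using assms(2) realized_by_representable by blast
qed

subsection \<open>The exceptional configurations\<close>

lemma det3_combine: "det3 (combine a u v w) (combine b u v w) (combine c u v w) = det3 a b c * det3 u v w"
  by (cases a; cases b; cases c; cases u; cases v; cases w) (simp add: algebra_simps)

lemma det3_scale: "det3 (scale k a) (scale k b) (scale k c) = k * k * k * det3 a b c"
  by (cases a; cases b; cases c) (simp add: algebra_simps)

lemma cremona_scale: "cremona (scale k t) = scale (k * k) (cremona t)"
  by (cases t) (simp add: ac_simps)

text \<open>Multiplicativity of the determinant compares the two brackets after multiplication by
  \<open>det3 u v w\<close>: on one side Cramer's rule scales all three vectors and contributes the
  cube, and one factor cancels.\<close>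

lemma det3_coordinates:
  fixes u :: "'a::idom triple"
  assumes "det3 u v w \<noteq> 0"
  shows "det3 (coordinates u v w x) (coordinates u v w y) (coordinates u v w z) =
     det3 u v w * det3 u v w * det3 x y z"
proof -
  have "det3 (coordinates u v w x) (coordinates u v w y) (coordinates u v w z) * det3 u v w =
      (det3 u v w * det3 u v w * det3 x y z) * det3 u v w"
    using det3_combine[of "coordinates u v w x" u v w "coordinates u v w y" "coordinates u v w z"]
    by (simp only: combine_coordinates det3_scale ac_simps)
  with assms show ?thesis by (metis mult_right_cancel)
qed

text \<open>Every bracket inside \<open>conic_det\<close> acquires the same factor, the square of
  \<open>det3 u v w\<close>, so the vanishing of the whole expression is kept.\<close>

lemma conic_det_coordinates:
  fixes u :: "'a::idom triple" and p :: "nat \<Rightarrow> 'a triple"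
  assumes "det3 u v w \<noteq> 0" "conic_det (p a) (p b) (p c) (p d) (p e) (p f) = 0"
  defines "q \<equiv> \<lambda>i. coordinates u v w (p i)"
  shows "conic_det (q a) (q b) (q c) (q d) (q e) (q f) = 0"
proof -
  have "coordinates (q a) (q b) (q c) (q t) = scale (det3 u v w * det3 u v w) (coordinates (p a) (p b) (p c) (p t))" for t
    unfolding q_def coordinates.simps[of "coordinates u v w _"] det3_coordinates[OF assms(1)] by simp
  then show ?thesis
    using assms(2) by (simp only: conic_det_def cremona_scale det3_scale mult_zero_right)
qed

text \<open>Three noncollinear points are moved to the vertices of the coordinate triangle without
  losing any incidence. They appear as multiples by \<open>D\<close> of the unit vectors because
  \<open>coordinates\<close> is not divided by the determinant.\<close>

lemma ex_coordinates:
  fixes P :: "nat \<Rightarrow> 'a::field proj_plane"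
  assumes inj: "inj_on P {1..8}" and ijk: "{i, j, k} \<subseteq> {1..8}" "i \<noteq> j" "i \<noteq> k" "j \<noteq> k"
    and base: "{i, j, k} \<notin> collinear_triples P"
  obtains q :: "nat \<Rightarrow> 'a triple" and D where "D \<noteq> 0" "q i = (D, 0, 0)" "q j = (0, D, 0)" "q k = (0, 0, D)"
    and "\<And>x y z. {x, y, z} \<subseteq> {1..8} \<Longrightarrow> x \<noteq> y \<Longrightarrow> x \<noteq> z \<Longrightarrow> y \<noteq> z \<Longrightarrow>
      {x, y, z} \<in> collinear_triples P \<longleftrightarrow> det3 (q x) (q y) (q z) = 0"
    and "\<And>a b c d e f. {a, b, c, d, e, f} \<in> coconic_sextuples P \<Longrightarrow>
      conic_det (q a) (q b) (q c) (q d) (q e) (q f) = 0"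
proof -
  obtain p where p0: "\<forall>i. p i \<noteq> (0, 0, 0)" and P: "P = (\<lambda>i. pt (p i))"
    using ex_pt_family[of P] by blast
  have dist: "distinct_points p"
    using inj distinct_points_iff[of p] p0 unfolding P by blast
  define D where "D = det3 (p i) (p j) (p k)"
  define q where "q = (\<lambda>x. coordinates (p i) (p j) (p k) (p x))"
  have D: "D \<noteq> 0"
    using base collinear_triples_iff[OF dist ijk] unfolding P D_def by blast
  have q: "q i = (D, 0, 0)" "q j = (0, D, 0)" "q k = (0, 0, D)"
    by (simp_all add: q_def D_def)
  have lin: "{x, y, z} \<in> collinear_triples P \<longleftrightarrow> det3 (q x) (q y) (q z) = 0"
    if "{x, y, z} \<subseteq> {1..8}" "x \<noteq> y" "x \<noteq> z" "y \<noteq> z" for x y z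
  proof -
    have "det3 (q x) (q y) (q z) = D * D * det3 (p x) (p y) (p z)"
      unfolding q_def D_def by (rule det3_coordinates) (use D in \<open>simp only: D_def not_False_eq_True\<close>)
    then show ?thesis
      using collinear_triples_iff[OF dist that] D unfolding P by simp
  qed
  have con: "conic_det (q a) (q b) (q c) (q d) (q e) (q f) = 0"
    if J: "{a, b, c, d, e, f} \<in> coconic_sextuples P" for a b c d e f
  proof -
    have "{a, b, c, d, e, f} \<subseteq> {1..8}" "card {a, b, c, d, e, f} = 6"
      using J by (simp_all only: coconic_sextuples_def mem_Collect_eq)
    then have "conic_det (p a) (p b) (p c) (p d) (p e) (p f) = 0"
      using coconic_sextuples_iff[OF dist refl, of a b c d e f] J unfolding P by (simp only: HOL.simp_thms)
    then show ?thesis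
      unfolding q_def by (rule conic_det_coordinates[OF D[unfolded D_def]])
  qed
  from that[OF D q lin con] show ?thesis .
qed

text \<open>Ceva against Menelaus in the triangle a, b, d with c, e, f on its sides: the lines cd,
  be, af meet in g, while c, e, f are collinear. The two conditions differ by a sign, which forces 2
  = 0.\<close>

lemma fano_not_realizable:
  fixes P :: "nat \<Rightarrow> 'a::field_char_0 proj_plane"
  assumes inj: "inj_on P {1..8}" and range: "{a, b, c, d, e, f, g} \<subseteq> {1..8}" and dist: "distinct [a, b, c, d, e, f, g]"
    and lines: "{a, b, c} \<in> collinear_triples P" "{a, d, e} \<in> collinear_triples P" "{b, d, f} \<in> collinear_triples P"
      "{c, e, f} \<in> collinear_triples P" "{c, d, g} \<in> collinear_triples P" "{b, e, g} \<in> collinear_triples P"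
      "{a, f, g} \<in> collinear_triples P"
    and triangles: "{a, b, d} \<notin> collinear_triples P" "{a, c, d} \<notin> collinear_triples P"
      "{b, d, e} \<notin> collinear_triples P" "{a, b, f} \<notin> collinear_triples P" "{a, b, g} \<notin> collinear_triples P"
      "{a, d, g} \<notin> collinear_triples P" "{b, d, g} \<notin> collinear_triples P"
  shows False
proof -
  have abd: "{a, b, d} \<subseteq> {1..8}" "a \<noteq> b" "a \<noteq> d" "b \<noteq> d"
    using range dist by simp_all
  obtain q :: "nat \<Rightarrow> 'a triple" and D where D: "D \<noteq> 0" and q: "q a = (D, 0, 0)" "q b = (0, D, 0)" "q d = (0, 0, D)"
    and lin: "\<And>x y z. {x, y, z} \<subseteq> {1..8} \<Longrightarrow> x \<noteq> y \<Longrightarrow> x \<noteq> z \<Longrightarrow> y \<noteq> z \<Longrightarrow>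
      {x, y, z} \<in> collinear_triples P \<longleftrightarrow> det3 (q x) (q y) (q z) = 0"
    by (rule ex_coordinates[OF inj abd triangles(1)], rule that, assumption+)
  obtain c1 c2 c3 where c: "q c = (c1, c2, c3)" by (cases "q c")
  obtain e1 e2 e3 where e: "q e = (e1, e2, e3)" by (cases "q e")
  obtain f1 f2 f3 where f: "q f = (f1, f2, f3)" by (cases "q f")
  obtain x y z where g: "q g = (x, y, z)" by (cases "q g")
  have "det3 (q a) (q b) (q c) = 0" "det3 (q a) (q d) (q e) = 0" "det3 (q b) (q d) (q f) = 0"
    using lines(1-3) lin dist range by simp_all
  then have "c3 = 0" "e2 = 0" "f1 = 0"
    using D by (simp_all add: q c e f)
  moreover have "det3 (q a) (q c) (q d) \<noteq> 0" "det3 (q b) (q d) (q e) \<noteq> 0" "det3 (q a) (q b) (q f) \<noteq> 0"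
      "det3 (q a) (q b) (q g) \<noteq> 0" "det3 (q a) (q d) (q g) \<noteq> 0" "det3 (q b) (q d) (q g) \<noteq> 0"
    using triangles(2-7) lin dist range by simp_all
  then have "c2 \<noteq> 0" "e1 \<noteq> 0" "f3 \<noteq> 0" "z \<noteq> 0" "y \<noteq> 0" "x \<noteq> 0"
    by (auto simp: q c e f g)
  moreover have "det3 (q c) (q e) (q f) = 0" "det3 (q c) (q d) (q g) = 0" "det3 (q b) (q e) (q g) = 0" "det3 (q a) (q f) (q g) = 0"
    using lines(4-7) lin dist range by simp_all
  ultimately have eqs: "c1 * f2 * e3 + c2 * e1 * f3 = 0" "c1 * y = c2 * x" "e1 * z = e3 * x" "f2 * z = f3 * y"
    using D by (simp_all add: q c e f g algebra_simps neg_eq_iff_add_eq_0)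
  \<comment> \<open>The product of the equations of the three lines through g, which is Ceva's
    condition once x y z is cancelled.\<close>
  have "c1 * f2 * e3 * (x * y * z) = c2 * e1 * f3 * (x * y * z)"
    using eqs(2-4) by algebra
  then have "c1 * f2 * e3 = c2 * e1 * f3"
    using \<open>x \<noteq> 0\<close> \<open>y \<noteq> 0\<close> \<open>z \<noteq> 0\<close> by simp
  with eqs(1) have "2 * (c2 * e1 * f3) = 0" by simp
  then show False
    using \<open>c2 \<noteq> 0\<close> \<open>e1 \<noteq> 0\<close> \<open>f3 \<noteq> 0\<close> by simp
qed

lemma mem_pair_of_blocks:
  assumes "{i, j, k} \<subseteq> {1..8}" "i \<noteq> j" "i \<noteq> k" "j \<noteq> k"
  shows "{i, j, k} \<in> fst (pair_of (blocks R)) \<longleftrightarrow> in_line R [i, j, k]"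
  using assms by (simp add: pair_of_def in_line_iff)

text \<open>With 1, 2, 4 as coordinate triangle, the points 3, 5, 6 lie on its sides. Eliminating 7
  and 8 from the five remaining lines leaves one equation between \<open>s\<close> and
  \<open>t\<close>, and t / s is a root of X^2 + X + 1.\<close>

lemma Q41_relation:
  fixes P :: "nat \<Rightarrow> 'a::field proj_plane"
  assumes inj: "inj_on P {1..8}" and P: "collinear_triples P = fst (pair_of (blocks K_Q41))"
  shows "\<exists>s t :: 'a. s \<noteq> 0 \<and> s * s + s * t + t * t = 0"
proof -
  have mem: "{i, j, k} \<in> collinear_triples P \<longleftrightarrow> in_line K_Q41 [i, j, k]"
    if "{i, j, k} \<subseteq> {1..8}" "i \<noteq> j" "i \<noteq> k" "j \<noteq> k" for i j k
    using mem_pair_of_blocks[OF that] by (simp add: P)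
  have "\<not> in_line K_Q41 [1, 2, 4]" by code_simp
  then have base: "{1, 2, 4} \<notin> collinear_triples P" using mem[of 1 2 4] by simp
  obtain q :: "nat \<Rightarrow> 'a triple" and D where D: "D \<noteq> 0"
    and q: "q 1 = (D, 0, 0)" "q 2 = (0, D, 0)" "q 4 = (0, 0, D)"
    and lin: "\<And>x y z. {x, y, z} \<subseteq> {1..8} \<Longrightarrow> x \<noteq> y \<Longrightarrow> x \<noteq> z \<Longrightarrow> y \<noteq> z \<Longrightarrow>
      {x, y, z} \<in> collinear_triples P \<longleftrightarrow> det3 (q x) (q y) (q z) = 0"
    by (rule ex_coordinates[OF inj _ _ _ _ base], simp, simp, simp, simp, rule that, assumption+)
  have det: "det3 (q i) (q j) (q k) = 0 \<longleftrightarrow> in_line K_Q41 [i, j, k]"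
    if "{i, j, k} \<subseteq> {1..8}" "i \<noteq> j" "i \<noteq> k" "j \<noteq> k" for i j k
    using lin[OF that] mem[OF that] by simp
  have "in_line K_Q41 [1, 2, 3]" "in_line K_Q41 [1, 4, 5]" "in_line K_Q41 [2, 4, 6]" "in_line K_Q41 [1, 6, 7]"
      "in_line K_Q41 [2, 5, 8]" "in_line K_Q41 [4, 7, 8]" "in_line K_Q41 [3, 5, 7]" "in_line K_Q41 [3, 6, 8]"
      "\<not> in_line K_Q41 [2, 3, 4]" "\<not> in_line K_Q41 [1, 2, 5]" "\<not> in_line K_Q41 [1, 4, 6]"
      "\<not> in_line K_Q41 [2, 4, 7]" "\<not> in_line K_Q41 [1, 4, 8]"
    by code_simp+
  then have dets: "det3 (q 1) (q 2) (q 3) = 0" "det3 (q 1) (q 4) (q 5) = 0" "det3 (q 2) (q 4) (q 6) = 0"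
      "det3 (q 1) (q 6) (q 7) = 0" "det3 (q 2) (q 5) (q 8) = 0" "det3 (q 4) (q 7) (q 8) = 0"
      "det3 (q 3) (q 5) (q 7) = 0" "det3 (q 3) (q 6) (q 8) = 0"
    and nz: "det3 (q 2) (q 3) (q 4) \<noteq> 0" "det3 (q 1) (q 2) (q 5) \<noteq> 0" "det3 (q 1) (q 4) (q 6) \<noteq> 0"
      "det3 (q 2) (q 4) (q 7) \<noteq> 0" "det3 (q 1) (q 4) (q 8) \<noteq> 0"
    by (simp_all add: det)
  obtain a b b3 where q3: "q 3 = (a, b, b3)" by (cases "q 3")
  obtain c c2 d where q5: "q 5 = (c, c2, d)" by (cases "q 5")
  obtain e1 e f where q6: "q 6 = (e1, e, f)" by (cases "q 6")
  obtain x y z where q7: "q 7 = (x, y, z)" by (cases "q 7")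
  obtain x' y' z' where q8: "q 8 = (x', y', z')" by (cases "q 8")
  have zero: "b3 = 0" "c2 = 0" "e1 = 0"
    using dets(1-3) D by (simp_all add: q q3 q5 q6 del: One_nat_def)
  have eqs: "e * z = f * y" "c * z' = d * x'" "x * y' = y * x'"
      "b * d * x = a * d * y + b * c * z" "a * f * y' = a * e * z' + b * f * x'"
    using dets(4-8) D by (simp_all add: q q3 q5 q6 q7 q8 zero algebra_simps neg_eq_iff_add_eq_0 del: One_nat_def)
  have nonzero: "a \<noteq> 0" "d \<noteq> 0" "e \<noteq> 0" "x \<noteq> 0" "y' \<noteq> 0"
    using nz by (auto simp: q q3 q5 q6 q7 q8 simp del: One_nat_def)
  define s t where "s = a * d * e" and "t = b * c * f"
  have 1: "b * d * e * x = (s + t) * y" and 2: "a * f * c * y' = (s + t) * x'"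
    unfolding s_def t_def using eqs by algebra+
  have "s * t * (x * y') = (s + t) * (s + t) * (x * y')"
    using 1 2 eqs(3) unfolding s_def t_def by algebra
  then have "s * t = (s + t) * (s + t)"
    using nonzero by simp
  then have "s * s + s * t + t * t = 0"
    by algebra
  moreover have "s \<noteq> 0"
    using nonzero by (simp add: s_def)
  ultimately show ?thesis by blast
qed

text \<open>Completing the square turns the relation into a vanishing sum of squares with positive
  weights and \<open>s\<close> nonzero. This works in every ordered field, hence for the reals and
  the rationals alike.\<close>

lemma Q41_not_realizable:
  fixes P :: "nat \<Rightarrow> 'a::linordered_field proj_plane"
  assumes "inj_on P {1..8}" "collinear_triples P = fst (pair_of (blocks K_Q41))"
  shows False
proof -
  obtain s t :: 'a where st: "s \<noteq> 0" "s * s + s * t + t * t = 0"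
    using Q41_relation[OF assms] by blast
  have "(s + 2 * t)\<^sup>2 + 3 * s\<^sup>2 = 4 * (s * s + s * t + t * t)"
    by (simp add: power2_eq_square algebra_simps)
  moreover have "0 < s\<^sup>2" "0 \<le> (s + 2 * t)\<^sup>2"
    using st(1) by simp_all
  ultimately show False
    using st(2) by simp
qed

text \<open>The coefficients are the cross product of (a, b, 0) and (c, 0, d): an equation of the
  line through the points 3 and 5.\<close>

definition fourth_side :: "'a::idom \<Rightarrow> 'a \<Rightarrow> 'a \<Rightarrow> 'a \<Rightarrow> 'a triple \<Rightarrow> 'a" where
  "fourth_side a b c d = linear_form (b * d, - (a * d), - (b * c))"

text \<open>Each conic passes through four vertices of the quadrilateral, omitting an opposite pair:
  3 and 4, 2 and 5, or 1 and 6. The quadrics through four such vertices form a pencil spanned by two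
  products of sides, and \<open>u\<close>, \<open>v\<close> lie on a common member iff the two
  products have proportional values there.\<close>

lemma conic_det_quadrilateral:
  assumes "u = (x, y, z)" "v = (x', y', z')"
  shows "conic_det (D, 0, 0) (0, D, 0) (c, 0, d) (0, b * c * k, - (a * d * k)) u v =
      D ^ 8 * a * c * d ^ 4 * k ^ 2 *
      (x * y * (z' * fourth_side a b c d v) - x' * y' * (z * fourth_side a b c d u))"
    and "conic_det (D, 0, 0) (a, b, 0) (0, 0, D) (0, b * c * k, - (a * d * k)) u v =
      D ^ 8 * a * b ^ 4 * c * k ^ 2 *
      (x' * z' * (y * fourth_side a b c d u) - x * z * (y' * fourth_side a b c d v))"
    and "conic_det (0, D, 0) (a, b, 0) (0, 0, D) (c, 0, d) u v =
      D ^ 8 * a ^ 3 * c *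
      (y' * z' * (x * fourth_side a b c d u) - y * z * (x' * fourth_side a b c d v))"
  unfolding conic_det_def fourth_side_def linear_form_def assms by (simp; algebra)+

text \<open>
  The lines 123, 145, 246, 356 form a quadrilateral with sides \<open>x\<close>, \<open>y\<close>, \<open>z\<close>, \<open>s\<close>. The three conics say that
  the points 7 and 8 give the same values of the cross ratios \<open>xy : zs\<close>, \<open>xz : ys\<close>, \<open>yz : xs\<close>. Hence
  8 arises from 7 by changing signs of the side forms, which puts 7 on a diagonal of the quadrilateral.
\<close>

lemma quadrilateral_signs:
  fixes x y z s x' y' z' s' :: "'a::field_char_0"
  assumes nz: "x \<noteq> 0" "y \<noteq> 0" "z \<noteq> 0" "s \<noteq> 0" "x' \<noteq> 0" "y' \<noteq> 0" "z' \<noteq> 0" "s' \<noteq> 0"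
    and eqs: "x * y * (z' * s') = x' * y' * (z * s)" "x * z * (y' * s') = x' * z' * (y * s)" "y * z * (x' * s') = y' * z' * (x * s)"
    and s: "s = \<alpha> * x + \<beta> * y + \<gamma> * z" "s' = \<alpha> * x' + \<beta> * y' + \<gamma> * z'"
  shows "x * s' = x' * s \<and> y * s' = y' * s \<and> z * s' = z' * s \<or>
    \<beta> * y + \<gamma> * z = 0 \<or> \<alpha> * x + \<gamma> * z = 0 \<or> \<alpha> * x + \<beta> * y = 0"
proof -
  \<comment> \<open>The two points are scaled so that the fourth side form takes the same value s s'
    at both.\<close>
  define X Y Z X' Y' Z' where "X = x * s'" "Y = y * s'" "Z = z * s'" "X' = x' * s" "Y' = y' * s" "Z' = z' * s"
  note defs = this
  \<comment> \<open>Multiplying two of the three equations leaves an equality of squares.\<close>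
  have "(X - X') * (X + X') * (y * z * y' * z') = 0" "(Y - Y') * (Y + Y') * (x * z * x' * z') = 0"
      "(Z - Z') * (Z + Z') * (x * y * x' * y') = 0"
    unfolding defs using eqs by algebra+
  then have signs: "X = X' \<or> X = - X'" "Y = Y' \<or> Y = - Y'" "Z = Z' \<or> Z = - Z'"
    using nz by (simp_all add: eq_neg_iff_add_eq_0)
  \<comment> \<open>This determines the product of the three signs, so the number of sign changes is
    even. With two changes, \<open>sum\<close> makes the two corresponding terms of the fourth side
    form cancel.\<close>
  have prod: "X * Y * Z' = X' * Y' * Z"
    unfolding defs using eqs(1) by algebra
  have sum: "\<alpha> * X + \<beta> * Y + \<gamma> * Z = \<alpha> * X' + \<beta> * Y' + \<gamma> * Z'"
    unfolding defs using s by algebra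
  have nz': "X \<noteq> 0" "Y \<noteq> 0" "Z \<noteq> 0" "X' \<noteq> 0" "Y' \<noteq> 0" "Z' \<noteq> 0"
    using nz by (simp_all add: defs)
  have double: "u = 0" if "u = - u" for u :: 'a
    using that by (simp add: eq_neg_iff_add_eq_0 flip: mult_2)
  have cancel: "v = 0" if "v * s' = 0" for v
    using that nz by simp
  consider "X = X'" "Y = Y'" "Z = Z'" | "X = X'" "Y = - Y'" "Z = - Z'" | "X = - X'" "Y = Y'" "Z = - Z'" |
      "X = - X'" "Y = - Y'" "Z = Z'" | "X * Y * Z' = - (X' * Y' * Z)"
    using signs by fastforce
  then show ?thesis
  proof cases
    case 1
    then show ?thesis by (simp add: defs)
  next
    case 2
    then have "\<beta> * Y + \<gamma> * Z = - (\<beta> * Y + \<gamma> * Z)" using sum by (simp add: algebra_simps)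
    then have "(\<beta> * y + \<gamma> * z) * s' = 0" using double[of "\<beta> * Y + \<gamma> * Z"] by (simp add: defs algebra_simps)
    then show ?thesis using cancel by blast
  next
    case 3
    then have "\<alpha> * X + \<gamma> * Z = - (\<alpha> * X + \<gamma> * Z)" using sum by (simp add: algebra_simps)
    then have "(\<alpha> * x + \<gamma> * z) * s' = 0" using double[of "\<alpha> * X + \<gamma> * Z"] by (simp add: defs algebra_simps)
    then show ?thesis using cancel by blast
  next
    case 4
    then have "\<alpha> * X + \<beta> * Y = - (\<alpha> * X + \<beta> * Y)" using sum by (simp add: algebra_simps)
    then have "(\<alpha> * x + \<beta> * y) * s' = 0" using double[of "\<alpha> * X + \<beta> * Y"] by (simp add: defs algebra_simps)
    then show ?thesis using cancel by blast
  next
    case 5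
    then have "X' * Y' * Z = 0" using prod double[of "X' * Y' * Z"] by simp
    then show ?thesis using nz' by simp
  qed
qed

lemma Q63_not_realizable:
  fixes P :: "nat \<Rightarrow> 'a::field_char_0 proj_plane"
  assumes inj: "inj_on P {1..8}" and P: "collinear_triples P = fst (pair_of (blocks K_Q63))"
    and P': "coconic_sextuples P = snd (pair_of (blocks K_Q63))"
  shows False
proof -
  have mem: "{i, j, k} \<in> collinear_triples P \<longleftrightarrow> in_line K_Q63 [i, j, k]"
    if "{i, j, k} \<subseteq> {1..8}" "i \<noteq> j" "i \<noteq> k" "j \<noteq> k" for i j k
    using mem_pair_of_blocks[OF that] by (simp add: P)
  have "\<not> in_line K_Q63 [1, 2, 4]" by code_simp
  then have base: "{1, 2, 4} \<notin> collinear_triples P" using mem[of 1 2 4] by simp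
  obtain q :: "nat \<Rightarrow> 'a triple" and D where D: "D \<noteq> 0"
    and q: "q 1 = (D, 0, 0)" "q 2 = (0, D, 0)" "q 4 = (0, 0, D)"
    and lin: "\<And>x y z. {x, y, z} \<subseteq> {1..8} \<Longrightarrow> x \<noteq> y \<Longrightarrow> x \<noteq> z \<Longrightarrow> y \<noteq> z \<Longrightarrow>
      {x, y, z} \<in> collinear_triples P \<longleftrightarrow> det3 (q x) (q y) (q z) = 0"
    and con: "\<And>a b c d e f. {a, b, c, d, e, f} \<in> coconic_sextuples P \<Longrightarrow>
      conic_det (q a) (q b) (q c) (q d) (q e) (q f) = 0"
    by (rule ex_coordinates[OF inj _ _ _ _ base], simp, simp, simp, simp, rule that, assumption+)
  have det: "det3 (q i) (q j) (q k) = 0 \<longleftrightarrow> in_line K_Q63 [i, j, k]"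
    if "{i, j, k} \<subseteq> {1..8}" "i \<noteq> j" "i \<noteq> k" "j \<noteq> k" for i j k
    using lin[OF that] mem[OF that] by simp
  have "in_line K_Q63 [1, 2, 3]" "in_line K_Q63 [1, 4, 5]" "in_line K_Q63 [2, 4, 6]" "in_line K_Q63 [3, 5, 6]"
      "\<not> in_line K_Q63 [2, 3, 4]" "\<not> in_line K_Q63 [1, 3, 4]" "\<not> in_line K_Q63 [2, 4, 5]"
      "\<not> in_line K_Q63 [1, 2, 5]" "\<not> in_line K_Q63 [1, 4, 6]"
      "\<not> in_line K_Q63 [2, 4, 7]" "\<not> in_line K_Q63 [1, 4, 7]" "\<not> in_line K_Q63 [1, 2, 7]" "\<not> in_line K_Q63 [3, 5, 7]"
      "\<not> in_line K_Q63 [2, 4, 8]" "\<not> in_line K_Q63 [1, 4, 8]" "\<not> in_line K_Q63 [1, 2, 8]" "\<not> in_line K_Q63 [3, 5, 8]"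
      "\<not> in_line K_Q63 [1, 7, 8]" "\<not> in_line K_Q63 [1, 6, 7]" "\<not> in_line K_Q63 [2, 5, 7]" "\<not> in_line K_Q63 [3, 4, 7]"
    by code_simp+
  then have dets: "det3 (q 1) (q 2) (q 3) = 0" "det3 (q 1) (q 4) (q 5) = 0" "det3 (q 2) (q 4) (q 6) = 0" "det3 (q 3) (q 5) (q 6) = 0"
    and nz: "det3 (q 2) (q 3) (q 4) \<noteq> 0" "det3 (q 1) (q 3) (q 4) \<noteq> 0" "det3 (q 2) (q 4) (q 5) \<noteq> 0"
      "det3 (q 1) (q 2) (q 5) \<noteq> 0" "det3 (q 1) (q 4) (q 6) \<noteq> 0"
      "det3 (q 2) (q 4) (q 7) \<noteq> 0" "det3 (q 1) (q 4) (q 7) \<noteq> 0" "det3 (q 1) (q 2) (q 7) \<noteq> 0" "det3 (q 3) (q 5) (q 7) \<noteq> 0"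
      "det3 (q 2) (q 4) (q 8) \<noteq> 0" "det3 (q 1) (q 4) (q 8) \<noteq> 0" "det3 (q 1) (q 2) (q 8) \<noteq> 0" "det3 (q 3) (q 5) (q 8) \<noteq> 0"
    and last: "det3 (q 1) (q 7) (q 8) \<noteq> 0" "det3 (q 1) (q 6) (q 7) \<noteq> 0" "det3 (q 2) (q 5) (q 7) \<noteq> 0" "det3 (q 3) (q 4) (q 7) \<noteq> 0"
    by (simp_all add: det)
  obtain a b b3 where q3: "q 3 = (a, b, b3)" by (cases "q 3")
  obtain c c2 d where q5: "q 5 = (c, c2, d)" by (cases "q 5")
  obtain e1 e f where q6: "q 6 = (e1, e, f)" by (cases "q 6")
  obtain x y z where q7: "q 7 = (x, y, z)" by (cases "q 7")
  obtain x' y' z' where q8: "q 8 = (x', y', z')" by (cases "q 8")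
  note coords = q q3 q5 q6 q7 q8
  have zero: "b3 = 0" "c2 = 0" "e1 = 0"
    using dets(1-3) D by (simp_all add: coords del: One_nat_def)
  have nonzero: "a \<noteq> 0" "b \<noteq> 0" "c \<noteq> 0" "d \<noteq> 0" "e \<noteq> 0"
      "x \<noteq> 0" "y \<noteq> 0" "z \<noteq> 0" "x' \<noteq> 0" "y' \<noteq> 0" "z' \<noteq> 0"
    using nz by (auto simp: coords zero simp del: One_nat_def)
  \<comment> \<open>The point 6 is where x = 0 meets the fourth side, so it is a multiple of (0, b
    c, - a d); \<open>k\<close> is the factor.\<close>
  define k where "k = e / (b * c)"
  have e: "e = b * c * k" using nonzero by (simp add: k_def)
  have "a * d * e + b * c * f = 0"
    using dets(4) by (simp add: coords zero algebra_simps neg_eq_iff_add_eq_0 del: One_nat_def)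
  then have "b * c * (f + a * d * k) = 0" unfolding e by algebra
  then have f: "f = - (a * d * k)" using nonzero by (simp add: eq_neg_iff_add_eq_0)
  have k: "k \<noteq> 0" using nonzero(5) e by auto
  let ?s = "fourth_side a b c d"
  have side: "?s t = det3 (q 3) (q 5) t" for t
    by (cases t) (simp add: fourth_side_def linear_form_def coords zero algebra_simps)
  have s: "?s (q 7) \<noteq> 0" "?s (q 8) \<noteq> 0"
    using nz side by simp_all
  have "in_conic K_Q63 [1, 2, 5, 6, 7, 8]" "in_conic K_Q63 [1, 3, 4, 6, 7, 8]" "in_conic K_Q63 [2, 3, 4, 5, 7, 8]"
    by code_simp+
  then have "{1, 2, 5, 6, 7, 8} \<in> coconic_sextuples P" "{1, 3, 4, 6, 7, 8} \<in> coconic_sextuples P"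
      "{2, 3, 4, 5, 7, 8} \<in> coconic_sextuples P"
    by (simp_all add: P' pair_of_def in_conic_iff)
  then have "conic_det (q 1) (q 2) (q 5) (q 6) (q 7) (q 8) = 0" "conic_det (q 1) (q 3) (q 4) (q 6) (q 7) (q 8) = 0"
      "conic_det (q 2) (q 3) (q 4) (q 5) (q 7) (q 8) = 0"
    by (simp_all only: con)
  note this[unfolded q q3 q5 q6 zero e f conic_det_quadrilateral[OF q7 q8]]
  then have eqs: "x * y * (z' * ?s (q 8)) = x' * y' * (z * ?s (q 7))" "x * z * (y' * ?s (q 8)) = x' * z' * (y * ?s (q 7))"
      "y * z * (x' * ?s (q 8)) = y' * z' * (x * ?s (q 7))"
    using nonzero D k by simp_all
  have "?s (q 7) = b * d * x + - (a * d) * y + - (b * c) * z" "?s (q 8) = b * d * x' + - (a * d) * y' + - (b * c) * z'"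
    by (simp_all add: fourth_side_def linear_form_def q7 q8)
  from quadrilateral_signs[OF nonzero(6-8) s(1) nonzero(9-11) s(2) eqs this]
  consider "y * ?s (q 8) = y' * ?s (q 7)" "z * ?s (q 8) = z' * ?s (q 7)" | "- (a * d) * y + - (b * c) * z = 0" |
      "b * d * x + - (b * c) * z = 0" | "b * d * x + - (a * d) * y = 0"
    by blast
  then show False
  proof cases
    case 1
    then have "(y * z' - z * y') * ?s (q 8) = 0" by algebra
    then have "y * z' = z * y'" using s(2) by simp
    \<comment> \<open>Coincidence of 7 and 8 is refuted through the collinearity of 1, 7, 8 that it
      would entail.\<close>
    then have "det3 (q 1) (q 7) (q 8) = 0" by (simp add: coords del: One_nat_def)
    with last(1) show False ..
  next
    case 2
    \<comment> \<open>In this and the following cases the vanishing partial sum is, up to a nonzero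
      factor, the equation of a diagonal evaluated at 7.\<close>
    have "det3 (q 1) (q 6) (q 7) = - (D * k * (- (a * d) * y + - (b * c) * z))"
      by (simp add: coords zero e f algebra_simps del: One_nat_def)
    with 2 last(2) show False by simp
  next
    case 3
    have "b * det3 (q 2) (q 5) (q 7) = D * (b * d * x + - (b * c) * z)"
      by (simp add: coords zero algebra_simps del: One_nat_def)
    also have "\<dots> = 0" by (simp only: 3 mult_zero_right)
    finally show False using last(3) nonzero by simp
  next
    case 4
    have "d * det3 (q 3) (q 4) (q 7) = D * (b * d * x + - (a * d) * y)"
      by (simp add: coords zero algebra_simps del: One_nat_def)
    also have "\<dots> = 0" by (simp only: 4 mult_zero_right)
    finally show False using last(4) nonzero by simp
  qed
qed

text \<open>\<open>Eis a b\<close> stands for \<open>a + b \<omega>\<close>, where \<open>\<omega>\<close> is a primitive third root of unity.\<close>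

datatype eisenstein = Eis int int

instantiation eisenstein :: comm_ring_1
begin

definition "0 = Eis 0 0"
definition "1 = Eis 1 0"

fun plus_eisenstein where "Eis a b + Eis c d = Eis (a + c) (b + d)"
fun minus_eisenstein where "Eis a b - Eis c d = Eis (a - c) (b - d)"
fun uminus_eisenstein where "- Eis a b = Eis (- a) (- b)"
text \<open>Multiplication is reduced by \<omega>^2 = - 1 - \<omega>.\<close>

fun times_eisenstein where "Eis a b * Eis c d = Eis (a * c - b * d) (a * d + b * c - b * d)"

instance
proof
  fix x y z :: eisenstein
  show "x + y + z = x + (y + z)" by (cases x; cases y; cases z) simp
  show "x + y = y + x" by (cases x; cases y) simp
  show "0 + x = x" by (cases x) (simp add: zero_eisenstein_def)
  show "- x + x = 0" by (cases x) (simp add: zero_eisenstein_def)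
  show "x - y = x + - y" by (cases x; cases y) simp
  show "x * y * z = x * (y * z)" by (cases x; cases y; cases z) (simp add: algebra_simps)
  show "x * y = y * x" by (cases x; cases y) (simp add: algebra_simps)
  show "1 * x = x" by (cases x) (simp add: one_eisenstein_def)
  show "(x + y) * z = x * z + y * z" by (cases x; cases y; cases z) (simp add: algebra_simps)
  show "(0 :: eisenstein) \<noteq> 1" by (simp add: zero_eisenstein_def one_eisenstein_def)
qed

end

text \<open>\<omega> is sent to (- 1 + i sqrt 3) / 2.\<close>

fun complex_of_eisenstein :: "eisenstein \<Rightarrow> complex" where
  "complex_of_eisenstein (Eis a b) = Complex (of_int a - of_int b / 2) (of_int b * sqrt 3 / 2)"

lemma ring_embedding_eisenstein: "ring_embedding complex_of_eisenstein"
proof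
  fix x y :: eisenstein
  show "complex_of_eisenstein (x + y) = complex_of_eisenstein x + complex_of_eisenstein y"
    by (cases x; cases y) (simp add: complex_eq_iff algebra_simps add_divide_distrib)
  show "complex_of_eisenstein (x * y) = complex_of_eisenstein x * complex_of_eisenstein y"
    by (cases x; cases y) (simp add: complex_eq_iff field_simps)
  show "complex_of_eisenstein x = 0 \<longleftrightarrow> x = 0"
    by (cases x) (auto simp: complex_eq_iff zero_eisenstein_def)
qed

text \<open>The coordinates come from the elimination in \<open>Q41_relation\<close> with a = b = c
  = d = e = 1 and f = \<omega>, so that s = 1 and t = \<omega>; the equations for 7 and 8 then fix
  these two points.\<close>

lemma Q41_realized:
  "realized_by K_Q41 [(Eis 1 0, Eis 0 0, Eis 0 0), (Eis 0 0, Eis 1 0, Eis 0 0), (Eis 1 0, Eis 1 0, Eis 0 0),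
     (Eis 0 0, Eis 0 0, Eis 1 0), (Eis 1 0, Eis 0 0, Eis 1 0), (Eis 0 0, Eis 1 0, Eis 0 1),
     (Eis 1 1, Eis 1 0, Eis 0 1), (Eis 1 0, Eis 0 (-1), Eis 1 0)]"
  by code_simp

subsection \<open>Relabelling\<close>

text \<open>The point that had label i now has label \<sigma>(i). An arbitrary family
  \<open>X\<close> of point sets covers lines and conics together.\<close>

lemma image_relabel:
  assumes \<sigma>: "\<sigma> permutes S"
  shows "{I. I \<subseteq> S \<and> card I = n \<and> (\<exists>L\<in>X. (P \<circ> inv \<sigma>) ` I \<subseteq> L)} =
    image \<sigma> ` {I. I \<subseteq> S \<and> card I = n \<and> (\<exists>L\<in>X. P ` I \<subseteq> L)}" (is "?A = image \<sigma> ` ?B")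
proof (intro equalityI subsetI)
  have card: "card (\<tau> ` I) = card I" "I \<subseteq> S \<Longrightarrow> \<tau> ` I \<subseteq> S" if "\<tau> permutes S" for \<tau> I
    using permutes_inj[OF that] permutes_image[OF that] by (auto simp: card_image inj_on_subset)
  fix I
  {
    assume "I \<in> ?A"
    moreover have "I = \<sigma> ` inv \<sigma> ` I"
      by (simp add: image_comp permutes_inv_o[OF \<sigma>])
    ultimately show "I \<in> image \<sigma> ` ?B"
      using card[OF permutes_inv[OF \<sigma>]] by (intro image_eqI[of _ _ "inv \<sigma> ` I"]) (auto simp: image_comp)
  next
    assume "I \<in> image \<sigma> ` ?B"
    then obtain I' where "I = \<sigma> ` I'" "I' \<in> ?B" by blast
    then show "I \<in> ?A"
      using card[OF \<sigma>] by (auto simp: image_comp o_def permutes_inverses[OF \<sigma>])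
  }
qed

lemma relabel_points:
  assumes "inj_on P {1..8}" "\<sigma> permutes {1..8}"
  shows "inj_on (P \<circ> inv \<sigma>) {1..8}" "collinear_triples (P \<circ> inv \<sigma>) = image \<sigma> ` collinear_triples P"
    "coconic_sextuples (P \<circ> inv \<sigma>) = image \<sigma> ` coconic_sextuples P"
proof -
  have "inv \<sigma> permutes {1..8}" using assms(2) by (rule permutes_inv)
  then show "inj_on (P \<circ> inv \<sigma>) {1..8}"
    using assms(1) by (intro comp_inj_on) (auto simp: permutes_image intro: inj_on_subset[OF permutes_inj])
qed (simp_all only: collinear_triples_def coconic_sextuples_def image_relabel[OF assms(2)])

lemma representable_permute:
  assumes "\<sigma> permutes {1..8}" "representable K Q"
  shows "representable K (permute_pair \<sigma> Q)"
  using assms relabel_points unfolding representable_def permute_pair_def by (metis fst_conv snd_conv)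

lemma matroidal_permute:
  assumes "\<sigma> permutes {1..8}" "matroidal Q"
  shows "matroidal (permute_pair \<sigma> Q)"
  using assms relabel_points unfolding matroidal_def permute_pair_def by (metis fst_conv)

lemma permute_pair_inv:
  assumes "\<sigma> permutes {1..8}"
  shows "permute_pair (inv \<sigma>) (permute_pair \<sigma> Q) = Q"
  by (simp add: permute_pair_def image_image permutes_inverses[OF assms])

lemma representable_permute_iff:
  assumes "\<sigma> permutes {1..8}"
  shows "representable K (permute_pair \<sigma> Q) \<longleftrightarrow> representable K Q"
  using representable_permute[OF assms] representable_permute[OF permutes_inv[OF assms]] permute_pair_inv[OF assms]
  by metis

lemma matroidal_permute_iff:
  assumes "\<sigma> permutes {1..8}"
  shows "matroidal (permute_pair \<sigma> Q) \<longleftrightarrow> matroidal Q"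
  using matroidal_permute[OF assms] matroidal_permute[OF permutes_inv[OF assms]] permute_pair_inv[OF assms]
  by metis

text \<open>A block with exactly 3 or 6 points contains only itself as a subset of that size, so
  here the pair is just the list of blocks. This links the catalogue entries to \<open>Q41\<close>
  and \<open>Q63\<close>.\<close>

lemma pair_of_minimal_blocks:
  assumes "\<And>b. b \<in> S \<Longrightarrow> points b \<subseteq> {1..8} \<and> card (points b) = min_points b"
  shows "pair_of S = ({L. Line L \<in> S}, {C. Conic C \<in> S})"
proof -
  have L: "L \<subseteq> {1..8}" "card L = 3" if "Line L \<in> S" for L
    using assms[OF that] by simp_all
  have C: "C \<subseteq> {1..8}" "card C = 6" if "Conic C \<in> S" for C
    using assms[OF that] by simp_all
  have eq: "A = B" if "A \<subseteq> B" "card A = card B" "B \<subseteq> {1..8}" for A B :: "nat set"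
    using that finite_subset[OF that(3)] by (intro card_subset_eq) simp_all
  have "{I. I \<subseteq> {1..8} \<and> card I = 3 \<and> (\<exists>L. Line L \<in> S \<and> I \<subseteq> L)} = {L. Line L \<in> S}"
  proof (intro Collect_cong iffI)
    fix I assume "I \<subseteq> {1..8} \<and> card I = 3 \<and> (\<exists>L. Line L \<in> S \<and> I \<subseteq> L)"
    then obtain L where *: "Line L \<in> S" "I \<subseteq> L" "card I = 3" by blast
    then have "I = L" using eq[of I L] L[OF *(1)] by simp
    with * show "Line I \<in> S" by simp
  qed (use L in blast)
  moreover have "{I. I \<subseteq> {1..8} \<and> card I = 6 \<and> (\<exists>C. Conic C \<in> S \<and> I \<subseteq> C)} = {C. Conic C \<in> S}"
  proof (intro Collect_cong iffI)
    fix I assume "I \<subseteq> {1..8} \<and> card I = 6 \<and> (\<exists>C. Conic C \<in> S \<and> I \<subseteq> C)"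
    then obtain C where *: "Conic C \<in> S" "I \<subseteq> C" "card I = 6" by blast
    then have "I = C" using eq[of I C] C[OF *(1)] by simp
    with * show "Conic I \<in> S" by simp
  qed (use C in blast)
  ultimately show ?thesis
    by (simp only: pair_of_def)
qed

lemma Collect_block_insert:
  "{L. Line L \<in> insert (Line A) S} = insert A {L. Line L \<in> S}"
  "{L. Line L \<in> insert (Conic A) S} = {L. Line L \<in> S}"
  "{L. Conic L \<in> insert (Line A) S} = {L. Conic L \<in> S}"
  "{L. Conic L \<in> insert (Conic A) S} = insert A {L. Conic L \<in> S}"
  by auto

lemma blocks_simps:
  "blocks [] = {}"
  "blocks (Line xs # R) = insert (Line (set xs)) (blocks R)"
  "blocks (Conic xs # R) = insert (Conic (set xs)) (blocks R)"
  by (simp_all add: blocks_def)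

lemma pair_of_K_Q41: "pair_of (blocks K_Q41) = Q41"
proof -
  have "pair_of (blocks K_Q41) = ({L. Line L \<in> blocks K_Q41}, {C. Conic C \<in> blocks K_Q41})"
    by (rule pair_of_minimal_blocks) (auto simp: blocks_simps K_Q41_def)
  then show ?thesis
    unfolding K_Q41_def blocks_simps Collect_block_insert by (simp add: Q41_def)
qed

lemma pair_of_K_Q63: "pair_of (blocks K_Q63) = Q63"
proof -
  have "pair_of (blocks K_Q63) = ({L. Line L \<in> blocks K_Q63}, {C. Conic C \<in> blocks K_Q63})"
    by (rule pair_of_minimal_blocks) (auto simp: blocks_simps K_Q63_def)
  then show ?thesis
    unfolding K_Q63_def blocks_simps Collect_block_insert by (simp add: Q63_def)
qed

lemma not_matroidal_fano: "\<not> matroidal (pair_of (blocks K_fano))"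
proof
  assume "matroidal (pair_of (blocks K_fano))"
  then obtain P :: "nat \<Rightarrow> complex proj_plane" where P: "inj_on P {1..8}"
      "collinear_triples P = fst (pair_of (blocks K_fano))"
    unfolding matroidal_def by blast
  show False
    by (rule fano_not_realizable[OF P(1), of 1 2 3 4 5 6 7])
       (simp_all add: P(2) mem_pair_of_blocks in_line_def K_fano_def)
qed

lemma not_matroidal_fano_with_point: "\<not> matroidal (pair_of (blocks K_fano_point))"
proof
  assume "matroidal (pair_of (blocks K_fano_point))"
  then obtain P :: "nat \<Rightarrow> complex proj_plane" where P: "inj_on P {1..8}"
      "collinear_triples P = fst (pair_of (blocks K_fano_point))"
    unfolding matroidal_def by blast
  \<comment> \<open>The point 4 is left out; the other seven form a Fano plane.\<close>
  show False
    by (rule fano_not_realizable[OF P(1), of 1 2 3 5 6 7 8])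
       (simp_all add: P(2) mem_pair_of_blocks in_line_def K_fano_point_def)
qed

section \<open>Representability of the candidates\<close>

lemma Q41_not_representable: "\<not> representable TYPE('a::linordered_field) Q41"
  using Q41_not_realizable[where 'a = 'a] unfolding representable_def pair_of_K_Q41 by blast

lemma Q63_not_representable: "\<not> representable TYPE('a::field_char_0) Q63"
  using Q63_not_realizable[where 'a = 'a] unfolding representable_def pair_of_K_Q63 by blast

text \<open>Bezout's criteria lead to a catalogue entry. Matroidality discards the two entries that
  contain the Fano plane, which leaves the integer realizations and the two exceptional
  orbits.\<close>

lemma candidate_representable_or_exceptional:
  assumes "candidate_quatroid Q"
  shows "representable TYPE(rat) Q \<or> Q \<in> S8_orbit Q41 \<union> S8_orbit Q63"
proof -
  obtain S where S: "configuration S" "pair_of S = Q"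
    using bezout_configuration assms unfolding candidate_quatroid_def by blast
  obtain R \<sigma> where R: "R \<in> catalogue" "\<sigma> permutes {1..8}" "S = map_block (image \<sigma>) ` blocks R"
    using configuration_classification[OF extension_closed_catalogue S(1)] by blast
  then have Q: "Q = permute_pair \<sigma> (pair_of (blocks R))"
    using S(2) permute_pair_of[OF R(2)] by simp
  have "matroidal (pair_of (blocks R))"
    using assms matroidal_permute_iff[OF R(2)] unfolding candidate_quatroid_def Q by blast
  then have "R \<noteq> K_fano" "R \<noteq> K_fano_point"
    using not_matroidal_fano not_matroidal_fano_with_point by blast+
  then consider "R \<notin> {K_fano, K_Q63, K_fano_point, K_Q41}" | "R = K_Q41" | "R = K_Q63"
    by blast
  then show ?thesis
  proof cases
    case 1
    then show ?thesis
      using catalogue_representable[OF R(1), where 'a = rat] representable_permute[OF R(2)] unfolding Q by blast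
  next
    case 2
    then show ?thesis
      using R(2) unfolding Q S8_orbit_def by (auto simp: pair_of_K_Q41)
  next
    case 3
    then show ?thesis
      using R(2) unfolding Q S8_orbit_def by (auto simp: pair_of_K_Q63)
  qed
qed

theorem theorem3p20:
  "(\<forall>Q. candidate_quatroid Q \<longrightarrow>
      (representable TYPE(rat) Q \<longleftrightarrow> Q \<notin> S8_orbit Q41 \<union> S8_orbit Q63)) \<and>
   (\<forall>Q \<in> S8_orbit Q41. representable TYPE(complex) Q \<and> \<not> representable TYPE(real) Q) \<and>
   (\<forall>Q \<in> S8_orbit Q63. \<not> representable TYPE(complex) Q)"
proof -
  \<comment> \<open>Representability is constant on orbits, so \<open>Q41\<close> and
    \<open>Q63\<close> themselves decide. For \<open>Q41\<close> the rational and the real case both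
    follow from the ordering of the field, for \<open>Q63\<close> the rational and the complex case
    from characteristic 0.\<close>
  have orbit: "representable K Q \<longleftrightarrow> representable K Q'" if "Q \<in> S8_orbit Q'" for K :: "'a::field itself" and Q Q'
    using that representable_permute_iff unfolding S8_orbit_def by blast
  have "representable TYPE(complex) Q41"
    using realized_by_representable[OF ring_embedding_eisenstein Q41_realized] by (simp only: pair_of_K_Q41)
  then have Q41: "representable TYPE(complex) Q" "\<not> representable TYPE(rat) Q" "\<not> representable TYPE(real) Q"
    if "Q \<in> S8_orbit Q41" for Q
    using orbit[OF that] Q41_not_representable by metis+
  have Q63: "\<not> representable TYPE(rat) Q" "\<not> representable TYPE(complex) Q" if "Q \<in> S8_orbit Q63" for Q
    using orbit[OF that] Q63_not_representable by metis+
  show ?thesis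
    using candidate_representable_or_exceptional Q41 Q63 by (intro conjI allI ballI impI iffI) auto
qed

end
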